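(* Let $(\Sigma,\sigma)$ be a transitive countable Markov shift satisfying the $\mathcal{F}$-property. Then the space $\mathcal{M}(\Sigma,\sigma)$ of $\sigma$-invariant Borel probability measures, endowed with the weak* topology, is affinely homeomorphic to the Poulsen simplex minus a vertex and all of its convex combinations; that is, there are a Poulsen simplex $K$ and an extreme point $v$ of $K$ such that $\mathcal{M}(\Sigma,\sigma)$ is affinely homeomorphic to $K\setminus\{\lambda x+(1-\lambda)v : x\in K,\ 0\le\lambda<1\}$.
   Context: Let $\mathbb{N}=\{1,2,\dots\}$ and let $B=(B(i,j))_{i,j\in\mathbb{N}}$ be a matrix with entries in $\{0,1\}$ having no zero row and no zero column. The (one-sided) countable Markov shift defined by $B$ is $\Sigma=\{(x_n)_{n\in\mathbb{N}}\in\mathbb{N}^{\mathbb{N}}: B(x_n,x_{n+1})=1 \text{ for all } n\}$ with the shift map $\sigma(x_1,x_2,\dots)=(x_2,x_3,\dots)$. A cylinder of length $n$ is $[a_1\dots a_n]=\{x\in\Sigma: x_j=a_j,\ 1\le j\le n\}$; $\Sigma$ has the topology generated by cylinders. A word $a_1\dots a_n$ is admissible if $[a_1\dots a_n]\neq\emptyset$. $(\Sigma,\sigma)$ is transitive if for all nonempty open $U,V\subset\Sigma$ there is $n\in\mathbb{N}$ with $U\cap\sigma^{-n}V\ne\emptyset$. $\mathcal{F}$-property: for every symbol $i\in\mathbb{N}$ and every $n\in\mathbb{N}$ there are only finitely many admissible words of length $n$ starting and ending at $i$. The weak* topology on probability measures is the coarsest topology making $\mu\mapsto\int f\,d\mu$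 continuous for every bounded continuous $f:\Sigma\to\mathbb{R}$. A Poulsen simplex is a metrizable compact convex Choquet simplex with at least two points whose extreme points are dense; it is unique up to affine homeomorphism. *)

theory Defs
  imports "HOL-Probability.Probability"
begin

(* Conventions: both the alphabet and the time index {1,2,...} are rendered by the type nat,
   i.e. shifted by one; a 0-1 matrix is a relation B :: nat => nat => bool. *)

section \<open>Countable Markov shifts\<close>

definition markov_shift :: "(nat \<Rightarrow> nat \<Rightarrow> bool) \<Rightarrow> (nat \<Rightarrow> nat) set" where
  "markov_shift B = {x. \<forall>n. B (x n) (x (Suc n))}"

definition shift_map :: "(nat \<Rightarrow> nat) \<Rightarrow> (nat \<Rightarrow> nat)" where
  "shift_map x = (\<lambda>n. x (Suc n))"

definition no_zero_row_or_column :: "(nat \<Rightarrow> nat \<Rightarrow> bool) \<Rightarrow> bool" where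
  "no_zero_row_or_column B \<longleftrightarrow> (\<forall>i. \<exists>j. B i j) \<and> (\<forall>j. \<exists>i. B i j)"

definition cylinder :: "(nat \<Rightarrow> nat \<Rightarrow> bool) \<Rightarrow> nat list \<Rightarrow> (nat \<Rightarrow> nat) set" where
  "cylinder B w = {x \<in> markov_shift B. \<forall>j < length w. x j = w ! j}"

definition markov_topology :: "(nat \<Rightarrow> nat \<Rightarrow> bool) \<Rightarrow> (nat \<Rightarrow> nat) topology" where
  "markov_topology B = topology_generated_by {cylinder B w | w. w \<noteq> []}"

definition admissible :: "(nat \<Rightarrow> nat \<Rightarrow> bool) \<Rightarrow> nat list \<Rightarrow> bool" where
  "admissible B w \<longleftrightarrow> cylinder B w \<noteq> {}"

definition transitive_shift :: "(nat \<Rightarrow> nat \<Rightarrow> bool) \<Rightarrow> bool" where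
  "transitive_shift B \<longleftrightarrow>
    (\<forall>U V. openin (markov_topology B) U \<and> U \<noteq> {} \<and> openin (markov_topology B) V \<and> V \<noteq> {} \<longrightarrow>
       (\<exists>n\<ge>1. U \<inter> (shift_map ^^ n) -` V \<noteq> {}))"

definition F_property :: "(nat \<Rightarrow> nat \<Rightarrow> bool) \<Rightarrow> bool" where
  "F_property B \<longleftrightarrow>
    (\<forall>i. \<forall>n\<ge>1. finite {w. admissible B w \<and> length w = n \<and> hd w = i \<and> last w = i})"

section \<open>Spaces of probability measures and the weak* topology\<close>

definition borel_measure_of :: "'a topology \<Rightarrow> 'a measure" where
  "borel_measure_of X = sigma (topspace X) {U. openin X U}"

definition borel_probs :: "'a topology \<Rightarrow> 'a measure set" where
  "borel_probs X = {\<mu>. sets \<mu> = sets (borel_measure_of X) \<and> prob_space \<mu>}"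

definition weak_star_topology :: "'a topology \<Rightarrow> 'a measure topology" where
  "weak_star_topology X = topology_generated_by
    {{\<mu> \<in> borel_probs X. (\<integral>x. f x \<partial>\<mu>) \<in> U} | f U.
       continuous_map X euclideanreal f \<and> bounded (f ` topspace X) \<and> open U}"

definition invariant_probs :: "(nat \<Rightarrow> nat \<Rightarrow> bool) \<Rightarrow> (nat \<Rightarrow> nat) measure set" where
  "invariant_probs B = {\<mu> \<in> borel_probs (markov_topology B).
     \<forall>A \<in> sets \<mu>. emeasure \<mu> (shift_map -` A \<inter> markov_shift B) = emeasure \<mu> A}"

definition invariant_probs_topology :: "(nat \<Rightarrow> nat \<Rightarrow> bool) \<Rightarrow> (nat \<Rightarrow> nat) measure topology" where
  "invariant_probs_topology B =
     subtopology (weak_star_topology (markov_topology B)) (invariant_probs B)"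

definition mix :: "real \<Rightarrow> 'a measure \<Rightarrow> 'a measure \<Rightarrow> 'a measure" where
  "mix t \<mu> \<nu> = measure_of (space \<mu>) (sets \<mu>)
     (\<lambda>A. ennreal t * emeasure \<mu> A + ennreal (1 - t) * emeasure \<nu> A)"

(* measure_of yields the null measure unless its argument is countably additive;
   this is the case here: *)
lemma emeasure_mix:
  assumes "sets \<mu> = sets \<nu>" "A \<in> sets \<mu>"
  shows "emeasure (mix t \<mu> \<nu>) A = ennreal t * emeasure \<mu> A + ennreal (1 - t) * emeasure \<nu> A"
  unfolding mix_def
proof (rule emeasure_measure_of_sigma)
  show "sigma_algebra (space \<mu>) (sets \<mu>)" ..
  show "positive (sets \<mu>) (\<lambda>A. ennreal t * emeasure \<mu> A + ennreal (1 - t) * emeasure \<nu> A)"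
    by (simp add: positive_def)
  show "countably_additive (sets \<mu>) (\<lambda>A. ennreal t * emeasure \<mu> A + ennreal (1 - t) * emeasure \<nu> A)"
  proof (rule countably_additiveI)
    fix F :: "nat \<Rightarrow> 'a set"
    assume F: "range F \<subseteq> sets \<mu>" "disjoint_family F" "\<Union> (range F) \<in> sets \<mu>"
    have "(\<Sum>i. ennreal t * emeasure \<mu> (F i) + ennreal (1 - t) * emeasure \<nu> (F i))
        = (\<Sum>i. ennreal t * emeasure \<mu> (F i)) + (\<Sum>i. ennreal (1 - t) * emeasure \<nu> (F i))"
      by (rule suminf_add[symmetric]) auto
    also have "\<dots> = ennreal t * emeasure \<mu> (\<Union> (range F)) + ennreal (1 - t) * emeasure \<nu> (\<Union> (range F))"
      using F assms(1) by (simp add: suminf_emeasure ennreal_suminf_cmult)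
    finally show "(\<Sum>i. ennreal t * emeasure \<mu> (F i) + ennreal (1 - t) * emeasure \<nu> (F i))
        = ennreal t * emeasure \<mu> (\<Union> (range F)) + ennreal (1 - t) * emeasure \<nu> (\<Union> (range F))" .
  qed
  show "A \<in> sets \<mu>" by fact
qed

definition affine_on_measures :: "'a measure set \<Rightarrow> ('a measure \<Rightarrow> 'b::real_vector) \<Rightarrow> bool" where
  "affine_on_measures M h \<longleftrightarrow>
    (\<forall>\<mu>\<in>M. \<forall>\<nu>\<in>M. \<forall>t\<in>{0..1}. h (mix t \<mu> \<nu>) = t *\<^sub>R h \<mu> + (1 - t) *\<^sub>R h \<nu>)"

section \<open>The Poulsen simplex\<close>

class locally_convex_space = real_vector + topological_group_add + t2_space +
  assumes tendsto_scaleR_lcs: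
    "filterlim (\<lambda>p. fst p *\<^sub>R snd p) (nhds (r *\<^sub>R a)) (nhds r \<times>\<^sub>F nhds a)"
  (* convexity of C is written out because the constant convex is not available in a class
     specification *)
  assumes convex_nhds_base:
    "open U \<Longrightarrow> 0 \<in> U \<Longrightarrow> \<exists>C. open C \<and>
       (\<forall>x\<in>C. \<forall>y\<in>C. \<forall>u\<ge>0. \<forall>v\<ge>0. u + v = 1 \<longrightarrow> u *\<^sub>R x + v *\<^sub>R y \<in> C) \<and> 0 \<in> C \<and> C \<subseteq> U"

instance real_normed_vector \<subseteq> locally_convex_space
proof
  fix r :: real and a :: 'a
  show "filterlim (\<lambda>p. fst p *\<^sub>R snd p) (nhds (r *\<^sub>R a)) (nhds r \<times>\<^sub>F nhds a)"
    by (intro tendsto_scaleR filterlim_fst filterlim_snd)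
next
  fix U :: "'a set"
  assume "open U" "0 \<in> U"
  then obtain e where "e > 0" "ball 0 e \<subseteq> U"
    using openE by blast
  then show "\<exists>C. open C \<and>
       (\<forall>x\<in>C. \<forall>y\<in>C. \<forall>u\<ge>0. \<forall>v\<ge>0. u + v = 1 \<longrightarrow> u *\<^sub>R x + v *\<^sub>R y \<in> C) \<and> 0 \<in> C \<and> C \<subseteq> U"
    using convex_ball[of "0::'a" e] unfolding convex_def
    by (intro exI[of _ "ball 0 e"] conjI) simp_all
qed

definition extreme_points :: "'a::real_vector set \<Rightarrow> 'a set" where
  "extreme_points K = {x. x extreme_point_of K}"

definition barycenter_of :: "'a::locally_convex_space set \<Rightarrow> 'a measure \<Rightarrow> 'a \<Rightarrow> bool" where
  "barycenter_of K m x \<longleftrightarrow>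
    (\<forall>f :: 'a \<Rightarrow> real. linear f \<and> continuous_on UNIV f \<longrightarrow> (\<integral>y. f y \<partial>m) = f x)"

(* For metrizable K the set of extreme points is a Borel (indeed G_delta) set. *)
definition metrizable_choquet_simplex :: "'a::locally_convex_space set \<Rightarrow> bool" where
  "metrizable_choquet_simplex K \<longleftrightarrow>
    compact K \<and> convex K \<and> metrizable_space (top_of_set K) \<and>
    (\<forall>x\<in>K. \<exists>!m. m \<in> borel_probs (top_of_set K) \<and> emeasure m (extreme_points K) = 1 \<and> barycenter_of K m x)"

definition poulsen_simplex :: "'a::locally_convex_space set \<Rightarrow> bool" where
  "poulsen_simplex K \<longleftrightarrow>
    metrizable_choquet_simplex K \<and> (\<exists>x\<in>K. \<exists>y\<in>K. x \<noteq> y) \<and> K \<subseteq> closure (extreme_points K)"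

(* A type cannot be existentially quantified, so the existence of a Poulsen simplex is asserted
   inside a fixed space, the Banach space of bounded real sequences. Nothing is lost: if (f_k) are
   continuous affine functions K -> [0,1] separating the points of a metrizable compact convex
   set K, then x |-> (f_k(x) / (k+1))_k is an affine homeomorphism of K onto a subset of it. *)
type_synonym bounded_seq = "nat \<Rightarrow>\<^sub>C real"

end

theory Submission
  imports Defs
begin

text \<open>
  Adding a cemetery letter with a single loop turns the sub-probability measures invariant under the
  shift into a set \<open>K\<close> of invariant probability measures, embedded into the bounded sequences by their
  values on cylinders. The only mass that can escape in a limit of such measures escapes to the
  cemetery: the set of points that start in \<open>i\<close> and avoid \<open>i\<close> for the next \<open>n\<close> steps has mass at most
  \<open>1 / (n + 1)\<close>, and up to this mass the \<open>F\<close>-property leaves finitely many neighbours of \<open>i\<close>, so \<open>K\<close>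
  is compact. By Birkhoff's theorem, the measure of frequencies of a point is defined almost
  everywhere; it is the ergodic decomposition, and it shows that every point of \<open>K\<close> has exactly one
  representing measure on the extreme points. Periodic orbit measures are extreme, and they are dense:
  an invariant measure is an average of frequencies in long words, long words close up to loops, loops
  can be concatenated in any proportion, and loops through far away letters approximate the zero
  measure. The zero measure is the vertex \<open>v\<close>, and the points of \<open>K\<close> without a component at \<open>v\<close> are the
  invariant probability measures of the shift.
\<close>

section \<open>Cylinders and the extension theorem\<close>

text \<open>The topology of \<open>K\<close> is convergence of the values on words that begin with a
  letter other than \<open>0\<close>. The mass of the cemetery is one minus a series of such values,
  so it is not continuous; this is what lets mass on letters tending to infinity reappear there, and
  why cylinders starting with \<open>0\<close> must not be coordinates. The obstacle is a limit of
  coordinates that is no longer additive: a word could lose mass to its extensions by large letters.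
  Additivity on the right makes a measure and additivity on the left makes it invariant, so both the
  successors and the predecessors of a letter have to be controlled uniformly over all invariant
  measures. On measures without cemetery mass the topology is the weak* topology of the shift,
  because a limit of total mass one leaves no room for escape. Ergodicity is expressed throughout by
  frequencies of words instead of invariant sets: there are only countably many words, so
  extremality becomes countably many equations between integrals, and in this way the extreme points
  are seen to form a Borel set.\<close>

definition cyl :: "nat list \<Rightarrow> (nat \<Rightarrow> nat) set" where
  "cyl w = {x. \<forall>j<length w. x j = w ! j}"

lemma cyl_Nil [simp]: "cyl [] = UNIV"
  by (simp add: cyl_def)

lemma in_cyl_iff: "x \<in> cyl w \<longleftrightarrow> map x [0..<length w] = w"
  unfolding cyl_def by (subst list_eq_iff_nth_eq) simp

lemma in_cyl_map [simp]: "x \<in> cyl (map x [0..<n])"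
  by (simp add: cyl_def)

lemma shift_map_pow: "(shift_map ^^ k) x = (\<lambda>n. x (n + k))"
  by (induction k arbitrary: x) (auto simp: shift_map_def)

lemma cyl_snoc: "x \<in> cyl (w @ [a]) \<longleftrightarrow> x \<in> cyl w \<and> x (length w) = a"
  by (auto simp: cyl_def nth_append less_Suc_eq)

lemma cyl_Cons: "x \<in> cyl (a # w) \<longleftrightarrow> x 0 = a \<and> shift_map x \<in> cyl w"
  by (auto simp: cyl_def shift_map_def nth_Cons split: nat.splits)

lemma cyl_append: "x \<in> cyl (u @ w) \<longleftrightarrow> x \<in> cyl u \<and> (shift_map ^^ length u) x \<in> cyl w"
proof (induction u arbitrary: x)
  case (Cons a u)
  then show ?case by (simp add: cyl_Cons funpow_swap1)
qed simp

text \<open>Either the shorter word is a prefix of the longer one, and the cylinders are nested, or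
  the words differ at some position, and they are disjoint. The empty set is added because no
  cylinder in the full sequence space is empty.\<close>

lemma cyl_inter: "cyl u \<inter> cyl w \<in> insert {} (range cyl)"
proof -
  have "cyl u \<inter> cyl w \<in> insert {} (range cyl)" if "length u \<le> length w" for u w
  proof (cases "take (length u) w = u")
    case True
    then have "cyl w \<subseteq> cyl u"
      using cyl_append[of _ u "drop (length u) w"] append_take_drop_id[of "length u" w] by auto
    then show ?thesis by (simp add: Int_absorb1)
  next
    case False
    then have "cyl u \<inter> cyl w = {}"
      using that unfolding cyl_def by (subst (asm) list_eq_iff_nth_eq) auto
    then show ?thesis by simp
  qed
  then show ?thesis
    by (metis Int_commute nat_le_linear)
qed

lemma Int_stable_cyl: "Int_stable (insert {} (range cyl))"
proof (rule Int_stableI)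
  fix A B assume "A \<in> insert {} (range cyl)" "B \<in> insert {} (range cyl)"
  then show "A \<inter> B \<in> insert {} (range cyl)"
    using cyl_inter by auto
qed

text \<open>The Borel sets are those of the product topology, hence generated by the coordinates; a
  condition on the coordinate \<open>i\<close> is a countable union of cylinders over all prefixes
  of length \<open>i\<close>.\<close>

lemma sets_borel_cyl: "sets (borel :: (nat \<Rightarrow> nat) measure) = sigma_sets UNIV (insert {} (range cyl))"
proof
  let ?M = "sigma UNIV (insert {} (range cyl)) :: (nat \<Rightarrow> nat) measure"
  have "(\<lambda>x. x) \<in> borel_measurable ?M"
  proof (rule measurable_coordinatewise_then_product)
    fix i
    have "{x. x i = a} \<in> sets ?M" for a :: nat
    proof -
      have "{x. x i = a} = (\<Union>u\<in>{u. length u = i}. cyl (u @ [a]))"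
      proof (intro equalityI subsetI)
        fix x assume "x \<in> {x. x i = a}"
        then have "x \<in> cyl (map x [0..<i] @ [a])" by (simp add: cyl_snoc)
        then show "x \<in> (\<Union>u\<in>{u. length u = i}. cyl (u @ [a]))" by force
      qed (auto simp: cyl_snoc)
      also have "\<dots> \<in> sets ?M"
        by (intro sets.countable_UN'') auto
      finally show ?thesis .
    qed
    then have "(\<lambda>x. x i) \<in> ?M \<rightarrow>\<^sub>M count_space UNIV"
      by (subst measurable_count_space_eq_countable) (auto simp: vimage_def)
    then show "(\<lambda>x. x i) \<in> borel_measurable ?M"
      by (rule measurable_compose) simp
  qed
  then have "A \<in> sets ?M" if "A \<in> sets borel" for A
    using measurable_sets[OF _ that, of "\<lambda>x. x" ?M] by simp
  then show "sets borel \<subseteq> sigma_sets UNIV (insert {} (range cyl))"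
    by (auto simp: sets_measure_of_conv)
next
  have "cyl w \<in> sets borel" for w
  proof -
    have "cyl w = (\<Inter>j\<in>{..<length w}. {x. x j = w ! j}) "
      by (auto simp: cyl_def)
    moreover have "{x\<in>space borel. x j = a} \<in> sets (borel :: (nat \<Rightarrow> nat) measure)" for j a
      by measurable
    ultimately show ?thesis
      by (auto intro!: sets.countable_INT'')
  qed
  then show "sigma_sets UNIV (insert {} (range cyl)) \<subseteq> sets (borel :: (nat \<Rightarrow> nat) measure)"
    by (intro sets.sigma_sets_subset') auto
qed

lemma cyl_sets [measurable, simp]: "cyl w \<in> sets borel"
  by (simp add: sets_borel_cyl sigma_sets.Basic)

lemma shift_map_measurable [measurable]: "shift_map \<in> borel \<rightarrow>\<^sub>M (borel :: (nat \<Rightarrow> nat) measure)"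
  unfolding shift_map_def
  by (rule measurable_coordinatewise_then_product) measurable

lemma shift_map_pow_measurable [measurable]: "(shift_map ^^ k) \<in> borel \<rightarrow>\<^sub>M (borel :: (nat \<Rightarrow> nat) measure)"
proof (induction k)
  case (Suc k)
  then show ?case
    unfolding funpow.simps by (rule measurable_comp[OF _ shift_map_measurable])
qed simp

lemma measure_eqI_cyl:
  assumes "sets \<mu> = sets borel" "sets \<nu> = sets borel" "prob_space \<mu>"
    and "\<And>w. emeasure \<mu> (cyl w) = emeasure \<nu> (cyl w)"
  shows "\<mu> = \<nu>"
proof (rule measure_eqI_generator_eq[OF Int_stable_cyl, where A="\<lambda>_. UNIV"])
  interpret prob_space \<mu> by fact
  show "emeasure \<mu> UNIV \<noteq> \<infinity>" by simp
  show "range (\<lambda>_. UNIV) \<subseteq> insert {} (range cyl)"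
    by (metis cyl_Nil image_subset_iff insertCI rangeI)
  show "sets \<mu> = sigma_sets UNIV (insert {} (range cyl))" "sets \<nu> = sigma_sets UNIV (insert {} (range cyl))"
    using assms sets_borel_cyl by metis+
  show "emeasure \<mu> X = emeasure \<nu> X" if "X \<in> insert {} (range cyl)" for X
    using that assms(4) by auto
qed simp_all

section \<open>Measures with prescribed values on cylinders\<close>

definition consistent :: "(nat list \<Rightarrow> real) \<Rightarrow> bool" where
  "consistent q \<longleftrightarrow> (\<forall>w. 0 \<le> q w) \<and> q [] = 1 \<and> (\<forall>w. (\<lambda>a. q (w @ [a])) sums q w)"

text \<open>For consistent \<open>q\<close>, this is the mass of the words of the same length that
  precede \<open>w\<close> lexicographically, sorted by the first position \<open>j\<close> of
  difference.\<close>

definition left_end :: "(nat list \<Rightarrow> real) \<Rightarrow> nat list \<Rightarrow> real" where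
  "left_end q w = (\<Sum>j<length w. \<Sum>b<w ! j. q (take j w @ [b]))"

lemma left_end_snoc: "left_end q (w @ [a]) = left_end q w + (\<Sum>b<a. q (w @ [b]))"
  by (simp add: left_end_def nth_append)

primrec interval_word :: "(nat list \<Rightarrow> real) \<Rightarrow> real \<Rightarrow> nat \<Rightarrow> nat list" where
  "interval_word q t 0 = []"
| "interval_word q t (Suc n) = interval_word q t n @
     [LEAST a. t < left_end q (interval_word q t n @ [a]) + q (interval_word q t n @ [a])]"

lemma length_interval_word [simp]: "length (interval_word q t n) = n"
  by (induction n) auto

text \<open>The intervals of the words \<open>w @ [a]\<close> tile the interval of \<open>w\<close>
  from left to right, so \<open>t\<close> lies in exactly one of them, and \<open>LEAST\<close>
  picks the first one that ends beyond \<open>t\<close>.\<close>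

lemma interval_word_iff:
  assumes "consistent q" "0 \<le> t" "t < 1"
  shows "interval_word q t (length w) = w \<longleftrightarrow> left_end q w \<le> t \<and> t < left_end q w + q w"
proof (induction w rule: rev_induct)
  case Nil
  then show ?case using assms by (simp add: left_end_def consistent_def)
next
  case (snoc a w)
  define P where "P b \<longleftrightarrow> t < left_end q (w @ [b]) + q (w @ [b])" for b
  have P: "P b \<longleftrightarrow> t < left_end q w + (\<Sum>c<Suc b. q (w @ [c]))" for b
    by (simp add: P_def left_end_snoc algebra_simps)
  have nn: "q u \<ge> 0" for u using assms by (simp add: consistent_def)
  have su: "(\<lambda>a. q (w @ [a])) sums q w" using assms by (simp add: consistent_def)
  have le: "(\<Sum>c<b. q (w @ [c])) \<le> q w" for b
    using su nn by (metis sum_le_suminf sums_iff finite_lessThan)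
  show ?case
  proof
    assume "interval_word q t (length (w @ [a])) = w @ [a]"
    then have w: "interval_word q t (length w) = w" and a: "(LEAST b. P b) = a"
      by (auto simp: P_def)
    from w snoc have t: "left_end q w \<le> t" "t < left_end q w + q w" by auto
    \<comment> \<open>The partial sums reach up to the right end of the interval of
      \<open>w\<close>, so some child interval ends beyond \<open>t\<close> and \<open>LEAST\<close>
      is attained.\<close>
    have "(\<lambda>n. left_end q w + (\<Sum>c<n. q (w @ [c]))) \<longlonglongrightarrow> left_end q w + q w"
      using su unfolding sums_def by (intro tendsto_intros)
    then have "eventually (\<lambda>n. t < left_end q w + (\<Sum>c<n. q (w @ [c]))) sequentially"
      using t(2) by (rule order_tendstoD)
    then obtain n where n: "\<And>m. m \<ge> n \<Longrightarrow> t < left_end q w + (\<Sum>c<m. q (w @ [c]))"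
      by (auto simp: eventually_sequentially)
    have "P n" unfolding P by (rule n) simp
    then have "P a" using LeastI[of P n] a by simp
    moreover have "left_end q (w @ [a]) \<le> t"
    proof (cases a)
      case 0
      then show ?thesis using t by (simp add: left_end_snoc)
    next
      case (Suc b)
      then have "\<not> P b" using a not_less_Least[of b P] by simp
      then show ?thesis using Suc by (simp add: P left_end_snoc)
    qed
    ultimately show "left_end q (w @ [a]) \<le> t \<and> t < left_end q (w @ [a]) + q (w @ [a])"
      by (simp add: P_def)
  next
    assume *: "left_end q (w @ [a]) \<le> t \<and> t < left_end q (w @ [a]) + q (w @ [a])"
    have "left_end q w \<le> t"
      using * nn by (smt (verit) left_end_snoc sum_nonneg)
    moreover have "t < left_end q w + q w"
      using * le[of "Suc a"] by (simp add: left_end_snoc)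
    ultimately have w: "interval_word q t (length w) = w" using snoc by simp
    have "(LEAST b. P b) = a"
    proof (rule Least_equality)
      show "P a" using * by (simp add: P_def)
      fix b assume "P b"
      show "a \<le> b"
      proof (rule ccontr)
        assume "\<not> a \<le> b"
        then have "(\<Sum>c<Suc b. q (w @ [c])) \<le> (\<Sum>c<a. q (w @ [c]))"
          by (intro sum_mono2) (auto simp: nn)
        then show False using \<open>P b\<close> * by (simp add: P left_end_snoc)
      qed
    qed
    then show "interval_word q t (length (w @ [a])) = w @ [a]"
      using w by (simp add: P_def)
  qed
qed

text \<open>Each word \<open>w\<close> gets the interval of length \<open>q w\<close> starting at \<open>left_end q w\<close>; the itinerary of
  a uniformly distributed point through these nested partitions has the required law.\<close>

lemma extension_exists:
  assumes q: "consistent q"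
  shows "\<exists>\<mu>. sets \<mu> = sets borel \<and> prob_space \<mu> \<and> (\<forall>w. measure \<mu> (cyl w) = q w)"
proof -
  define U :: "real measure" where "U = restrict_space lborel {0..<1}"
  define X where "X t = (\<lambda>n. interval_word q t (Suc n) ! n)" for t
  have nn: "q u \<ge> 0" for u using q by (simp add: consistent_def)
  have [simp]: "space U = {0..<1}" by (simp add: U_def space_restrict_space)
  have take: "take n (interval_word q t m) = interval_word q t n" if "n \<le> m" for n m t
    using that by (induction m) (auto simp: le_Suc_eq)
  have X_word: "map (X t) [0..<n] = interval_word q t n" for t n
  proof (rule nth_equalityI)
    fix i assume "i < length (map (X t) [0..<n])"
    then have "i < n" by simp
    then have "X t i = interval_word q t n ! i"
      unfolding X_def by (metis take Suc_leI lessI nth_take)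
    then show "map (X t) [0..<n] ! i = interval_word q t n ! i" using \<open>i < n\<close> by simp
  qed simp
  have bounds: "0 \<le> left_end q w \<and> left_end q w + q w \<le> 1" for w
  proof (induction w rule: rev_induct)
    case Nil
    then show ?case using q by (simp add: left_end_def consistent_def)
  next
    case (snoc a w)
    have su: "(\<lambda>a. q (w @ [a])) sums q w" using q by (simp add: consistent_def)
    have "(\<Sum>c<Suc a. q (w @ [c])) \<le> q w"
      using su nn by (metis sum_le_suminf sums_iff finite_lessThan)
    moreover have "(\<Sum>c<a. q (w @ [c])) \<ge> 0" using nn by (intro sum_nonneg) auto
    ultimately show ?case using snoc by (simp add: left_end_snoc)
  qed
  have vim: "X -` cyl w \<inter> space U = {left_end q w ..< left_end q w + q w}" for w
    using bounds[of w] interval_word_iff[OF q, of _ w] by (auto simp: in_cyl_iff X_word)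
  have ms: "X -` cyl w \<inter> space U \<in> sets U" for w
    unfolding vim using bounds[of w] by (auto simp: U_def sets_restrict_space_iff)
  have meas: "X \<in> U \<rightarrow>\<^sub>M borel"
  proof (rule measurable_sigma_sets[OF sets_borel_cyl])
    fix A assume "A \<in> insert {} (range cyl)"
    then show "X -` A \<inter> space U \<in> sets U" using ms by auto
  qed auto
  have em: "emeasure (distr U borel X) (cyl w) = ennreal (q w)" for w
    using bounds[of w] nn[of w] vim[of w] 
    by (subst emeasure_distr[OF meas]) (auto simp: U_def emeasure_restrict_space)
  show ?thesis
  proof (intro exI[of _ "distr U borel X"] conjI allI)
    have "emeasure (distr U borel X) UNIV = 1"
      using em[of "[]"] q by (simp add: consistent_def)
    then show "prob_space (distr U borel X)" by (auto intro: prob_spaceI)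
    show "measure (distr U borel X) (cyl w) = q w" for w
      using em[of w] nn by (simp add: measure_def)
  qed simp
qed

section \<open>The ergodic theorem\<close>

definition birkhoff_sum :: "('a \<Rightarrow> 'a) \<Rightarrow> ('a \<Rightarrow> real) \<Rightarrow> nat \<Rightarrow> 'a \<Rightarrow> real" where
  "birkhoff_sum T f n x = (\<Sum>j<n. f ((T ^^ j) x))"

definition birkhoff_avg :: "('a \<Rightarrow> 'a) \<Rightarrow> ('a \<Rightarrow> real) \<Rightarrow> nat \<Rightarrow> 'a \<Rightarrow> real" where
  "birkhoff_avg T f n x = birkhoff_sum T f n x / n"

text \<open>The maximum of the Birkhoff sums of lengths \<open>0\<close> to \<open>n\<close>. The
  recursion through \<open>T x\<close> is the identity on which the maximal ergodic theorem
  rests.\<close>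

primrec max_sum :: "('a \<Rightarrow> 'a) \<Rightarrow> ('a \<Rightarrow> real) \<Rightarrow> nat \<Rightarrow> 'a \<Rightarrow> real" where
  "max_sum T f 0 x = 0"
| "max_sum T f (Suc n) x = max 0 (f x + max_sum T f n (T x))"

locale measure_preserving_self = prob_space M for M :: "'a measure" +
  fixes T :: "'a \<Rightarrow> 'a"
  assumes T_measurable [measurable]: "T \<in> M \<rightarrow>\<^sub>M M" and distr_T: "distr M M T = M"
begin

lemma T_space [simp]: "x \<in> space M \<Longrightarrow> T x \<in> space M"
  using measurable_space[OF T_measurable] .

lemma funpow_T_measurable [measurable]: "(T ^^ j) \<in> M \<rightarrow>\<^sub>M M"
proof (induction j)
  case (Suc j)
  then show ?case unfolding funpow.simps by (rule measurable_comp[OF _ T_measurable])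
qed (simp add: id_def)

lemma integral_T:
  fixes f :: "'a \<Rightarrow> real"
  assumes [measurable]: "f \<in> borel_measurable M"
  shows "(\<integral>x. f (T x) \<partial>M) = (\<integral>x. f x \<partial>M)"
  using integral_distr[of T M M f] by (simp add: distr_T)

lemma integral_funpow_T:
  fixes f :: "'a \<Rightarrow> real"
  assumes f: "f \<in> borel_measurable M"
  shows "(\<integral>x. f ((T ^^ j) x) \<partial>M) = (\<integral>x. f x \<partial>M)"
  using f
proof (induction j arbitrary: f)
  case (Suc j)
  from Suc.prems have "(\<lambda>x. f (T x)) \<in> borel_measurable M" by measurable
  from Suc.IH[OF this] show ?case using integral_T[OF Suc.prems] by simp
qed simp

lemma birkhoff_sum_measurable [measurable]:
  "f \<in> borel_measurable M \<Longrightarrow> birkhoff_sum T f n \<in> borel_measurable M"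
  unfolding birkhoff_sum_def
  by (intro borel_measurable_sum measurable_compose[OF funpow_T_measurable])

lemma birkhoff_avg_measurable [measurable]:
  "f \<in> borel_measurable M \<Longrightarrow> birkhoff_avg T f n \<in> borel_measurable M"
  unfolding birkhoff_avg_def by (intro borel_measurable_divide birkhoff_sum_measurable) auto

lemma birkhoff_sum_Suc: "birkhoff_sum T f (Suc n) x = f x + birkhoff_sum T f n (T x)"
  unfolding birkhoff_sum_def by (subst sum.lessThan_Suc_shift) (simp add: funpow_swap1)

lemma max_sum_measurable [measurable]:
  "f \<in> borel_measurable M \<Longrightarrow> (\<lambda>x. max_sum T f n x) \<in> borel_measurable M"
proof (induction n)
  case (Suc n)
  note [measurable] = Suc
  then show ?case by simp
next
  case 0
  have "(\<lambda>x. max_sum T f 0 x) = (\<lambda>x. 0)" by simp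
  then show ?case by simp
qed

lemma max_sum_nonneg: "0 \<le> max_sum T f n x"
  by (cases n) auto

lemma max_sum_le_Suc: "max_sum T f n x \<le> max_sum T f (Suc n) x"
proof (induction n arbitrary: x)
  case (Suc n)
  have "max 0 (f x + max_sum T f n (T x)) \<le> max 0 (f x + max_sum T f (Suc n) (T x))"
    using Suc[of "T x"] by (intro max.mono) auto
  then show ?case by simp
qed simp

lemma birkhoff_sum_le_max_sum: "birkhoff_sum T f n x \<le> max_sum T f n x"
proof (induction n arbitrary: x)
  case (Suc n)
  then show ?case using Suc[of "T x"] by (simp add: birkhoff_sum_Suc le_max_iff_disj)
qed (simp add: birkhoff_sum_def)

lemma max_sum_le:
  assumes "\<And>x. x \<in> space M \<Longrightarrow> \<bar>f x\<bar> \<le> C" "0 \<le> C"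
  shows "x \<in> space M \<Longrightarrow> max_sum T f n x \<le> n * C"
proof (induction n arbitrary: x)
  case (Suc n)
  have "f x \<le> C" "max_sum T f n (T x) \<le> n * C"
    using assms(1)[of x] Suc by (auto simp: abs_le_iff)
  then show ?case using \<open>0 \<le> C\<close> by (simp add: algebra_simps)
qed simp

text \<open>Garsia's argument. Write \<open>m n\<close> for \<open>max_sum T f n\<close>: where it
  is positive, it equals \<open>f\<close> plus \<open>m (n - 1)\<close> at \<open>T x\<close>, which
  is at most \<open>f\<close> plus \<open>m n\<close> at \<open>T x\<close>; elsewhere it is
  \<open>0\<close>. Since \<open>m n\<close> and its composition with \<open>T\<close> have the same
  integral, the integral of \<open>f\<close> over the set where \<open>m n\<close> is positive is
  nonnegative. These sets increase with \<open>n\<close>.\<close>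

lemma maximal_ergodic:
  fixes f :: "'a \<Rightarrow> real"
  assumes f [measurable]: "f \<in> borel_measurable M" and C: "\<And>x. x \<in> space M \<Longrightarrow> \<bar>f x\<bar> \<le> C"
  shows "0 \<le> (\<integral>x. f x * indicator {x. \<exists>n. max_sum T f n x > 0} x \<partial>M)"
proof -
  have "0 \<le> C" using C not_empty by force
  have int: "integrable M (\<lambda>x. f x * indicator {x. 0 < max_sum T f n x} x)" for n
    using C \<open>0 \<le> C\<close> by (intro integrable_const_bound[of _ C]) (auto simp: indicator_def)
  have int': "integrable M (max_sum T f n)" for n
    using max_sum_le[OF C \<open>0 \<le> C\<close>] max_sum_nonneg[of f n]
    by (intro integrable_const_bound[of _ "n * C"]) auto
  have int'': "integrable M (\<lambda>x. max_sum T f n (T x))" for n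
    using max_sum_le[OF C \<open>0 \<le> C\<close>] max_sum_nonneg[of f n]
    by (intro integrable_const_bound[of _ "n * C"]) auto
  have pos: "0 \<le> (\<integral>x. f x * indicator {x. 0 < max_sum T f n x} x \<partial>M)" for n
  proof -
    have "(\<integral>x. max_sum T f n x \<partial>M) \<le> (\<integral>x. f x * indicator {x. 0 < max_sum T f n x} x + max_sum T f n (T x) \<partial>M)"
    proof (intro integral_mono int' Bochner_Integration.integrable_add int int'')
      fix x
      show "max_sum T f n x \<le> f x * indicator {x. 0 < max_sum T f n x} x + max_sum T f n (T x)"
      proof (cases n)
        case (Suc k)
        then show ?thesis using max_sum_le_Suc[of f k "T x"] max_sum_nonneg[of f n "T x"]
          by (auto simp: indicator_def)
      qed simp
    qed
    also have "\<dots> = (\<integral>x. f x * indicator {x. 0 < max_sum T f n x} x \<partial>M) + (\<integral>x. max_sum T f n x \<partial>M)"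
      using integral_T[of "max_sum T f n"] by (subst Bochner_Integration.integral_add[OF int int'']) simp
    finally show ?thesis by simp
  qed
  have "(\<lambda>n. \<integral>x. f x * indicator {x. 0 < max_sum T f n x} x \<partial>M) \<longlonglongrightarrow>
    (\<integral>x. f x * indicator {x. \<exists>n. max_sum T f n x > 0} x \<partial>M)"
  proof (rule integral_dominated_convergence[where w="\<lambda>_. C"])
    show "AE x in M. (\<lambda>n. f x * indicator {x. 0 < max_sum T f n x} x) \<longlonglongrightarrow> f x * indicator {x. \<exists>n. max_sum T f n x > 0} x"
    proof (rule AE_I2, rule tendsto_eventually)
      fix x
      show "\<forall>\<^sub>F n in sequentially. f x * indicator {x. 0 < max_sum T f n x} x = f x * indicator {x. \<exists>n. max_sum T f n x > 0} x"
      proof (cases "\<exists>n. max_sum T f n x > 0")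
        case True
        then obtain n where n: "max_sum T f n x > 0" by auto
        have "max_sum T f m x > 0" if "m \<ge> n" for m
          using lift_Suc_mono_le[of "\<lambda>n. max_sum T f n x", OF max_sum_le_Suc that] n by simp
        then have "f x * indicator {x. 0 < max_sum T f m x} x = f x * indicator {x. \<exists>n. max_sum T f n x > 0} x" if "m \<ge> n" for m
          using that True by (simp add: indicator_def)
        then show ?thesis by (auto simp: eventually_sequentially)
      qed (simp add: indicator_def)
    qed
    show "\<And>n. AE x in M. norm (f x * indicator {x. 0 < max_sum T f n x} x) \<le> C"
      using C \<open>0 \<le> C\<close> by (auto simp: indicator_def)
  qed auto
  then show ?thesis
    by (rule LIMSEQ_le_const) (use pos in auto)
qed

text \<open>The maximal ergodic theorem for \<open>f - b\<close> cut off to \<open>E\<close>: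
  invariance keeps the orbits of points of \<open>E\<close> inside \<open>E\<close>, so some maximal
  sum is positive exactly on \<open>E\<close>.\<close>

lemma invariant_set_integral_ge:
  fixes f :: "'a \<Rightarrow> real"
  assumes f [measurable]: "f \<in> borel_measurable M" and C: "\<And>x. x \<in> space M \<Longrightarrow> \<bar>f x\<bar> \<le> C"
    and E [measurable]: "E \<in> sets M" and inv: "\<And>x. x \<in> space M \<Longrightarrow> T x \<in> E \<longleftrightarrow> x \<in> E"
    and large: "\<And>x. x \<in> E \<Longrightarrow> \<exists>n. birkhoff_sum T f n x > n * b"
  shows "b * prob E \<le> (\<integral>x. f x * indicator E x \<partial>M)"
proof -
  have "0 \<le> C" using C not_empty by force
  define g where "g x = (f x - b) * indicator E x" for x
  have [measurable]: "g \<in> borel_measurable M" unfolding g_def by measurable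
  have gb: "\<bar>g x\<bar> \<le> C + \<bar>b\<bar>" if "x \<in> space M" for x
    using C[OF that] by (auto simp: g_def indicator_def)
  have inv': "(T ^^ j) x \<in> E \<and> (T ^^ j) x \<in> space M" if "x \<in> E" for x j
    using that sets.sets_into_space[OF E] by (induction j) (auto simp: inv)
  have "max_sum T g n x = 0" if "x \<in> space M" "x \<notin> E" for n x
    using that by (induction n arbitrary: x) (auto simp: g_def inv)
  moreover have "\<exists>n. max_sum T g n x > 0" if "x \<in> E" for x
  proof -
    obtain n where n: "birkhoff_sum T f n x > n * b" using large[OF \<open>x \<in> E\<close>] by auto
    have "birkhoff_sum T g n x = (\<Sum>j<n. f ((T ^^ j) x) - b)"
      unfolding birkhoff_sum_def g_def using inv'[OF that] by (intro sum.cong) auto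
    also have "\<dots> = birkhoff_sum T f n x - n * b"
      by (simp add: birkhoff_sum_def sum_subtractf)
    finally have "birkhoff_sum T g n x > 0" using n by simp
    then show ?thesis using birkhoff_sum_le_max_sum[of g n x] by (intro exI[of _ n]) linarith
  qed
  ultimately have "g x * indicator {x. \<exists>n. max_sum T g n x > 0} x = f x * indicator E x - b * indicator E x"
    if "x \<in> space M" for x
    using that by (cases "x \<in> E") (auto simp: g_def)
  then have "(\<integral>x. g x * indicator {x. \<exists>n. max_sum T g n x > 0} x \<partial>M) = (\<integral>x. f x * indicator E x - b * indicator E x \<partial>M)"
    by (intro Bochner_Integration.integral_cong) auto
  moreover have "0 \<le> (\<integral>x. g x * indicator {x. \<exists>n. max_sum T g n x > 0} x \<partial>M)"
    using gb by (intro maximal_ergodic) auto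
  moreover have "(\<integral>x. f x * indicator E x - b * indicator E x \<partial>M) = (\<integral>x. f x * indicator E x \<partial>M) - b * prob E"
  proof (subst Bochner_Integration.integral_diff)
    show "integrable M (\<lambda>x. f x * indicator E x)"
      using C \<open>0 \<le> C\<close> by (intro integrable_const_bound[of _ C]) (auto simp: indicator_def)
    show "integrable M (\<lambda>x. b * indicator E x)"
      by (intro integrable_mult_right integrable_real_indicator) (auto simp: emeasure_eq_measure)
  qed auto
  ultimately show ?thesis by simp
qed

lemma birkhoff_avg_bound:
  assumes "\<And>x. x \<in> space M \<Longrightarrow> \<bar>f x\<bar> \<le> C" "x \<in> space M"
  shows "\<bar>birkhoff_avg T f n x\<bar> \<le> C"
proof (cases n)
  case 0
  then show ?thesis using assms(1)[OF assms(2)] by (simp add: birkhoff_avg_def)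
next
  case (Suc m)
  have "(T ^^ j) x \<in> space M" for j using assms(2) by (induction j) auto
  then have "\<bar>birkhoff_sum T f n x\<bar> \<le> (\<Sum>j<n. C)"
    unfolding birkhoff_sum_def using assms(1) by (intro order_trans[OF sum_abs] sum_mono) auto
  then show ?thesis using Suc by (simp add: birkhoff_avg_def abs_divide field_simps)
qed

text \<open>The sums along the orbits of \<open>x\<close> and of \<open>T x\<close> differ only in
  one term at each end. This makes upper and lower limits of the averages invariant.\<close>

lemma birkhoff_avg_T:
  assumes C: "\<And>x. x \<in> space M \<Longrightarrow> \<bar>f x\<bar> \<le> C" and x: "x \<in> space M"
  shows "(\<lambda>n. birkhoff_avg T f n (T x) - birkhoff_avg T f n x) \<longlonglongrightarrow> 0"
proof (rule Lim_null_comparison)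
  have sp: "(T ^^ j) x \<in> space M" for j using x by (induction j) auto
  show "\<forall>\<^sub>F n in sequentially. norm (birkhoff_avg T f n (T x) - birkhoff_avg T f n x) \<le> 2 * C * inverse (real n)"
  proof (rule always_eventually, rule allI)
    fix n
    have "birkhoff_sum T f n (T x) - birkhoff_sum T f n x = f ((T ^^ n) x) - f x"
      using birkhoff_sum_Suc[of f n x] by (simp add: birkhoff_sum_def)
    moreover have "\<bar>f ((T ^^ n) x) - f x\<bar> \<le> 2 * C" using C[OF sp[of n]] C[OF x] by linarith
    ultimately show "norm (birkhoff_avg T f n (T x) - birkhoff_avg T f n x) \<le> 2 * C * inverse (real n)"
      by (simp add: birkhoff_avg_def flip: diff_divide_distrib) (simp add: divide_inverse mult_right_mono)
  qed
  show "(\<lambda>n. 2 * C * inverse (real n)) \<longlonglongrightarrow> 0"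
    by (rule tendsto_mult_right_zero) (rule lim_inverse_n)
qed

lemma limsup_birkhoff_avg_T:
  assumes C: "\<And>x. x \<in> space M \<Longrightarrow> \<bar>f x\<bar> \<le> C" and x: "x \<in> space M"
  shows "limsup (\<lambda>n. ereal (birkhoff_avg T f n (T x))) = limsup (\<lambda>n. ereal (birkhoff_avg T f n x))"
  using ereal_limsup_lim_add[of "\<lambda>n. ereal (birkhoff_avg T f n (T x) - birkhoff_avg T f n x)" 0
      "\<lambda>n. ereal (birkhoff_avg T f n x)"] birkhoff_avg_T[OF assms]
  by (simp add: zero_ereal_def)

lemma birkhoff_avg_uminus: "birkhoff_avg T (\<lambda>x. - f x) n x = - birkhoff_avg T f n x"
  by (simp add: birkhoff_avg_def birkhoff_sum_def sum_negf)

lemma liminf_birkhoff_avg: "liminf (\<lambda>n. ereal (birkhoff_avg T f n x)) = - limsup (\<lambda>n. ereal (birkhoff_avg T (\<lambda>x. - f x) n x))"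
  using ereal_Limsup_uminus[of sequentially "\<lambda>n. ereal (birkhoff_avg T f n x)"]
  by (simp add: birkhoff_avg_uminus)

lemma frequently_avg_gt:
  assumes "ereal b < limsup (\<lambda>n. ereal (birkhoff_avg T f n x))"
  shows "\<exists>n. birkhoff_sum T f n x > n * b"
proof -
  have "\<exists>n\<ge>1. ereal b < ereal (birkhoff_avg T f n x)"
  proof (rule ccontr)
    assume "\<not> ?thesis"
    then have "\<forall>\<^sub>F n in sequentially. ereal (birkhoff_avg T f n x) \<le> ereal b"
      by (intro eventually_sequentiallyI[of 1]) auto
    then have "limsup (\<lambda>n. ereal (birkhoff_avg T f n x)) \<le> ereal b" by (rule Limsup_bounded)
    then show False using assms by simp
  qed
  then obtain n where "n \<ge> 1" "b < birkhoff_avg T f n x" by auto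
  then show ?thesis by (intro exI[of _ n]) (simp add: birkhoff_avg_def field_simps)
qed

text \<open>If the averages oscillate across \<open>a < b\<close> on the set \<open>E\<close>, then
  \<open>invariant_set_integral_ge\<close> for \<open>f\<close> and for \<open>- f\<close> bounds
  the integral of \<open>f\<close> over the invariant set \<open>E\<close> below by
  \<open>b * prob E\<close> and above by \<open>a * prob E\<close>, so \<open>E\<close> is null.
  Rational \<open>a\<close> and \<open>b\<close> exhaust all oscillation.\<close>

theorem birkhoff_convergent:
  fixes f :: "'a \<Rightarrow> real"
  assumes f [measurable]: "f \<in> borel_measurable M" and C: "\<And>x. x \<in> space M \<Longrightarrow> \<bar>f x\<bar> \<le> C"
  shows "AE x in M. convergent (\<lambda>n. birkhoff_avg T f n x)"
proof -
  define up where "up x = limsup (\<lambda>n. ereal (birkhoff_avg T f n x))" for x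
  define lo where "lo x = liminf (\<lambda>n. ereal (birkhoff_avg T f n x))" for x
  have [measurable]: "up \<in> borel_measurable M" "lo \<in> borel_measurable M"
    unfolding up_def lo_def by measurable
  have C': "\<And>x. x \<in> space M \<Longrightarrow> \<bar>- f x\<bar> \<le> C" using C by simp
  have null: "AE x in M. \<not> (lo x < ereal a \<and> ereal b < up x)" if "a < b" for a b
  proof -
    define E where "E = {x \<in> space M. lo x < ereal a \<and> ereal b < up x}"
    have [measurable]: "E \<in> sets M" unfolding E_def by measurable
    have inv: "T x \<in> E \<longleftrightarrow> x \<in> E" if "x \<in> space M" for x
      using limsup_birkhoff_avg_T[OF C that] limsup_birkhoff_avg_T[OF C' that] that
      by (simp add: E_def up_def lo_def liminf_birkhoff_avg)
    have "b * prob E \<le> (\<integral>x. f x * indicator E x \<partial>M)"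
      by (rule invariant_set_integral_ge[OF f C \<open>E \<in> sets M\<close> inv])
         (auto intro: frequently_avg_gt simp: E_def up_def)
    moreover have "(- a) * prob E \<le> (\<integral>x. (- f x) * indicator E x \<partial>M)"
    proof (rule invariant_set_integral_ge[OF _ C' \<open>E \<in> sets M\<close> inv])
      fix x assume "x \<in> E"
      then have "- limsup (\<lambda>n. ereal (birkhoff_avg T (\<lambda>x. - f x) n x)) < ereal a"
        by (simp add: E_def lo_def liminf_birkhoff_avg)
      then have "ereal (- a) < limsup (\<lambda>n. ereal (birkhoff_avg T (\<lambda>x. - f x) n x))"
        by (metis ereal_uminus_less_reorder uminus_ereal.simps(1))
      then show "\<exists>n. real n * - a < birkhoff_sum T (\<lambda>x. - f x) n x"
        by (rule frequently_avg_gt)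
    qed auto
    ultimately have "b * prob E \<le> a * prob E" by simp
    then have "prob E = 0"
      using \<open>a < b\<close> measure_nonneg[of M E] by (smt (verit) mult_strict_right_mono)
    then have "AE x in M. x \<notin> E" using prob_eq_0[of E] by simp
    then show ?thesis by (auto simp: E_def)
  qed
  have "AE x in M. \<forall>a b :: rat. a < b \<longrightarrow> \<not> (lo x < ereal (of_rat a) \<and> ereal (of_rat b) < up x)"
    unfolding AE_all_countable using null by (auto simp: of_rat_less)
  with AE_space show ?thesis
  proof eventually_elim
    case (elim x)
    have le: "lo x \<le> up x" unfolding lo_def up_def by (rule Liminf_le_Limsup) simp
    have "\<not> lo x < up x"
    proof
      assume "lo x < up x"
      then obtain b where b: "lo x < ereal (of_rat b)" "ereal (of_rat b) < up x" using ereal_dense3 by blast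
      then obtain a where a: "lo x < ereal (of_rat a)" "ereal (of_rat a) < ereal (of_rat b)" using ereal_dense3 by blast
      with b elim(2) show False by (auto simp: of_rat_less)
    qed
    with le have eq: "lo x = up x" by simp
    have lim: "(\<lambda>n. ereal (birkhoff_avg T f n x)) \<longlonglongrightarrow> up x"
      by (rule Liminf_eq_Limsup) (use eq in \<open>auto simp: lo_def up_def\<close>)
    have "up x \<le> ereal C" "ereal (- C) \<le> up x"
      using birkhoff_avg_bound[OF C elim(1)]
      by (auto intro!: LIMSEQ_le_const2[OF lim] LIMSEQ_le_const[OF lim] simp: abs_le_iff minus_le_iff)
    then obtain r where "up x = ereal r" by (cases "up x") auto
    then show ?case using lim by (auto simp: convergent_def)
  qed
qed

lemma integral_lim_birkhoff_avg:
  fixes f :: "'a \<Rightarrow> real"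
  assumes f [measurable]: "f \<in> borel_measurable M" and C: "\<And>x. x \<in> space M \<Longrightarrow> \<bar>f x\<bar> \<le> C"
  shows "(\<integral>x. lim (\<lambda>n. birkhoff_avg T f n x) \<partial>M) = (\<integral>x. f x \<partial>M)"
proof -
  have int: "integrable M (\<lambda>x. f ((T ^^ j) x))" for j
    using C measurable_space[OF funpow_T_measurable]
    by (intro integrable_const_bound[of _ C]) auto
  have eq: "(\<integral>x. birkhoff_avg T f n x \<partial>M) = (\<integral>x. f x \<partial>M)" if "n \<ge> 1" for n
    using that int by (simp add: birkhoff_avg_def birkhoff_sum_def integral_funpow_T[OF f])
  have "(\<lambda>n. \<integral>x. birkhoff_avg T f n x \<partial>M) \<longlonglongrightarrow> (\<integral>x. lim (\<lambda>n. birkhoff_avg T f n x) \<partial>M)"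
  proof (rule integral_dominated_convergence[where w="\<lambda>_. C"])
    show "AE x in M. (\<lambda>n. birkhoff_avg T f n x) \<longlonglongrightarrow> lim (\<lambda>n. birkhoff_avg T f n x)"
      using birkhoff_convergent[OF f C, simplified] by eventually_elim (simp add: convergent_LIMSEQ_iff)
    show "AE x in M. norm (birkhoff_avg T f n x) \<le> C" for n
      using birkhoff_avg_bound[OF C] by auto
  qed auto
  moreover have "(\<lambda>n. \<integral>x. birkhoff_avg T f n x \<partial>M) \<longlonglongrightarrow> (\<integral>x. f x \<partial>M)"
    by (rule tendsto_eventually) (auto simp: eventually_sequentially intro!: exI[of _ 1] eq)
  ultimately show ?thesis by (rule LIMSEQ_unique)
qed

end

section \<open>Invariant measures and frequencies\<close>

text \<open>The measures live on the whole sequence space, so that limits and mixtures stay in one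
  Borel space; by invariance the condition on the first two letters propagates along almost every
  sequence (\<open>invariant_measures_AE_path\<close>).\<close>

definition invariant_measures :: "(nat \<Rightarrow> nat \<Rightarrow> bool) \<Rightarrow> (nat \<Rightarrow> nat) measure set" where
  "invariant_measures R = {\<mu>. sets \<mu> = sets borel \<and> prob_space \<mu> \<and> distr \<mu> \<mu> shift_map = \<mu> \<and>
     (AE x in \<mu>. R (x 0) (x 1))}"

lemma invariant_measuresD:
  assumes "\<mu> \<in> invariant_measures R"
  shows "sets \<mu> = sets borel" "space \<mu> = UNIV" "prob_space \<mu>" "distr \<mu> \<mu> shift_map = \<mu>"
    "AE x in \<mu>. R (x 0) (x 1)" "measure_preserving_self \<mu> shift_map"
proof -
  show 1: "sets \<mu> = sets borel" "prob_space \<mu>" "distr \<mu> \<mu> shift_map = \<mu>" "AE x in \<mu>. R (x 0) (x 1)"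
    using assms by (auto simp: invariant_measures_def)
  show "space \<mu> = UNIV"
    using sets_eq_imp_space_eq[OF 1(1)] by simp
  have "shift_map \<in> \<mu> \<rightarrow>\<^sub>M \<mu>"
    using shift_map_measurable measurable_cong_sets 1(1) by blast
  then show "measure_preserving_self \<mu> shift_map"
    using 1 by (simp add: measure_preserving_self_def measure_preserving_self_axioms_def)
qed

lemma prob_cyl_snoc_sums:
  assumes "prob_space \<mu>" "sets \<mu> = sets borel"
  shows "(\<lambda>a. measure \<mu> (cyl (w @ [a]))) sums measure \<mu> (cyl w)"
proof -
  interpret prob_space \<mu> by fact
  have "cyl w = (\<Union>a. cyl (w @ [a]))" by (auto simp: cyl_snoc)
  moreover have "(\<lambda>a. measure \<mu> (cyl (w @ [a]))) sums measure \<mu> (\<Union>a. cyl (w @ [a]))"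
    by (rule finite_measure_UNION) (auto simp: assms disjoint_family_on_def cyl_snoc)
  ultimately show ?thesis by simp
qed

lemma prob_cyl_Cons_sums':
  assumes "prob_space \<mu>" "sets \<mu> = sets borel"
  shows "(\<lambda>a. measure \<mu> (cyl (a # w))) sums measure \<mu> (shift_map -` cyl w)"
proof -
  interpret prob_space \<mu> by fact
  have "shift_map -` cyl w = (\<Union>a. cyl (a # w))" by (auto simp: cyl_Cons)
  moreover have "(\<lambda>a. measure \<mu> (cyl (a # w))) sums measure \<mu> (\<Union>a. cyl (a # w))"
    by (rule finite_measure_UNION) (auto simp: assms disjoint_family_on_def cyl_Cons)
  ultimately show ?thesis by simp
qed

lemma invariant_measure_vimage:
  assumes "\<mu> \<in> invariant_measures R" "A \<in> sets borel"
  shows "measure \<mu> (shift_map -` A) = measure \<mu> A"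
proof -
  note [simp] = invariant_measuresD(1,2)[OF assms(1)]
  interpret measure_preserving_self \<mu> shift_map by (rule invariant_measuresD(6)[OF assms(1)])
  show ?thesis
    using measure_distr[OF T_measurable, of A] assms(2) by (simp add: distr_T)
qed

lemma prob_cyl_Cons_sums:
  assumes "\<mu> \<in> invariant_measures R"
  shows "(\<lambda>a. measure \<mu> (cyl (a # w))) sums measure \<mu> (cyl w)"
  using prob_cyl_Cons_sums'[of \<mu> w] invariant_measuresD[OF assms] invariant_measure_vimage[OF assms, of "cyl w"]
  by simp

lemma invariant_measures_AE_path:
  assumes "\<mu> \<in> invariant_measures R"
  shows "AE x in \<mu>. \<forall>n. R (x n) (x (Suc n))"
  unfolding AE_all_countable
proof
  fix n
  interpret measure_preserving_self \<mu> shift_map by (rule invariant_measuresD(6)[OF assms])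
  show "AE x in \<mu>. R (x n) (x (Suc n))"
  proof (induction n)
    case 0
    then show ?case using invariant_measuresD(5)[OF assms] by simp
  next
    case (Suc n)
    then have "AE x in distr \<mu> \<mu> shift_map. R (x n) (x (Suc n))" by (subst distr_T)
    from AE_distrD[OF T_measurable this] show ?case
      by eventually_elim (simp add: shift_map_def)
  qed
qed

lemma invariant_measures_eqI:
  assumes "\<mu> \<in> invariant_measures R" "\<nu> \<in> invariant_measures R"
    and "\<And>w. measure \<mu> (cyl w) = measure \<nu> (cyl w)"
  shows "\<mu> = \<nu>"
proof (rule measure_eqI_cyl)
  interpret M: prob_space \<mu> using invariant_measuresD(3)[OF assms(1)] .
  interpret N: prob_space \<nu> using invariant_measuresD(3)[OF assms(2)] .
  show "emeasure \<mu> (cyl w) = emeasure \<nu> (cyl w)" for w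
    using assms(3) by (simp add: M.emeasure_eq_measure N.emeasure_eq_measure)
qed (use invariant_measuresD[OF assms(1)] invariant_measuresD[OF assms(2)] in auto)

text \<open>Additivity on the right gives the measure, additivity on the left its invariance: the
  preimage of \<open>cyl w\<close> under the shift is the disjoint union of the cylinders of
  \<open>a # w\<close>.\<close>

lemma invariant_measure_exists:
  assumes q: "consistent q" and left: "\<And>w. (\<lambda>a. q (a # w)) sums q w"
    and R: "\<And>a b. \<not> R a b \<Longrightarrow> q [a, b] = 0"
  obtains \<mu> where "\<mu> \<in> invariant_measures R" "\<And>w. measure \<mu> (cyl w) = q w"
proof -
  obtain \<mu> where sets: "sets \<mu> = sets borel" and p: "prob_space \<mu>" and w: "\<And>w. measure \<mu> (cyl w) = q w"
    using extension_exists[OF q] by auto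
  interpret prob_space \<mu> by fact
  have [simp]: "space \<mu> = UNIV" using sets_eq_imp_space_eq[OF sets] by simp
  have S: "shift_map \<in> \<mu> \<rightarrow>\<^sub>M \<mu>"
    using shift_map_measurable measurable_cong_sets sets by blast
  have "distr \<mu> \<mu> shift_map = \<mu>"
  proof (rule measure_eqI_cyl)
    show "prob_space (distr \<mu> \<mu> shift_map)" by (rule prob_space_distr[OF S])
    fix u
    have "measure \<mu> (shift_map -` cyl u) = q u"
      using prob_cyl_Cons_sums'[OF p sets, of u] left[of u] by (simp add: w sums_iff)
    then show "emeasure (distr \<mu> \<mu> shift_map) (cyl u) = emeasure \<mu> (cyl u)"
      by (simp add: emeasure_distr[OF S] sets emeasure_eq_measure w)
  qed (simp_all add: sets)
  moreover have "AE x in \<mu>. \<forall>a b. \<not> R a b \<longrightarrow> x \<notin> cyl [a, b]"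
    unfolding AE_all_countable
  proof (intro allI)
    fix a b
    show "AE x in \<mu>. \<not> R a b \<longrightarrow> x \<notin> cyl [a, b]"
      using prob_eq_0[of "cyl [a, b]"] R[of a b] w[of "[a, b]"] by (cases "R a b") (auto simp: sets)
  qed
  then have "AE x in \<mu>. R (x 0) (x 1)"
    by eventually_elim (auto simp: cyl_Cons shift_map_def)
  ultimately have "\<mu> \<in> invariant_measures R"
    using sets p by (simp add: invariant_measures_def)
  then show ?thesis using w that by blast
qed

section \<open>Asymptotic frequencies of words along orbits\<close>

definition freq_avg :: "nat list \<Rightarrow> nat \<Rightarrow> (nat \<Rightarrow> nat) \<Rightarrow> real" where
  "freq_avg w = birkhoff_avg shift_map (indicator (cyl w))"

text \<open>The truncation only matters where the averages diverge and \<open>lim\<close> is arbitrary.\<close>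

definition freq :: "nat list \<Rightarrow> (nat \<Rightarrow> nat) \<Rightarrow> real" where
  "freq w x = max 0 (min 1 (lim (\<lambda>n. freq_avg w n x)))"

lemma freq_avg_eq: "freq_avg w n x = (\<Sum>j<n. indicator (cyl w) ((shift_map ^^ j) x)) / n"
  by (simp add: freq_avg_def birkhoff_avg_def birkhoff_sum_def)

lemma freq_avg_bounds: "0 \<le> freq_avg w n x" "freq_avg w n x \<le> 1"
proof -
  have "(\<Sum>j<n. indicator (cyl w) ((shift_map ^^ j) x) :: real) \<le> (\<Sum>j<n. 1)"
    by (intro sum_mono) (simp add: indicator_def)
  then show "freq_avg w n x \<le> 1" by (simp add: freq_avg_eq divide_le_eq)
  show "0 \<le> freq_avg w n x" by (simp add: freq_avg_eq sum_nonneg)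
qed

lemma freq_bounds: "0 \<le> freq w x" "freq w x \<le> 1"
  by (auto simp: freq_def)

lemma freq_eqI:
  assumes "(\<lambda>n. freq_avg w n x) \<longlonglongrightarrow> l"
  shows "freq w x = l"
proof -
  have "0 \<le> l" "l \<le> 1"
    using LIMSEQ_le_const[OF assms, of 0] LIMSEQ_le_const2[OF assms, of 1] freq_avg_bounds by auto
  then show ?thesis using limI[OF assms] by (simp add: freq_def)
qed

lemma freq_avg_measurable [measurable]: "freq_avg w n \<in> borel_measurable borel"
proof -
  have "(\<lambda>x. indicator (cyl w) ((shift_map ^^ j) x) :: real) \<in> borel_measurable borel" for j
    by (rule measurable_compose[OF shift_map_pow_measurable borel_measurable_indicator]) simp
  then have "(\<lambda>x. freq_avg w n x) \<in> borel_measurable borel"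
    unfolding freq_avg_eq by (intro borel_measurable_divide borel_measurable_sum borel_measurable_const)
  then show ?thesis by simp
qed

lemma freq_measurable [measurable]: "freq w \<in> borel_measurable borel"
proof -
  have "(\<lambda>x. lim (\<lambda>n. freq_avg w n x)) \<in> borel_measurable borel"
    by (rule borel_measurable_lim_metric) (rule freq_avg_measurable)
  then have "(\<lambda>x. freq w x) \<in> borel_measurable borel"
    unfolding freq_def by (intro borel_measurable_max borel_measurable_min borel_measurable_const)
  then show ?thesis by simp
qed

lemma freq_Nil [simp]: "freq [] x = 1"
proof (rule freq_eqI)
  show "(\<lambda>n. freq_avg [] n x) \<longlonglongrightarrow> 1"
    by (rule tendsto_eventually) (auto simp: freq_avg_eq eventually_sequentially intro!: exI[of _ 1])
qed

lemma freq_avg_tendsto_shift: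
  assumes "(\<lambda>n. freq_avg w n x) \<longlonglongrightarrow> l"
  shows "(\<lambda>n. freq_avg w n (shift_map x)) \<longlonglongrightarrow> l"
proof -
  have "(\<lambda>n. freq_avg w n (shift_map x) - freq_avg w n x) \<longlonglongrightarrow> 0"
  proof (rule Lim_null_comparison)
    show "\<forall>\<^sub>F n in sequentially. norm (freq_avg w n (shift_map x) - freq_avg w n x) \<le> inverse (real n)"
    proof (rule always_eventually, rule allI)
      fix n
      let ?s = "\<lambda>j. indicator (cyl w) ((shift_map ^^ j) x) :: real"
      have "(\<Sum>j<n. indicator (cyl w) ((shift_map ^^ j) (shift_map x)) :: real) - (\<Sum>j<n. ?s j) = ?s n - ?s 0"
        using sum.lessThan_Suc_shift[of ?s n] by (simp add: funpow_swap1)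
      then have "freq_avg w n (shift_map x) - freq_avg w n x = (?s n - ?s 0) / n"
        by (simp add: freq_avg_eq flip: diff_divide_distrib)
      then show "norm (freq_avg w n (shift_map x) - freq_avg w n x) \<le> inverse (real n)"
        by (simp add: indicator_def divide_inverse)
    qed
    show "(\<lambda>n. inverse (real n)) \<longlonglongrightarrow> 0" by (rule lim_inverse_n)
  qed
  from tendsto_add[OF this assms] show ?thesis by simp
qed

context
  fixes R \<mu>
  assumes \<mu>: "\<mu> \<in> invariant_measures R"
begin

interpretation measure_preserving_self \<mu> shift_map
  by (rule invariant_measuresD(6)[OF \<mu>])

lemma borel_measurable_invariant [measurable_dest, measurable]: "f \<in> borel_measurable borel \<Longrightarrow> f \<in> borel_measurable \<mu>"
  using invariant_measuresD(1)[OF \<mu>] measurable_cong_sets by blast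

lemma freq_convergent: "AE x in \<mu>. \<forall>w. (\<lambda>n. freq_avg w n x) \<longlonglongrightarrow> freq w x"
  unfolding AE_all_countable
proof
  fix w
  have "(indicator (cyl w) :: _ \<Rightarrow> real) \<in> borel_measurable \<mu>"
    by (intro borel_measurable_invariant borel_measurable_indicator cyl_sets)
  then have "AE x in \<mu>. convergent (\<lambda>n. freq_avg w n x)"
    unfolding freq_avg_def by (rule birkhoff_convergent[where C=1]) (simp add: indicator_def)
  then show "AE x in \<mu>. (\<lambda>n. freq_avg w n x) \<longlonglongrightarrow> freq w x"
  proof eventually_elim
    case (elim x)
    then obtain l where l: "(\<lambda>n. freq_avg w n x) \<longlonglongrightarrow> l" by (auto simp: convergent_def)
    then show ?case using freq_eqI[OF l] by simp
  qed
qed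

lemma freq_shift: "AE x in \<mu>. \<forall>w. freq w (shift_map x) = freq w x"
  using freq_convergent
proof eventually_elim
  case (elim x)
  then show ?case using freq_eqI[OF freq_avg_tendsto_shift] by blast
qed

lemma integrable_freq: "integrable \<mu> (freq w)"
  using freq_bounds by (intro integrable_const_bound[of _ 1]) auto

lemma integral_freq: "(\<integral>x. freq w x \<partial>\<mu>) = measure \<mu> (cyl w)"
proof -
  have ind: "(indicator (cyl w) :: _ \<Rightarrow> real) \<in> borel_measurable \<mu>"
    by (intro borel_measurable_invariant borel_measurable_indicator cyl_sets)
  have "(\<integral>x. freq w x \<partial>\<mu>) = (\<integral>x. lim (\<lambda>n. freq_avg w n x) \<partial>\<mu>)"
  proof (rule integral_cong_AE)
    show "AE x in \<mu>. freq w x = lim (\<lambda>n. freq_avg w n x)"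
      using freq_convergent
    proof eventually_elim
      case (elim x)
      then have "(\<lambda>n. freq_avg w n x) \<longlonglongrightarrow> freq w x" by blast
      then show ?case using limI by metis
    qed
  qed measurable
  also have "\<dots> = (\<integral>x. indicator (cyl w) x \<partial>\<mu>)"
    unfolding freq_avg_def by (rule integral_lim_birkhoff_avg[OF ind, where C=1]) (simp add: indicator_def)
  also have "\<dots> = measure \<mu> (cyl w)"
    using invariant_measuresD(1)[OF \<mu>] invariant_measuresD(2)[OF \<mu>] by simp
  finally show ?thesis .
qed

text \<open>An inequality between functions with equal integrals is an equality almost everywhere.
  Thus frequencies, which as limits could lose mass in an infinite sum, lose none at almost every
  point.\<close>

lemma freq_sums:
  assumes v: "(\<lambda>a. measure \<mu> (cyl (v a))) sums measure \<mu> (cyl w)"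
    and le: "AE x in \<mu>. \<forall>n. (\<Sum>a<n. freq (v a) x) \<le> freq w x"
  shows "AE x in \<mu>. (\<lambda>a. freq (v a) x) sums freq w x"
proof -
  have summ: "AE x in \<mu>. (\<lambda>n. \<Sum>a<n. freq (v a) x) \<longlonglongrightarrow> (\<Sum>a. freq (v a) x)"
    using le
  proof eventually_elim
    case (elim x)
    have "summable (\<lambda>a. freq (v a) x)"
      by (rule summableI_nonneg_bounded[of _ "freq w x"]) (use freq_bounds elim in auto)
    then show ?case by (rule summable_LIMSEQ)
  qed
  have "(\<lambda>n. \<integral>x. (\<Sum>a<n. freq (v a) x) \<partial>\<mu>) \<longlonglongrightarrow> (\<integral>x. (\<Sum>a. freq (v a) x) \<partial>\<mu>)"
  proof (rule integral_dominated_convergence[where w="\<lambda>_. 1"])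
    show "AE x in \<mu>. norm (\<Sum>a<n. freq (v a) x) \<le> 1" for n
      using le
    proof eventually_elim
      case (elim x)
      then have "(\<Sum>a<n. freq (v a) x) \<le> 1" using freq_bounds(2)[of w x] by (meson order_trans)
      then show ?case using freq_bounds(1) by (simp add: sum_nonneg)
    qed
  qed (use summ in measurable)
  moreover have "(\<integral>x. (\<Sum>a<n. freq (v a) x) \<partial>\<mu>) = (\<Sum>a<n. measure \<mu> (cyl (v a)))" for n
    by (simp add: integrable_freq integral_freq)
  ultimately have eq: "(\<integral>x. (\<Sum>a. freq (v a) x) \<partial>\<mu>) = measure \<mu> (cyl w)"
    using v LIMSEQ_unique unfolding sums_def by auto
  have le': "AE x in \<mu>. (\<Sum>a. freq (v a) x) \<le> freq w x"
    using summ le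
  proof eventually_elim
    case (elim x)
    then show ?case using LIMSEQ_le_const2[OF elim(1)] by blast
  qed
  have "AE x in \<mu>. 0 \<le> (\<Sum>a. freq (v a) x)"
    using summ
  proof eventually_elim
    case (elim x)
    then show ?case using LIMSEQ_le_const[OF elim, of 0] freq_bounds(1) by (simp add: sum_nonneg)
  qed
  with le' have "AE x in \<mu>. norm (\<Sum>a. freq (v a) x) \<le> 1"
  proof eventually_elim
    case (elim x)
    then show ?case using freq_bounds(2)[of w x] by simp
  qed
  then have "integrable \<mu> (\<lambda>x. \<Sum>a. freq (v a) x)"
    by (intro integrable_const_bound[of _ 1]) measurable
  then have "integrable \<mu> (\<lambda>x. freq w x - (\<Sum>a. freq (v a) x))" and
    "(\<integral>x. freq w x - (\<Sum>a. freq (v a) x) \<partial>\<mu>) = 0"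
    using integrable_freq by (simp_all add: integral_freq eq)
  then have "AE x in \<mu>. freq w x - (\<Sum>a. freq (v a) x) = 0"
    using le' by (subst integral_nonneg_eq_0_iff_AE[symmetric]) auto
  with summ show ?thesis
    unfolding sums_def by eventually_elim simp
qed

lemma freq_snoc_sums: "AE x in \<mu>. (\<lambda>a. freq (w @ [a]) x) sums freq w x"
proof (rule freq_sums)
  show "(\<lambda>a. measure \<mu> (cyl (w @ [a]))) sums measure \<mu> (cyl w)"
    using prob_cyl_snoc_sums invariant_measuresD[OF \<mu>] by blast
  show "AE x in \<mu>. \<forall>n. (\<Sum>a<n. freq (w @ [a]) x) \<le> freq w x"
    using freq_convergent
  proof eventually_elim
    case (elim x)
    show ?case
    proof
      fix n
      have "(\<Sum>a<n. indicator (cyl (w @ [a])) y) \<le> (indicator (cyl w) y :: real)" for y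
        by (cases "y \<in> cyl w") (auto simp: indicator_def cyl_snoc if_distrib sum.If_cases card_le_Suc0_iff_eq)
      then have "(\<Sum>j<m. \<Sum>a<n. indicator (cyl (w @ [a])) ((shift_map ^^ j) x)) \<le> (\<Sum>j<m. indicator (cyl w) ((shift_map ^^ j) x) :: real)" for m
        by (intro sum_mono)
      then have "(\<Sum>a<n. freq_avg (w @ [a]) m x) \<le> freq_avg w m x" for m
        by (subst (asm) sum.swap) (simp add: freq_avg_eq divide_right_mono flip: sum_divide_distrib)
      moreover have "(\<lambda>m. \<Sum>a<n. freq_avg (w @ [a]) m x) \<longlonglongrightarrow> (\<Sum>a<n. freq (w @ [a]) x)"
        using elim by (intro tendsto_sum) auto
      ultimately show "(\<Sum>a<n. freq (w @ [a]) x) \<le> freq w x"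
        using elim LIMSEQ_le by blast
    qed
  qed
qed

lemma freq_Cons_sums: "AE x in \<mu>. (\<lambda>a. freq (a # w) x) sums freq w x"
proof (rule freq_sums)
  show "(\<lambda>a. measure \<mu> (cyl (a # w))) sums measure \<mu> (cyl w)"
    using prob_cyl_Cons_sums[OF \<mu>] .
  show "AE x in \<mu>. \<forall>n. (\<Sum>a<n. freq (a # w) x) \<le> freq w x"
    using freq_convergent
  proof eventually_elim
    case (elim x)
    show ?case
    proof
      fix n
      \<comment> \<open>A visit of \<open>y\<close> to the cylinder of \<open>a # w\<close> is a
        visit of the shifted point to that of \<open>w\<close>. The comparison is therefore with the
        averages of \<open>shift_map x\<close>, which have the same limit.\<close>
      have "(\<Sum>a<n. indicator (cyl (a # w)) y) \<le> (indicator (cyl w) (shift_map y) :: real)" for y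
        by (cases "shift_map y \<in> cyl w") (auto simp: indicator_def cyl_Cons if_distrib sum.If_cases card_le_Suc0_iff_eq)
      then have "(\<Sum>j<m. \<Sum>a<n. indicator (cyl (a # w)) ((shift_map ^^ j) x)) \<le>
          (\<Sum>j<m. indicator (cyl w) ((shift_map ^^ j) (shift_map x)) :: real)" for m
        by (intro sum_mono) (metis funpow_swap1)
      then have "(\<Sum>a<n. freq_avg (a # w) m x) \<le> freq_avg w m (shift_map x)" for m
        by (subst (asm) sum.swap) (simp add: freq_avg_eq divide_right_mono flip: sum_divide_distrib)
      moreover have "(\<lambda>m. \<Sum>a<n. freq_avg (a # w) m x) \<longlonglongrightarrow> (\<Sum>a<n. freq (a # w) x)"
        using elim by (intro tendsto_sum) auto
      moreover have "(\<lambda>m. freq_avg w m (shift_map x)) \<longlonglongrightarrow> freq w x"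
        using elim freq_avg_tendsto_shift by blast
      ultimately show "(\<Sum>a<n. freq (a # w) x) \<le> freq w x"
        using LIMSEQ_le by blast
    qed
  qed
qed

lemma freq_forbidden: "AE x in \<mu>. \<not> R a b \<longrightarrow> freq [a, b] x = 0"
proof (cases "R a b")
  case False
  have "AE x in \<mu>. x \<notin> cyl [a, b]"
    using invariant_measuresD(5)[OF \<mu>] by eventually_elim (use False in \<open>auto simp: cyl_Cons shift_map_def\<close>)
  then have "measure \<mu> (cyl [a, b]) = 0"
    using prob_eq_0[of "cyl [a, b]"] invariant_measuresD(1)[OF \<mu>] by simp
  then have "AE x in \<mu>. freq [a, b] x = 0"
    using freq_bounds(1) integrable_freq integral_freq
    by (subst integral_nonneg_eq_0_iff_AE[symmetric]) auto
  then show ?thesis by simp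
qed simp

text \<open>There are countably many words, so outside one null set the frequencies satisfy all sum
  rules at once, and \<open>invariant_measure_exists\<close> applies to them.\<close>

theorem freq_invariant_measure:
  "AE x in \<mu>. \<exists>\<nu>\<in>invariant_measures R. \<forall>w. measure \<nu> (cyl w) = freq w x"
proof -
  have "AE x in \<mu>. \<forall>w. (\<lambda>a. freq (w @ [a]) x) sums freq w x"
    unfolding AE_all_countable using freq_snoc_sums by blast
  moreover have "AE x in \<mu>. \<forall>w. (\<lambda>a. freq (a # w) x) sums freq w x"
    unfolding AE_all_countable using freq_Cons_sums by blast
  moreover have "AE x in \<mu>. \<forall>a b. \<not> R a b \<longrightarrow> freq [a, b] x = 0"
    unfolding AE_all_countable using freq_forbidden by blast
  ultimately show ?thesis
  proof eventually_elim
    case (elim x)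
    have "consistent (\<lambda>w. freq w x)"
      using elim freq_bounds(1) by (simp add: consistent_def)
    from invariant_measure_exists[OF this, of R] elim show ?case by metis
  qed
qed

end

section \<open>Embedding into bounded sequences\<close>

text \<open>The geometric weights turn coordinatewise convergence on \<open>unit_box\<close> into
  convergence in the supremum norm, since the entries from the \<open>m\<close>-th on differ by at
  most \<open>(1/2) ^ m\<close>.\<close>

definition weigh :: "(nat list \<Rightarrow> real) \<Rightarrow> bounded_seq" where
  "weigh q = Bcontfun (\<lambda>k. (1/2) ^ k * q (from_nat k))"

definition unit_box :: "(nat list \<Rightarrow> real) set" where
  "unit_box = {q. \<forall>w. 0 \<le> q w \<and> q w \<le> 1}"

lemma apply_weigh:
  assumes "q \<in> unit_box"
  shows "apply_bcontfun (weigh q) k = (1/2) ^ k * q (from_nat k)"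
proof -
  have "\<bar>(1/2) ^ k * q (from_nat k)\<bar> \<le> 1" for k
    using assms by (simp add: unit_box_def abs_mult mult_le_one power_le_one)
  then have "(\<lambda>k. (1/2) ^ k * q (from_nat k)) \<in> bcontfun"
    by (auto simp: bcontfun_def bounded_iff intro!: exI[of _ 1])
  then show ?thesis by (simp add: weigh_def Bcontfun_inverse)
qed

lemma unit_box_eq_weigh:
  assumes "q \<in> unit_box"
  shows "q w = 2 ^ to_nat w * apply_bcontfun (weigh q) (to_nat w)"
  using apply_weigh[OF assms, of "to_nat w"] by (simp add: power_divide)

lemma inj_on_weigh: "inj_on weigh unit_box"
proof
  fix p q assume "p \<in> unit_box" "q \<in> unit_box" "weigh p = weigh q"
  then show "p = q" using unit_box_eq_weigh by (metis ext)
qed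

lemma tendsto_apply_bcontfun:
  fixes y :: "'b \<Rightarrow> bounded_seq"
  assumes "(y \<longlongrightarrow> l) F"
  shows "((\<lambda>n. apply_bcontfun (y n) k) \<longlongrightarrow> apply_bcontfun l k) F"
  unfolding tendsto_iff
proof (intro allI impI)
  fix e :: real assume "e > 0"
  then have "\<forall>\<^sub>F n in F. dist (y n) l < e" using assms by (simp add: tendsto_iff)
  then show "\<forall>\<^sub>F n in F. dist (apply_bcontfun (y n) k) (apply_bcontfun l k) < e"
    by eventually_elim (rule dist_fun_lt_imp_dist_val_lt)
qed

lemma weigh_near:
  assumes "p \<in> unit_box" "q \<in> unit_box" "0 \<le> e" "(1/2) ^ m \<le> e"
    and "\<And>k. k < m \<Longrightarrow> \<bar>p (from_nat k) - q (from_nat k)\<bar> \<le> e"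
  shows "dist (weigh p) (weigh q) \<le> e"
proof (rule dist_bound)
  fix k
  have eq: "dist (apply_bcontfun (weigh p) k) (apply_bcontfun (weigh q) k) = (1/2) ^ k * \<bar>p (from_nat k) - q (from_nat k)\<bar>"
    using assms by (simp add: apply_weigh dist_real_def abs_mult flip: right_diff_distrib)
  show "dist (apply_bcontfun (weigh p) k) (apply_bcontfun (weigh q) k) \<le> e"
  proof (cases "k < m")
    case True
    have "(1/2) ^ k * \<bar>p (from_nat k) - q (from_nat k)\<bar> \<le> 1 * e"
      by (intro mult_mono assms(5) True) (auto simp: power_le_one)
    then show ?thesis using eq by simp
  next
    case False
    then have "(1/2 :: real) ^ k \<le> (1/2) ^ m" by (intro power_decreasing) auto
    moreover have "\<bar>p (from_nat k) - q (from_nat k)\<bar> \<le> 1"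
      using assms(1,2) unfolding unit_box_def by (smt (verit) mem_Collect_eq)
    ultimately have "(1/2) ^ k * \<bar>p (from_nat k) - q (from_nat k)\<bar> \<le> (1/2) ^ m * 1"
      by (intro mult_mono) auto
    then show ?thesis using eq assms(4) by simp
  qed
qed

lemma tendsto_weigh:
  assumes box: "\<And>n. p n \<in> unit_box" "q \<in> unit_box" and lim: "\<And>w. ((\<lambda>n. p n w) \<longlongrightarrow> q w) F"
  shows "((\<lambda>n. weigh (p n)) \<longlongrightarrow> weigh q) F"
  unfolding tendsto_iff
proof (intro allI impI)
  fix e :: real assume "e > 0"
  obtain m where m: "(1/2 :: real) ^ m < e / 2"
    using real_arch_pow_inv[of "e / 2" "1/2"] \<open>e > 0\<close> by auto
  have "\<forall>\<^sub>F n in F. \<bar>p n (from_nat k) - q (from_nat k)\<bar> < e / 2" for k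
    using tendstoD[OF lim[of "from_nat k"], of "e / 2"] \<open>e > 0\<close> by (simp add: dist_real_def)
  then have "\<forall>\<^sub>F n in F. \<forall>k\<in>{..<m}. \<bar>p n (from_nat k) - q (from_nat k)\<bar> < e / 2"
    by (intro eventually_ball_finite) auto
  then show "\<forall>\<^sub>F n in F. dist (weigh (p n)) (weigh q) < e"
  proof eventually_elim
    case (elim n)
    have "dist (weigh (p n)) (weigh q) \<le> e / 2"
      by (rule weigh_near[where m=m]) (use box elim m \<open>e > 0\<close> in \<open>auto intro: less_imp_le\<close>)
    then show ?case using \<open>e > 0\<close> by simp
  qed
qed

lemma tendsto_weighD:
  assumes "\<And>n. p n \<in> unit_box" "q \<in> unit_box" "((\<lambda>n. weigh (p n)) \<longlongrightarrow> weigh q) F"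
  shows "((\<lambda>n. p n w) \<longlongrightarrow> q w) F"
proof -
  have "((\<lambda>n. 2 ^ to_nat w * apply_bcontfun (weigh (p n)) (to_nat w)) \<longlongrightarrow>
      2 ^ to_nat w * apply_bcontfun (weigh q) (to_nat w)) F"
    by (intro tendsto_intros tendsto_apply_bcontfun assms)
  then show ?thesis using unit_box_eq_weigh assms by simp
qed

lemma unit_box_subseq:
  fixes p :: "nat \<Rightarrow> nat list \<Rightarrow> real"
  assumes "\<And>n. p n \<in> unit_box"
  obtains q r where "q \<in> unit_box" "strict_mono r" "\<And>w. (\<lambda>n. p (r n) w) \<longlonglongrightarrow> q w"
proof -
  have "compactin (product_topology (\<lambda>_ :: nat list. euclidean) UNIV) (PiE UNIV (\<lambda>_. {0..1::real}))"
    by (subst compactin_PiE) (simp add: compactin_euclidean_iff)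
  moreover have "PiE UNIV (\<lambda>_. {0..1}) = unit_box" by (auto simp: unit_box_def)
  ultimately have "compact unit_box"
    by (simp add: euclidean_product_topology flip: compactin_euclidean_iff)
  then obtain q r where q: "q \<in> unit_box" "strict_mono r" "(p \<circ> r) \<longlonglongrightarrow> q"
    using assms compact_imp_seq_compact seq_compactE by metis
  have "(\<lambda>n. p (r n) w) \<longlonglongrightarrow> q w" for w
    using continuous_on_tendsto_compose[OF continuous_on_product_coordinates[of w] q(3)]
    by (simp add: o_def)
  then show ?thesis using q that by blast
qed

text \<open>Dropping the empty word together with the words that start with \<open>0\<close> sends
  the point mass at \<open>000...\<close> to the zero sequence and leaves no coordinate that sees
  the total mass.\<close>

definition coord :: "(nat \<Rightarrow> nat) measure \<Rightarrow> nat list \<Rightarrow> real" where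
  "coord \<mu> w = (if w = [] \<or> hd w = 0 then 0 else measure \<mu> (cyl w))"

definition emb :: "(nat \<Rightarrow> nat) measure \<Rightarrow> bounded_seq" where
  "emb \<mu> = weigh (coord \<mu>)"

lemma coord_unit_box: "prob_space \<mu> \<Longrightarrow> coord \<mu> \<in> unit_box"
  by (auto simp: coord_def unit_box_def prob_space.prob_le_1)

text \<open>The letter \<open>0\<close> is a cemetery: the fixed point \<open>000\<dots>\<close> carries the mass that escapes to infinity,
  and the measures on the remaining letters become sub-probability measures.\<close>

locale pointed_shift =
  fixes R :: "nat \<Rightarrow> nat \<Rightarrow> bool"
  assumes R_zero_left: "R 0 b \<longleftrightarrow> b = 0" and R_zero_right: "R a 0 \<longleftrightarrow> a = 0"
begin

abbreviation "IM \<equiv> invariant_measures R"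

lemma path_zero_iff:
  assumes "\<forall>n. R (x n) (x (Suc n))"
  shows "x n = 0 \<longleftrightarrow> x 0 = 0"
proof (induction n)
  case (Suc n)
  then show ?case using assms R_zero_left R_zero_right by metis
qed simp

lemma path_Suc_zero_iff:
  assumes "\<forall>n. R (x n) (x (Suc n))"
  shows "(\<forall>j<length w. x j = w ! j) \<Longrightarrow> w \<noteq> [] \<Longrightarrow> hd w = 0 \<Longrightarrow> set w \<subseteq> {0}"
    and "(\<forall>j<length w. x j = w ! j) \<Longrightarrow> w \<noteq> [] \<Longrightarrow> hd w \<noteq> 0 \<Longrightarrow> 0 \<notin> set w"
proof -
  assume eq: "\<forall>j<length w. x j = w ! j" and "w \<noteq> []"
  then have hd: "hd w = x 0" by (simp add: hd_conv_nth)
  have set: "\<exists>n. a = x n" if "a \<in> set w" for a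
    using that eq by (auto simp: in_set_conv_nth) metis
  show "set w \<subseteq> {0}" if "hd w = 0"
    using set path_zero_iff[OF assms] hd that by (metis subsetI singletonI)
  show "0 \<notin> set w" if "hd w \<noteq> 0"
    using set path_zero_iff[OF assms] hd that by metis
qed

lemma measure_cyl_zero_in:
  assumes "\<mu> \<in> IM" "hd w \<noteq> 0" "w \<noteq> []" "0 \<in> set w"
  shows "measure \<mu> (cyl w) = 0"
proof -
  interpret prob_space \<mu> using invariant_measuresD(3)[OF assms(1)] .
  have "AE x in \<mu>. x \<notin> cyl w"
    using invariant_measures_AE_path[OF assms(1)]
  proof eventually_elim
    case (elim x)
    then show ?case using path_Suc_zero_iff(2)[OF elim, of w] assms(2-4) by (auto simp: cyl_def)
  qed
  then show ?thesis using prob_eq_0[of "cyl w"] invariant_measuresD(1)[OF assms(1)] by simp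
qed

lemma measure_letters_sums:
  assumes "\<mu> \<in> IM"
  shows "(\<lambda>a. measure \<mu> (cyl [Suc a])) sums (1 - measure \<mu> (cyl [0]))"
proof -
  interpret prob_space \<mu> using invariant_measuresD(3)[OF assms] .
  have "(\<lambda>a. measure \<mu> (cyl [a])) sums 1"
    using prob_cyl_snoc_sums[of \<mu> "[]"] invariant_measuresD(1,2,3)[OF assms] prob_space by simp
  then show ?thesis using sums_Suc_iff[of "\<lambda>a. measure \<mu> (cyl [a])" "1 - measure \<mu> (cyl [0])"] by simp
qed

lemma measure_zero_word:
  assumes "\<mu> \<in> IM"
  shows "measure \<mu> (cyl (0 # w)) = (if set w \<subseteq> {0} then 1 - (\<Sum>a. measure \<mu> (cyl [Suc a])) else 0)"
proof (cases "set w \<subseteq> {0}")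
  interpret prob_space \<mu> using invariant_measuresD(3)[OF assms] .
  case True
  have "AE x in \<mu>. x \<in> cyl (0 # w) \<longleftrightarrow> x \<in> cyl [0]"
    using invariant_measures_AE_path[OF assms]
  proof eventually_elim
    case (elim x)
    have "w ! j = 0" if "j < length w" for j using True that nth_mem by blast
    then show ?case using path_zero_iff[OF elim] by (auto simp: cyl_def nth_Cons split: nat.split)
  qed
  then have "measure \<mu> (cyl (0 # w)) = measure \<mu> (cyl [0])"
    using invariant_measuresD(1)[OF assms] by (intro finite_measure_eq_AE) auto
  then show ?thesis using measure_letters_sums[OF assms] True by (simp add: sums_iff)
next
  interpret prob_space \<mu> using invariant_measuresD(3)[OF assms] .
  case False
  have "AE x in \<mu>. x \<notin> cyl (0 # w)"
    using invariant_measures_AE_path[OF assms]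
  proof eventually_elim
    case (elim x)
    then show ?case using path_Suc_zero_iff(1)[OF elim, of "0 # w"] False by (auto simp: cyl_def)
  qed
  then show ?thesis using prob_eq_0[of "cyl (0 # w)"] invariant_measuresD(1)[OF assms] False by simp
qed

text \<open>Recovers the dropped values: almost every path that starts in \<open>0\<close> stays
  there, so every word of zeros has the mass left over by the other letters. This gives the
  injectivity of \<open>emb\<close>, the shape of limit measures and the measurability of
  \<open>meas\<close>.\<close>

lemma measure_eq_coord:
  assumes "\<mu> \<in> IM"
  shows "measure \<mu> (cyl w) = (case w of [] \<Rightarrow> 1 | a # u \<Rightarrow> if a = 0
      then (if set u \<subseteq> {0} then 1 - (\<Sum>a. coord \<mu> [Suc a]) else 0) else coord \<mu> w)"
proof -
  interpret prob_space \<mu> using invariant_measuresD(3)[OF assms] .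
  show ?thesis
    using measure_zero_word[OF assms] invariant_measuresD(2)[OF assms] prob_space
    by (auto simp: coord_def split: list.split)
qed

lemma emb_box: "\<mu> \<in> IM \<Longrightarrow> coord \<mu> \<in> unit_box"
  by (intro coord_unit_box invariant_measuresD(3))

lemma inj_on_emb: "inj_on emb IM"
proof
  fix \<mu> \<nu> assume *: "\<mu> \<in> IM" "\<nu> \<in> IM" "emb \<mu> = emb \<nu>"
  then have "coord \<mu> = coord \<nu>"
    using inj_on_weigh emb_box unfolding emb_def inj_on_def by blast
  with * show "\<mu> = \<nu>" by (intro invariant_measures_eqI[of _ R]) (simp_all only: measure_eq_coord)
qed

lemma mix_invariant:
  assumes \<mu>: "\<mu> \<in> IM" and \<nu>: "\<nu> \<in> IM" and t: "0 \<le> t" "t \<le> 1"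
  shows "mix t \<mu> \<nu> \<in> IM" "A \<in> sets borel \<Longrightarrow> measure (mix t \<mu> \<nu>) A = t * measure \<mu> A + (1 - t) * measure \<nu> A"
proof -
  interpret M: prob_space \<mu> using invariant_measuresD(3)[OF \<mu>] .
  interpret N: prob_space \<nu> using invariant_measuresD(3)[OF \<nu>] .
  note s = invariant_measuresD(1)[OF \<mu>] invariant_measuresD(1)[OF \<nu>]
  have [simp]: "sets (mix t \<mu> \<nu>) = sets borel" "space (mix t \<mu> \<nu>) = UNIV"
    using s invariant_measuresD(2)[OF \<mu>] sets.space_closed[of \<mu>]
      sets.sigma_sets_eq[of "borel :: (nat \<Rightarrow> nat) measure"] by (simp_all add: mix_def)
  have em: "emeasure (mix t \<mu> \<nu>) A = ennreal (t * measure \<mu> A + (1 - t) * measure \<nu> A)" if "A \<in> sets borel" for A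
    using that s t by (simp add: emeasure_mix M.emeasure_eq_measure N.emeasure_eq_measure ennreal_mult'' ennreal_plus)
  show m: "measure (mix t \<mu> \<nu>) A = t * measure \<mu> A + (1 - t) * measure \<nu> A" if "A \<in> sets borel" for A
    unfolding measure_def[of "mix t \<mu> \<nu>"] em[OF that] using t by (intro enn2real_ennreal) simp
  have S: "shift_map \<in> mix t \<mu> \<nu> \<rightarrow>\<^sub>M mix t \<mu> \<nu>"
    by (subst measurable_cong_sets[where M'=borel and N'=borel]) simp_all
  show "mix t \<mu> \<nu> \<in> IM"
    unfolding invariant_measures_def
  proof (intro CollectI conjI)
    show p: "prob_space (mix t \<mu> \<nu>)"
      using em[of UNIV] invariant_measuresD(2)[OF \<mu>] invariant_measuresD(2)[OF \<nu>] M.prob_space N.prob_space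
      by (intro prob_spaceI) simp
    show "distr (mix t \<mu> \<nu>) (mix t \<mu> \<nu>) shift_map = mix t \<mu> \<nu>"
    proof (rule measure_eqI)
      fix A assume "A \<in> sets (distr (mix t \<mu> \<nu>) (mix t \<mu> \<nu>) shift_map)"
      then have A: "A \<in> sets borel" by simp
      then have "shift_map -` A \<in> sets borel" using measurable_sets[OF shift_map_measurable A] by simp
      then show "emeasure (distr (mix t \<mu> \<nu>) (mix t \<mu> \<nu>) shift_map) A = emeasure (mix t \<mu> \<nu>) A"
        using A S by (simp add: emeasure_distr em invariant_measure_vimage[OF \<mu>] invariant_measure_vimage[OF \<nu>])
    qed simp
    \<comment> \<open>\<open>mix\<close> is known through its values on measurable sets, so the
      almost sure condition is expressed by the nullity of a Borel set.\<close>
    define Z where "Z = (\<Union>(a, b)\<in>{(a, b). \<not> R a b}. cyl [a, b])"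
    have Z: "Z \<in> sets borel" unfolding Z_def by (intro sets.countable_UN'') auto
    have in_Z: "x \<in> Z \<longleftrightarrow> \<not> R (x 0) (x 1)" for x
      by (auto simp: Z_def cyl_Cons shift_map_def)
    have "measure \<mu> Z = 0" "measure \<nu> Z = 0"
      using M.prob_eq_0[of Z] N.prob_eq_0[of Z] s Z invariant_measuresD(5)[OF \<mu>] invariant_measuresD(5)[OF \<nu>]
      by (simp_all add: in_Z)
    then have "measure (mix t \<mu> \<nu>) Z = 0" using m[OF Z] by simp
    then show "AE x in mix t \<mu> \<nu>. R (x 0) (x 1)"
      using prob_space.prob_eq_0[OF p, of Z] Z by (simp add: in_Z)
  qed simp
qed

lemma coord_mix:
  assumes "\<mu> \<in> IM" "\<nu> \<in> IM" "0 \<le> t" "t \<le> 1"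
  shows "coord (mix t \<mu> \<nu>) w = t * coord \<mu> w + (1 - t) * coord \<nu> w"
  using mix_invariant(2)[OF assms, of "cyl w"] by (simp add: coord_def)

lemma apply_emb:
  assumes "\<mu> \<in> IM"
  shows "apply_bcontfun (emb \<mu>) k = (1/2) ^ k * coord \<mu> (from_nat k)"
  unfolding emb_def by (rule apply_weigh[OF emb_box[OF assms]])

lemma emb_mix:
  assumes "\<mu> \<in> IM" "\<nu> \<in> IM" "0 \<le> t" "t \<le> 1"
  shows "emb (mix t \<mu> \<nu>) = t *\<^sub>R emb \<mu> + (1 - t) *\<^sub>R emb \<nu>"
proof (rule bcontfun_eqI)
  fix k
  show "apply_bcontfun (emb (mix t \<mu> \<nu>)) k = apply_bcontfun (t *\<^sub>R emb \<mu> + (1 - t) *\<^sub>R emb \<nu>) k"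
    unfolding plus_bcontfun.rep_eq scaleR_bcontfun.rep_eq apply_emb[OF assms(1)] apply_emb[OF assms(2)]
      apply_emb[OF mix_invariant(1)[OF assms]] coord_mix[OF assms]
    by (simp add: distrib_left mult.left_commute)
qed

lemma convex_emb: "convex (emb ` IM)"
  unfolding convex_alt
proof safe
  fix \<mu> \<nu> and u :: real
  assume "\<mu> \<in> IM" "\<nu> \<in> IM" "0 \<le> u" "u \<le> 1"
  then have "mix (1 - u) \<mu> \<nu> \<in> IM" "emb (mix (1 - u) \<mu> \<nu>) = (1 - u) *\<^sub>R emb \<mu> + u *\<^sub>R emb \<nu>"
    using mix_invariant(1)[of \<mu> \<nu> "1 - u"] emb_mix[of \<mu> \<nu> "1 - u"] by auto
  then show "(1 - u) *\<^sub>R emb \<mu> + u *\<^sub>R emb \<nu> \<in> emb ` IM" by (metis imageI)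
qed

end

section \<open>Tightness and compactness\<close>

text \<open>Termwise limits satisfy only an inequality in general; tails that are small uniformly in
  \<open>n\<close> allow the limit and the sum to be exchanged.\<close>

lemma sums_limit:
  fixes c :: "nat \<Rightarrow> nat \<Rightarrow> real"
  assumes "\<And>a. (\<lambda>n. c n a) \<longlonglongrightarrow> c' a" "d \<longlonglongrightarrow> d'" "\<And>n. c n sums d n" "\<And>n a. 0 \<le> c n a"
    and tight: "\<And>e. e > 0 \<Longrightarrow> \<exists>N. \<forall>n. d n - (\<Sum>a<N. c n a) \<le> e"
  shows "c' sums d'"
  unfolding sums_def
proof (rule LIMSEQ_I)
  fix e :: real assume "e > 0"
  then obtain N where N: "\<And>n. d n - (\<Sum>a<N. c n a) \<le> e / 2" using tight[of "e / 2"] by auto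
  have lim: "(\<lambda>n. d n - (\<Sum>a<m. c n a)) \<longlonglongrightarrow> d' - (\<Sum>a<m. c' a)" for m
    by (intro tendsto_intros assms)
  have "norm ((\<Sum>a<m. c' a) - d') < e" if "m \<ge> N" for m
  proof -
    have "0 \<le> d n - (\<Sum>a<m. c n a)" for n
      using sum_le_suminf[of "c n" "{..<m}"] assms(3,4) by (simp add: sums_iff)
    then have "0 \<le> d' - (\<Sum>a<m. c' a)" by (intro LIMSEQ_le_const[OF lim]) auto
    moreover have "d n - (\<Sum>a<m. c n a) \<le> e / 2" for n
    proof -
      have "(\<Sum>a<N. c n a) \<le> (\<Sum>a<m. c n a)" using that assms(4) by (intro sum_mono2) auto
      then show ?thesis using N[of n] by linarith
    qed
    then have "d' - (\<Sum>a<m. c' a) \<le> e / 2" by (intro LIMSEQ_le_const2[OF lim]) auto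
    ultimately show ?thesis using \<open>e > 0\<close> by simp
  qed
  then show "\<exists>N. \<forall>m\<ge>N. norm ((\<Sum>a<m. c' a) - d') < e" by blast
qed

lemma coordinate_pred: "Measurable.pred (borel :: (nat \<Rightarrow> nat) measure) (\<lambda>x. P (x k))"
proof -
  have "(\<lambda>x. x k) \<in> borel_measurable (borel :: (nat \<Rightarrow> nat) measure)" by measurable
  moreover have "{a :: nat. P a} \<in> sets borel" by (rule borel_open) (rule discrete_topology_class.open_discrete)
  ultimately have "(\<lambda>x. x k) -` {a. P a} \<inter> space borel \<in> sets (borel :: (nat \<Rightarrow> nat) measure)"
    by (rule measurable_sets)
  then show ?thesis by (simp add: pred_def vimage_def)
qed

lemma coordinate_sets: "{x. P (x k)} \<in> sets (borel :: (nat \<Rightarrow> nat) measure)"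
  using coordinate_pred[of P k] by (simp add: pred_def)

lemma coordinate_conj_sets: "{x. P (x k) \<and> Q (x l)} \<in> sets (borel :: (nat \<Rightarrow> nat) measure)"
  using sets.Int[OF coordinate_sets[of P k] coordinate_sets[of Q l]] by (simp add: Collect_conj_eq)

lemma coordinate_rel_sets: "{x. Q (x k) (x l)} \<in> sets (borel :: (nat \<Rightarrow> nat) measure)"
proof -
  have "{x. Q (x k) (x l)} = (\<Union>(a, b)\<in>{(a, b). Q a b}. {x :: nat \<Rightarrow> nat. x k = a \<and> x l = b})" by auto
  also have "\<dots> \<in> sets borel"
  proof (rule sets.countable_UN'')
    have "{x :: nat \<Rightarrow> nat. x k = a \<and> x l = b} \<in> sets borel" for a b
      by (rule coordinate_conj_sets[of "\<lambda>c. c = a" k "\<lambda>c. c = b" l])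
    then show "(case p of (a, b) \<Rightarrow> {x :: nat \<Rightarrow> nat. x k = a \<and> x l = b}) \<in> sets borel" for p
      by (simp add: case_prod_beta)
  qed simp
  finally show ?thesis .
qed

lemma avoidance_sets:
  "{x. \<forall>k\<in>I. x k \<noteq> i} \<in> sets (borel :: (nat \<Rightarrow> nat) measure)"
  "{x. x l = i \<and> (\<forall>k\<in>I. x k \<noteq> i)} \<in> sets (borel :: (nat \<Rightarrow> nat) measure)"
proof -
  have "{x. \<forall>k\<in>I. x k \<noteq> i} = (\<Inter>k\<in>I. {x. x k \<noteq> i})" by auto
  also have "\<dots> \<in> sets borel"
  proof (rule sets.countable_INT'')
    show "UNIV \<in> sets (borel :: (nat \<Rightarrow> nat) measure)" by simp
  qed (auto intro: coordinate_sets)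
  finally show *: "{x. \<forall>k\<in>I. x k \<noteq> i} \<in> sets (borel :: (nat \<Rightarrow> nat) measure)" .
  show "{x. x l = i \<and> (\<forall>k\<in>I. x k \<noteq> i)} \<in> sets (borel :: (nat \<Rightarrow> nat) measure)"
    using sets.Int[OF coordinate_sets[of "\<lambda>a. a = i" l] *] by (simp add: Collect_conj_eq)
qed

context
  fixes R \<mu>
  assumes \<mu>: "\<mu> \<in> invariant_measures R"
begin

interpretation measure_preserving_self \<mu> shift_map
  by (rule invariant_measuresD(6)[OF \<mu>])

text \<open>Both sets have the measure of \<open>V\<^sub>n - V\<^sub>(\<^sub>n\<^sub>+\<^sub>1\<^sub>)\<close> for the event \<open>V\<^sub>n\<close> of avoiding \<open>i\<close> at the
  times below \<open>n\<close>; the first ones decrease in \<open>n\<close> and their measures telescope.\<close>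

lemma avoidance_measure:
  "measure \<mu> {x. x 0 = i \<and> (\<forall>k\<in>{1..n}. x k \<noteq> i)} \<le> 1 / real (n + 1)"
  "measure \<mu> {x. x n = i \<and> (\<forall>k<n. x k \<noteq> i)} \<le> 1 / real (n + 1)"
proof -
  note [simp] = invariant_measuresD(1,2)[OF \<mu>]
  define V where "V n = {x :: nat \<Rightarrow> nat. \<forall>k<n. x k \<noteq> i}" for n
  define F where "F n = {x :: nat \<Rightarrow> nat. x 0 = i \<and> (\<forall>k\<in>{1..n}. x k \<noteq> i)}" for n
  define L where "L n = {x :: nat \<Rightarrow> nat. x n = i \<and> (\<forall>k<n. x k \<noteq> i)}" for n
  have m: "V n \<in> sets borel" "F n \<in> sets borel" "L n \<in> sets borel" for n
    using avoidance_sets(1)[of "{..<n}" i] avoidance_sets(2)[of 0 i "{1..n}"] avoidance_sets(2)[of n i "{..<n}"]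
    by (simp_all add: V_def F_def L_def Ball_def)
  have L: "prob (V n) = prob (V (Suc n)) + prob (L n)" for n
  proof -
    have "V (Suc n) \<union> L n = V n" "V (Suc n) \<inter> L n = {}"
      by (auto simp: V_def L_def less_Suc_eq)
    then show ?thesis using finite_measure_Union[of "V (Suc n)" "L n"] m by simp
  qed
  have eq: "shift_map -` V n = V (Suc n) \<union> F n" "V (Suc n) \<inter> F n = {}" for n
  proof -
    have "(\<forall>k<n. x (Suc k) \<noteq> i) \<longleftrightarrow> (\<forall>k\<in>{1..n}. x k \<noteq> i)" for x
      by (metis One_nat_def Suc_le_eq atLeastAtMost_iff gr0_conv_Suc less_Suc_eq_le not_less_eq not_less_eq_eq zero_less_Suc)
    moreover have "(\<forall>k<Suc n. x k \<noteq> i) \<longleftrightarrow> x 0 \<noteq> i \<and> (\<forall>k<n. x (Suc k) \<noteq> i)" for x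
      by (rule All_less_Suc2)
    ultimately show "shift_map -` V n = V (Suc n) \<union> F n" "V (Suc n) \<inter> F n = {}"
      by (auto simp: V_def F_def shift_map_def)
  qed
  have F: "prob (V n) = prob (V (Suc n)) + prob (F n)" for n
    using finite_measure_Union[of "V (Suc n)" "F n"] m eq[of n] invariant_measure_vimage[OF \<mu> m(1), of n]
    by simp
  have sum: "(\<Sum>k<n. prob (F k)) = 1 - prob (V n)" for n
  proof (induction n)
    case 0
    have "V 0 = UNIV" by (simp add: V_def)
    then show ?case using prob_space by simp
  next
    case (Suc n)
    then show ?case using F[of n] by simp
  qed
  have "(\<Sum>k<Suc n. prob (F n)) \<le> (\<Sum>k<Suc n. prob (F k))"
  proof (intro sum_mono finite_measure_mono)
    fix k assume "k \<in> {..<Suc n}"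
    then show "F n \<subseteq> F k" by (auto simp: F_def)
  qed (use m in simp)
  also have "\<dots> \<le> 1" using sum[of "Suc n"] measure_nonneg[of \<mu> "V (Suc n)"] by linarith
  finally have "prob (F n) \<le> 1 / real (n + 1)" by (simp add: field_simps)
  moreover have "prob (L n) = prob (F n)" using F[of n] L[of n] by simp
  ultimately show "prob {x. x 0 = i \<and> (\<forall>k\<in>{1..n}. x k \<noteq> i)} \<le> 1 / real (n + 1)"
    "prob {x. x n = i \<and> (\<forall>k<n. x k \<noteq> i)} \<le> 1 / real (n + 1)"
    by (simp_all add: F_def L_def)
qed

lemma measure_funpow_vimage:
  assumes "A \<in> sets borel"
  shows "measure \<mu> ((shift_map ^^ n) -` A) = measure \<mu> A"
proof (induction n)
  case (Suc n)
  have "(shift_map ^^ n) -` A \<in> sets borel"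
    using measurable_sets[OF shift_map_pow_measurable assms] by simp
  from invariant_measure_vimage[OF \<mu> this] Suc show ?case
    by (simp add: vimage_def funpow_swap1)
qed simp

end

locale loop_finite_shift = pointed_shift +
  assumes finite_loops: "i \<noteq> 0 \<Longrightarrow> finite {w. length w = n \<and> w \<noteq> [] \<and> hd w = i \<and> last w = i \<and> successively R w}"
begin

lemma loop_letters_bounded:
  assumes "i \<noteq> 0"
  shows "\<exists>N. \<forall>w. length w \<le> n \<longrightarrow> w \<noteq> [] \<longrightarrow> hd w = i \<longrightarrow> last w = i \<longrightarrow> successively R w \<longrightarrow> (\<forall>a\<in>set w. a < N)"
proof -
  let ?W = "\<Union>m\<le>n. {w. length w = m \<and> w \<noteq> [] \<and> hd w = i \<and> last w = i \<and> successively R w}"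
  have "finite (\<Union>w\<in>?W. set w)" using finite_loops[OF assms] by auto
  then obtain N where "\<forall>a\<in>(\<Union>w\<in>?W. set w). a < N"
    unfolding finite_nat_set_iff_bounded by (elim exE)
  then show ?thesis by (intro exI[of _ N]) auto
qed

lemma segment_loop:
  assumes "\<forall>n. R (x n) (x (Suc n))" "k \<le> m" "x k = i" "x m = i"
  defines "w \<equiv> map x [k..<Suc m]"
  shows "w \<noteq> []" "hd w = i" "last w = i" "successively R w" "length w = Suc m - k"
    "\<forall>l. k \<le> l \<longrightarrow> l \<le> m \<longrightarrow> x l \<in> set w"
  using assms by (auto simp: hd_map last_map successively_conv_nth simp del: upt_Suc)

text \<open>A second visit to \<open>i\<close> a short time away on the far side of the neighbour
  closes a loop through it, and the letters of short loops are below \<open>N\<close>; a neighbour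
  from \<open>N\<close> on therefore forces the avoidance event. For predecessors the pair is first
  moved to the times \<open>n\<close> and \<open>n + 1\<close>, which makes room for visits in the
  past.\<close>

lemma tails_small:
  assumes "i \<noteq> 0" "e > 0"
  shows "\<exists>N. \<forall>\<mu>\<in>IM. measure \<mu> {x. x 0 = i \<and> N \<le> x 1} \<le> e \<and> measure \<mu> {x. x 1 = i \<and> N \<le> x 0} \<le> e"
proof -
  obtain n where n: "1 / real (Suc n) < e" using nat_approx_posE[OF assms(2)] by blast
  \<comment> \<open>A loop from time \<open>0\<close> to time \<open>n + 1\<close> has
    \<open>n + 2\<close> letters; this is the longest one that occurs below.\<close>
  obtain N where N: "\<And>w a. \<lbrakk>length w \<le> n + 2; w \<noteq> []; hd w = i; last w = i; successively R w; a \<in> set w\<rbrakk> \<Longrightarrow> a < N"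
    using loop_letters_bounded[OF assms(1), of "n + 2"] by blast
  show ?thesis
  proof (intro exI[of _ N] ballI conjI)
    fix \<mu> assume \<mu>: "\<mu> \<in> IM"
    note [simp] = invariant_measuresD(1,2)[OF \<mu>]
    interpret prob_space \<mu> using invariant_measuresD(3)[OF \<mu>] .
    have m: "{x. x 1 = i \<and> N \<le> x 0} \<in> sets (borel :: (nat \<Rightarrow> nat) measure)"
      by (rule coordinate_conj_sets[of "\<lambda>a. a = i" 1 "\<lambda>a. N \<le> a" 0])
    have m': "{x. x 0 = i \<and> (\<forall>k\<in>{1..n}. x k \<noteq> i)} \<in> sets borel"
      "{x. x (n + 1) = i \<and> (\<forall>k<n + 1. x k \<noteq> i)} \<in> sets borel"
      using avoidance_sets(2)[of 0 i "{1..n}"] avoidance_sets(2)[of "n + 1" i "{..<n + 1}"]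
      by (simp_all add: Ball_def)
    have "prob {x. x 0 = i \<and> N \<le> x 1} \<le> prob {x. x 0 = i \<and> (\<forall>k\<in>{1..n}. x k \<noteq> i)}"
    proof (rule finite_measure_mono_AE)
      show "AE x in \<mu>. x \<in> {x. x 0 = i \<and> N \<le> x 1} \<longrightarrow> x \<in> {x. x 0 = i \<and> (\<forall>k\<in>{1..n}. x k \<noteq> i)}"
        using invariant_measures_AE_path[OF \<mu>]
      proof eventually_elim
        case (elim x)
        have "x 1 < N" if "x 0 = i" "k \<in> {1..n}" "x k = i" for k
          using segment_loop[OF elim, of 0 k i] that by (intro N[of "map x [0..<Suc k]"]) auto
        then show ?case by force
      qed
    qed (use m' in simp)
    also have "\<dots> \<le> 1 / real (Suc n)" using avoidance_measure(1)[OF \<mu>, of i n] by (simp add: add.commute)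
    finally show "prob {x. x 0 = i \<and> N \<le> x 1} \<le> e" using n by simp
    have "prob {x. x 1 = i \<and> N \<le> x 0} = prob ((shift_map ^^ n) -` {x. x 1 = i \<and> N \<le> x 0})"
      using measure_funpow_vimage[OF \<mu> m] by simp
    also have "\<dots> = prob {x. x (n + 1) = i \<and> N \<le> x n}"
      by (simp add: vimage_def shift_map_pow)
    also have "\<dots> \<le> prob {x. x (n + 1) = i \<and> (\<forall>k<n + 1. x k \<noteq> i)}"
    proof (rule finite_measure_mono_AE)
      show "AE x in \<mu>. x \<in> {x. x (n + 1) = i \<and> N \<le> x n} \<longrightarrow> x \<in> {x. x (n + 1) = i \<and> (\<forall>k<n + 1. x k \<noteq> i)}"
        using invariant_measures_AE_path[OF \<mu>]
      proof eventually_elim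
        case (elim x)
        have "x n < N" if "x (n + 1) = i" "k < n + 1" "x k = i" for k
          using segment_loop[OF elim, of k "n + 1" i] that by (intro N[of "map x [k..<Suc (n + 1)]"]) auto
        then show ?case by force
      qed
    qed (use m' in simp)
    also have "\<dots> \<le> 1 / real (Suc n)"
      using avoidance_measure(2)[OF \<mu>, of "n + 1" i] by (rule order_trans) (simp add: field_simps)
    finally show "prob {x. x 1 = i \<and> N \<le> x 0} \<le> e" using n by simp
  qed
qed

text \<open>The empty word is excluded because its coordinate is \<open>0\<close>, whereas those of
  the letters sum to the mass off the cemetery.\<close>

lemma coord_snoc_sums:
  assumes "\<mu> \<in> IM" "w \<noteq> []"
  shows "(\<lambda>a. coord \<mu> (w @ [a])) sums coord \<mu> w"
  using prob_cyl_snoc_sums[OF invariant_measuresD(3,1)[OF assms(1)], of w] assms(2) by (simp add: coord_def)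

lemma coord_Cons_sums:
  assumes "\<mu> \<in> IM" "w \<noteq> []" 
  shows "(\<lambda>a. coord \<mu> (a # w)) sums coord \<mu> w"
proof (cases "hd w = 0")
  case True
  then have "coord \<mu> (a # w) = 0" for a
    using measure_cyl_zero_in[OF assms(1), of "a # w"] assms(2) hd_in_set[of w] by (simp add: coord_def)
  then show ?thesis using True by (simp add: coord_def)
next
  case False
  then obtain b u where w: "w = b # u" "b \<noteq> 0" using assms(2) by (cases w) auto
  have "measure \<mu> (cyl (0 # w)) = 0"
    using measure_zero_word[OF assms(1), of w] w by simp
  then have "coord \<mu> (a # w) = measure \<mu> (cyl (a # w))" for a by (simp add: coord_def)
  then show ?thesis using prob_cyl_Cons_sums[OF assms(1), of w] False assms(2) by (simp add: coord_def)
qed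

lemma coord_zero_in:
  assumes "\<mu> \<in> IM" "0 \<in> set w"
  shows "coord \<mu> w = 0"
  using measure_cyl_zero_in[OF assms(1), of w] assms(2) by (auto simp: coord_def)

text \<open>The mass missing from the partial sum lies where \<open>last w\<close> is followed by a
  letter from \<open>N\<close> on. Shifting by \<open>length w - 1\<close> moves this pair to the
  times \<open>0\<close> and \<open>1\<close>, where \<open>tails_small\<close> bounds it for all
  measures at once.\<close>

lemma coord_snoc_tight:
  assumes "w \<noteq> []" "e > 0"
  shows "\<exists>N. \<forall>\<mu>\<in>IM. coord \<mu> w - (\<Sum>a<N. coord \<mu> (w @ [a])) \<le> e"
proof (cases "hd w = 0 \<or> last w = 0")
  case True
  then have "0 \<in> set w" using assms(1) by (metis hd_in_set last_in_set)
  then show ?thesis using assms(2) by (auto simp: coord_zero_in)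
next
  case False
  then obtain N where N: "\<And>\<mu>. \<mu> \<in> IM \<Longrightarrow> measure \<mu> {x. x 0 = last w \<and> N \<le> x 1} \<le> e"
    using tails_small[of "last w" e] assms(2) by auto
  show ?thesis
  proof (intro exI[of _ N] ballI)
    fix \<mu> assume \<mu>: "\<mu> \<in> IM"
    note [simp] = invariant_measuresD(1,2)[OF \<mu>]
    interpret prob_space \<mu> using invariant_measuresD(3)[OF \<mu>] .
    have m: "{x :: nat \<Rightarrow> nat. x 0 = last w \<and> N \<le> x 1} \<in> sets borel"
      by (rule coordinate_conj_sets[of "\<lambda>a. a = last w" 0 "\<lambda>a. N \<le> a" 1])
    let ?U = "(\<Union>a\<in>{..<N}. cyl (w @ [a]))"
    have "(\<Sum>a<N. coord \<mu> (w @ [a])) = (\<Sum>a<N. prob (cyl (w @ [a])))"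
      using False assms(1) by (simp add: coord_def)
    also have "\<dots> = prob ?U"
      by (rule finite_measure_finite_Union[symmetric]) (auto simp: disjoint_family_on_def cyl_snoc)
    finally have "coord \<mu> w - (\<Sum>a<N. coord \<mu> (w @ [a])) = prob (cyl w) - prob ?U"
      using False assms(1) by (simp add: coord_def)
    also have "\<dots> = prob (cyl w - ?U)"
      by (intro finite_measure_Diff[symmetric]) (auto simp: cyl_snoc)
    also have "\<dots> \<le> prob ((shift_map ^^ (length w - 1)) -` {x. x 0 = last w \<and> N \<le> x 1})"
    proof (rule finite_measure_mono)
      show "cyl w - ?U \<subseteq> (shift_map ^^ (length w - 1)) -` {x. x 0 = last w \<and> N \<le> x 1}"
      proof
        fix x assume "x \<in> cyl w - ?U"
        then have x: "x \<in> cyl w" "x \<notin> ?U" by auto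
        then have "N \<le> x (length w)" by (auto simp: cyl_snoc simp flip: not_less)
        moreover have "x (length w - 1) = last w" using x(1) assms(1) by (simp add: cyl_def last_conv_nth)
        ultimately show "x \<in> (shift_map ^^ (length w - 1)) -` {x. x 0 = last w \<and> N \<le> x 1}"
          using assms(1) by (simp add: shift_map_pow)
      qed
      show "(shift_map ^^ (length w - 1)) -` {x. x 0 = last w \<and> N \<le> x 1} \<in> events"
        using measurable_sets[OF shift_map_pow_measurable m, of "length w - 1"]
        by (simp only: space_borel Int_UNIV_right invariant_measuresD(1)[OF \<mu>])
    qed
    also have "\<dots> \<le> e" using measure_funpow_vimage[OF \<mu> m] N[OF \<mu>] by simp
    finally show "coord \<mu> w - (\<Sum>a<N. coord \<mu> (w @ [a])) \<le> e" .
  qed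
qed

text \<open>Here invariance replaces \<open>cyl w\<close> by its preimage under the shift, so that
  the new letter and \<open>hd w\<close> stand at the times \<open>0\<close> and
  \<open>1\<close>.\<close>

lemma coord_Cons_tight:
  assumes "w \<noteq> []" "e > 0"
  shows "\<exists>N. \<forall>\<mu>\<in>IM. coord \<mu> w - (\<Sum>a<N. coord \<mu> (a # w)) \<le> e"
proof (cases "hd w = 0")
  case True
  then have "0 \<in> set w" using assms(1) by (metis hd_in_set)
  then show ?thesis using assms(2) by (auto simp: coord_zero_in)
next
  case False
  then obtain N where N: "\<And>\<mu>. \<mu> \<in> IM \<Longrightarrow> measure \<mu> {x. x 1 = hd w \<and> N \<le> x 0} \<le> e"
    using tails_small[of "hd w" e] assms(2) by auto
  obtain b u where w: "w = b # u" "b \<noteq> 0" using False assms(1) by (cases w) auto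
  show ?thesis
  proof (intro exI[of _ N] ballI)
    fix \<mu> assume \<mu>: "\<mu> \<in> IM"
    note [simp] = invariant_measuresD(1,2)[OF \<mu>]
    interpret prob_space \<mu> using invariant_measuresD(3)[OF \<mu>] .
    have m: "{x :: nat \<Rightarrow> nat. x 1 = hd w \<and> N \<le> x 0} \<in> sets borel"
      by (rule coordinate_conj_sets[of "\<lambda>a. a = hd w" 1 "\<lambda>a. N \<le> a" 0])
    have "measure \<mu> (cyl (0 # w)) = 0"
      using measure_zero_word[OF \<mu>, of w] w by simp
    then have c: "coord \<mu> (a # w) = measure \<mu> (cyl (a # w))" for a by (simp add: coord_def)
    let ?U = "(\<Union>a\<in>{..<N}. cyl (a # w))"
    have sw: "shift_map -` cyl w \<in> sets borel" using measurable_sets[OF shift_map_measurable cyl_sets] by simp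
    have "(\<Sum>a<N. coord \<mu> (a # w)) = prob ?U"
      unfolding c
      by (rule finite_measure_finite_Union[symmetric]) (auto simp: disjoint_family_on_def cyl_Cons)
    moreover have "coord \<mu> w = prob (shift_map -` cyl w)"
      using invariant_measure_vimage[OF \<mu>, of "cyl w"] w by (simp add: coord_def)
    ultimately have "coord \<mu> w - (\<Sum>a<N. coord \<mu> (a # w)) = prob (shift_map -` cyl w) - prob ?U" by simp
    also have "\<dots> = prob (shift_map -` cyl w - ?U)"
      using sw by (intro finite_measure_Diff[symmetric]) (auto simp: cyl_Cons)
    also have "\<dots> \<le> prob {x. x 1 = hd w \<and> N \<le> x 0}"
    proof (rule finite_measure_mono)
      show "shift_map -` cyl w - ?U \<subseteq> {x. x 1 = hd w \<and> N \<le> x 0}"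
        using w by (auto simp: cyl_Cons shift_map_def not_less)
    qed (use m in simp)
    also have "\<dots> \<le> e" using N[OF \<mu>] .
    finally show "coord \<mu> w - (\<Sum>a<N. coord \<mu> (a # w)) \<le> e" .
  qed
qed

text \<open>The two tightness lemmas keep additivity on both sides for nonempty words. Only the
  letters together may end up with less mass than before, and the deficit is given to the words of
  zeros.\<close>

lemma coord_limit:
  assumes \<mu>: "\<And>n. \<mu> n \<in> IM" and lim: "\<And>w. (\<lambda>n. coord (\<mu> n) w) \<longlonglongrightarrow> q w"
  shows "\<exists>\<nu>\<in>IM. coord \<nu> = q"
proof -
  have nn: "0 \<le> coord \<nu> w" for \<nu> w by (simp add: coord_def)
  have q_nn: "0 \<le> q w" for w by (rule LIMSEQ_le_const[OF lim]) (use nn in auto)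
  have snoc: "(\<lambda>a. q (w @ [a])) sums q w" if "w \<noteq> []" for w
    by (rule sums_limit[OF lim lim coord_snoc_sums[OF \<mu> that] nn]) (use coord_snoc_tight[OF that] \<mu> in blast)
  have left: "(\<lambda>a. q (a # w)) sums q w" if "w \<noteq> []" for w
    by (rule sums_limit[OF lim lim coord_Cons_sums[OF \<mu> that] nn]) (use coord_Cons_tight[OF that] \<mu> in blast)
  have zero_in: "q w = 0" if "0 \<in> set w" for w
    using LIMSEQ_unique[OF lim[of w]] coord_zero_in[OF \<mu> that] by simp
  have Nil: "q [] = 0" using LIMSEQ_unique[OF lim[of "[]"]] by (simp add: coord_def)
  have part: "(\<Sum>a<m. q [Suc a]) \<le> 1" for m
  proof (rule LIMSEQ_le_const2)
    show "(\<lambda>n. \<Sum>a<m. coord (\<mu> n) [Suc a]) \<longlonglongrightarrow> (\<Sum>a<m. q [Suc a])" by (intro tendsto_sum lim)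
    have "(\<Sum>a<m. coord (\<mu> n) [Suc a]) \<le> 1" for n
    proof -
      have s: "(\<lambda>a. coord (\<mu> n) [Suc a]) sums (1 - measure (\<mu> n) (cyl [0]))"
        using measure_letters_sums[OF \<mu>] by (simp add: coord_def)
      have "(\<Sum>a<m. coord (\<mu> n) [Suc a]) \<le> (\<Sum>a. coord (\<mu> n) [Suc a])"
        by (rule sum_le_suminf) (use s nn in \<open>auto simp: sums_iff\<close>)
      also have "\<dots> \<le> 1" using s by (simp add: sums_iff)
      finally show ?thesis .
    qed
    then show "\<exists>N. \<forall>n\<ge>N. (\<Sum>a<m. coord (\<mu> n) [Suc a]) \<le> 1" by blast
  qed
  have summ: "summable (\<lambda>a. q [Suc a])"
    by (rule summableI_nonneg_bounded[OF q_nn part])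
  have le1: "(\<Sum>a. q [Suc a]) \<le> 1" using suminf_le_const[OF summ part] .
  \<comment> \<open>The formula of \<open>measure_eq_coord\<close>, with the coordinates replaced by
    their limits.\<close>
  define p where "p w = (case w of [] \<Rightarrow> 1 | a # u \<Rightarrow> if a = 0
      then (if set u \<subseteq> {0} then 1 - (\<Sum>a. q [Suc a]) else 0) else q w)" for w
  have letters: "(\<lambda>a. p [a]) sums 1"
    using sums_Suc_iff[of "\<lambda>a. p [a]" "\<Sum>a. q [Suc a]"] summ by (simp add: p_def summable_sums)
  have "(\<lambda>a. p (w @ [a])) sums p w" for w
  proof (cases w)
    case Nil
    then show ?thesis using letters by (simp add: p_def)
  next
    case (Cons b u)
    show ?thesis
    proof (cases "b = 0")
      case True
      have "(\<lambda>a. p (w @ [a])) = (\<lambda>a. if a = 0 then p w else 0)"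
        by (auto simp: fun_eq_iff p_def Cons True)
      then show ?thesis using sums_single[of 0 "\<lambda>_. p w"] by simp
    next
      case False
      then show ?thesis using snoc[of w] by (simp add: p_def Cons)
    qed
  qed
  moreover have "0 \<le> p w" for w using q_nn le1 by (simp add: p_def split: list.split)
  ultimately have "consistent p" by (simp add: consistent_def) (simp add: p_def)
  moreover have "(\<lambda>a. p (a # w)) sums p w" for w
  proof (cases w)
    case Nil
    then show ?thesis using letters by (simp add: p_def)
  next
    case (Cons b u)
    show ?thesis
    proof (cases "b = 0")
      case True
      have "(\<lambda>a. p (a # w)) = (\<lambda>a. if a = 0 then p w else 0)"
        using zero_in by (auto simp: fun_eq_iff p_def Cons True)
      then show ?thesis using sums_single[of 0 "\<lambda>_. p w"] by simp
    next
      case False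
      then have "p (a # w) = q (a # w)" for a using zero_in[of "0 # w"] by (simp add: p_def Cons)
      moreover have "p w = q w" using False by (simp add: p_def Cons)
      ultimately show ?thesis using left[of w] Cons by simp
    qed
  qed
  moreover have "p [a, b] = 0" if "\<not> R a b" for a b
  proof (cases "a = 0")
    case True
    then show ?thesis using that R_zero_left by (auto simp: p_def)
  next
    case False
    have "coord (\<mu> n) [a, b] = 0" for n
    proof -
      interpret prob_space "\<mu> n" using invariant_measuresD(3)[OF \<mu>] .
      have "AE x in \<mu> n. x \<notin> cyl [a, b]"
        using invariant_measuresD(5)[OF \<mu>] by eventually_elim (use that in \<open>auto simp: cyl_Cons shift_map_def\<close>)
      then show ?thesis
        using prob_eq_0[of "cyl [a, b]"] invariant_measuresD(1)[OF \<mu>] by (simp add: coord_def)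
    qed
    then show ?thesis using LIMSEQ_unique[OF lim[of "[a, b]"]] False by (simp add: p_def)
  qed
  ultimately obtain \<nu> where \<nu>: "\<nu> \<in> IM" "\<And>w. measure \<nu> (cyl w) = p w"
    using invariant_measure_exists[of p R] by metis
  have "coord \<nu> w = q w" for w
    using Nil zero_in[of w] by (auto simp: coord_def \<nu>(2) p_def split: list.split)
  then show ?thesis using \<nu>(1) by blast
qed

lemma compact_emb: "compact (emb ` IM)"
  unfolding compact_eq_seq_compact_metric
proof (rule seq_compactI)
  fix y :: "nat \<Rightarrow> bounded_seq" assume y: "\<forall>n. y n \<in> emb ` IM"
  define \<mu> where "\<mu> n = inv_into IM emb (y n)" for n
  have \<mu>: "\<mu> n \<in> IM" "y n = emb (\<mu> n)" for n
    using y by (simp_all add: \<mu>_def inv_into_into f_inv_into_f)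
  obtain q r where q: "q \<in> unit_box" "strict_mono r" "\<And>w. (\<lambda>n. coord (\<mu> (r n)) w) \<longlonglongrightarrow> q w"
    using unit_box_subseq[of "\<lambda>n. coord (\<mu> n)"] emb_box[OF \<mu>(1)] by blast
  then obtain \<nu> where \<nu>: "\<nu> \<in> IM" "coord \<nu> = q" using coord_limit[of "\<lambda>n. \<mu> (r n)"] \<mu>(1) by blast
  have "(\<lambda>n. emb (\<mu> (r n))) \<longlonglongrightarrow> emb \<nu>"
    unfolding emb_def by (rule tendsto_weigh) (use emb_box \<mu>(1) \<nu> q in auto)
  then show "\<exists>l\<in>emb ` IM. \<exists>r. strict_mono r \<and> (y \<circ> r) \<longlonglongrightarrow> l"
    using q(2) \<nu>(1) \<mu>(2) by (intro bexI[of _ "emb \<nu>"] exI[of _ r]) (auto simp: o_def)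
qed

end

section \<open>Ergodic measures and extreme points\<close>

lemma space_prob_algebraI: "prob_space M \<Longrightarrow> sets M = sets N \<Longrightarrow> M \<in> space (prob_algebra N)"
  by (simp add: space_prob_algebra)

text \<open>Image measures commute with mixing, and almost sure properties of almost every component
  pass to the mixture. This serves both the ergodic decomposition and the uniqueness of representing
  measures.\<close>

lemma bind_invariant_measures:
  assumes M: "prob_space M" and \<kappa>: "\<kappa> \<in> M \<rightarrow>\<^sub>M prob_algebra borel"
    and inv: "\<And>x. x \<in> space M \<Longrightarrow> \<kappa> x \<in> invariant_measures R"
  shows "M \<bind> \<kappa> \<in> invariant_measures R"
proof -
  interpret prob_space M by fact
  have MM: "M \<in> space (prob_algebra M)" using M by (rule space_prob_algebraI) simp
  have \<kappa>': "\<kappa> \<in> M \<rightarrow>\<^sub>M subprob_algebra borel" by (rule measurable_prob_algebraD[OF \<kappa>])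
  have S: "sets (M \<bind> \<kappa>) = sets borel" by (rule sets_bind'[OF MM \<kappa>])
  have "distr (M \<bind> \<kappa>) (M \<bind> \<kappa>) shift_map = distr (M \<bind> \<kappa>) borel shift_map"
    by (rule distr_cong) (simp_all add: S)
  also have "\<dots> = M \<bind> (\<lambda>x. distr (\<kappa> x) borel shift_map)"
    by (rule distr_bind[OF \<kappa>' not_empty]) measurable
  also have "\<dots> = M \<bind> \<kappa>"
  proof (rule bind_cong[OF refl])
    fix x assume "x \<in> space M"
    note inv = invariant_measuresD[OF inv[OF this]]
    have "distr (\<kappa> x) borel shift_map = distr (\<kappa> x) (\<kappa> x) shift_map"
      by (rule distr_cong) (simp_all add: inv(1))
    then show "distr (\<kappa> x) borel shift_map = \<kappa> x" using inv(4) by simp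
  qed
  finally have "distr (M \<bind> \<kappa>) (M \<bind> \<kappa>) shift_map = M \<bind> \<kappa>" .
  moreover have "AE x in M \<bind> \<kappa>. R (x 0) (x 1)"
  proof (subst AE_bind[OF \<kappa>'])
    show "Measurable.pred borel (\<lambda>x :: nat \<Rightarrow> nat. R (x 0) (x 1))"
      using coordinate_rel_sets[of R 0 1] by (simp add: pred_def)
    show "AE x in M. AE x in \<kappa> x. R (x 0) (x 1)"
    proof (rule AE_I2)
      fix y assume "y \<in> space M"
      from invariant_measuresD(5)[OF inv[OF this]] show "AE x in \<kappa> y. R (x 0) (x 1)" .
    qed
  qed
  ultimately show ?thesis
    using S prob_space_bind'[OF MM \<kappa>] by (simp add: invariant_measures_def)
qed

lemma measure_pos_emeasure:
  assumes "measure M A > 0"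
  shows "emeasure M A \<noteq> 0" "emeasure M A \<noteq> \<infinity>"
  using assms by (auto simp: measure_def enn2real_positive_iff)

text \<open>Up to a null set, \<open>A\<close> intersected with the preimage of \<open>B\<close> is
  the preimage of \<open>A \<inter> B\<close>, so conditioning on \<open>A\<close> preserves
  invariance.\<close>

lemma uniform_measure_invariant:
  assumes \<nu>: "\<nu> \<in> invariant_measures R" and A: "A \<in> sets borel" and pos: "measure \<nu> A > 0"
    and inv: "AE x in \<nu>. shift_map x \<in> A \<longleftrightarrow> x \<in> A"
  shows "uniform_measure \<nu> A \<in> invariant_measures R"
proof -
  note [simp] = invariant_measuresD(1,2)[OF \<nu>]
  interpret prob_space \<nu> by (rule invariant_measuresD(3)[OF \<nu>])
  note ne = measure_pos_emeasure[OF pos]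
  have S: "shift_map \<in> uniform_measure \<nu> A \<rightarrow>\<^sub>M uniform_measure \<nu> A"
    by (subst measurable_cong_sets[where M'=borel and N'=borel]) simp_all
  have "distr (uniform_measure \<nu> A) (uniform_measure \<nu> A) shift_map = uniform_measure \<nu> A"
  proof (rule measure_eqI)
    fix B assume "B \<in> sets (distr (uniform_measure \<nu> A) (uniform_measure \<nu> A) shift_map)"
    then have B: "B \<in> sets borel" by simp
    have v: "shift_map -` C \<in> sets borel" if "C \<in> sets borel" for C
      using measurable_sets[OF shift_map_measurable that] by simp
    have "prob (A \<inter> shift_map -` B) = prob (shift_map -` (A \<inter> B))"
      using inv by (intro finite_measure_eq_AE) (use v[OF B] v[of "A \<inter> B"] A B in auto)
    also have "\<dots> = prob (A \<inter> B)"
      using A B by (intro invariant_measure_vimage[OF \<nu>]) auto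
    finally show "emeasure (distr (uniform_measure \<nu> A) (uniform_measure \<nu> A) shift_map) B = emeasure (uniform_measure \<nu> A) B"
      using A B v[OF B] S by (simp add: emeasure_distr emeasure_eq_measure)
  qed simp
  moreover have "AE x in uniform_measure \<nu> A. R (x 0) (x 1)"
    using invariant_measuresD(5)[OF \<nu>] A by (intro AE_uniform_measureI) auto
  ultimately show ?thesis
    using prob_space_uniform_measure[OF ne] by (simp add: invariant_measures_def)
qed

context
  fixes R \<nu>
  assumes \<nu>: "\<nu> \<in> invariant_measures R"
begin

interpretation measure_preserving_self \<nu> shift_map
  by (rule invariant_measuresD(6)[OF \<nu>])

lemma integrable_freq_square: "integrable \<nu> (\<lambda>x. (freq w x)\<^sup>2)"
proof (rule integrable_const_bound[of _ 1])
  show "AE x in \<nu>. norm ((freq w x)\<^sup>2) \<le> 1"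
    using freq_bounds by (simp add: power_le_one)
  show "(\<lambda>x. (freq w x)\<^sup>2) \<in> borel_measurable \<nu>"
    by (intro borel_measurable_power borel_measurable_invariant[OF \<nu>] freq_measurable)
qed

lemma freq_variance:
  "(\<integral>x. (freq w x - measure \<nu> (cyl w))\<^sup>2 \<partial>\<nu>) = (\<integral>x. (freq w x)\<^sup>2 \<partial>\<nu>) - (measure \<nu> (cyl w))\<^sup>2"
proof -
  let ?m = "measure \<nu> (cyl w)"
  have "(\<integral>x. (freq w x - ?m)\<^sup>2 \<partial>\<nu>) = (\<integral>x. ((freq w x)\<^sup>2 + ?m\<^sup>2) - (2 * ?m) * freq w x \<partial>\<nu>)"
    by (simp add: power2_diff mult.commute mult.left_commute)
  also have "\<dots> = ((\<integral>x. (freq w x)\<^sup>2 \<partial>\<nu>) + ?m\<^sup>2) - (2 * ?m) * ?m"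
    using integrable_freq_square[of w] integrable_freq[OF \<nu>, of w] prob_space
    by (simp add: integral_freq[OF \<nu>])
  finally show ?thesis by (simp add: power2_eq_square)
qed

text \<open>The mean of \<open>freq w\<close> is \<open>measure \<nu> (cyl w)\<close>, so being
  constant means having variance zero. In this form ergodicity is an equation between integrals that
  depend measurably on the measure.\<close>

lemma freq_const_iff:
  "(AE x in \<nu>. freq w x = measure \<nu> (cyl w)) \<longleftrightarrow> (\<integral>x. (freq w x)\<^sup>2 \<partial>\<nu>) = (measure \<nu> (cyl w))\<^sup>2"
proof -
  have "integrable \<nu> (\<lambda>x. (freq w x - measure \<nu> (cyl w))\<^sup>2)"
    unfolding power2_diff using integrable_freq_square[of w] integrable_freq[OF \<nu>, of w]
    by (intro Bochner_Integration.integrable_add Bochner_Integration.integrable_diff) auto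
  then have "(\<integral>x. (freq w x - measure \<nu> (cyl w))\<^sup>2 \<partial>\<nu>) = 0 \<longleftrightarrow> (AE x in \<nu>. (freq w x - measure \<nu> (cyl w))\<^sup>2 = 0)"
    by (intro integral_nonneg_eq_0_iff_AE) auto
  then show ?thesis by (simp add: freq_variance)
qed

lemma freq_square_ge: "(measure \<nu> (cyl w))\<^sup>2 \<le> (\<integral>x. (freq w x)\<^sup>2 \<partial>\<nu>)"
proof -
  have "0 \<le> (\<integral>x. (freq w x - measure \<nu> (cyl w))\<^sup>2 \<partial>\<nu>)" by (intro integral_nonneg_AE) simp
  then show ?thesis by (simp add: freq_variance)
qed

lemma freq_const_le:
  assumes "AE x in \<nu>. freq w x \<le> measure \<nu> (cyl w)"
  shows "AE x in \<nu>. freq w x = measure \<nu> (cyl w)"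
proof -
  have i: "integrable \<nu> (\<lambda>x. measure \<nu> (cyl w) - freq w x)"
    using integrable_freq[OF \<nu>, of w] by simp
  have "(\<integral>x. measure \<nu> (cyl w) - freq w x \<partial>\<nu>) = 0"
    using integrable_freq[OF \<nu>, of w] prob_space by (simp add: integral_freq[OF \<nu>])
  then have "AE x in \<nu>. measure \<nu> (cyl w) - freq w x = 0"
    using assms by (subst integral_nonneg_eq_0_iff_AE[OF i, symmetric]) auto
  then show ?thesis by eventually_elim simp
qed

lemma not_freq_greater: "\<not> (AE x in \<nu>. freq w x > measure \<nu> (cyl w))"
proof
  assume *: "AE x in \<nu>. freq w x > measure \<nu> (cyl w)"
  have i: "integrable \<nu> (\<lambda>x. freq w x - measure \<nu> (cyl w))"
    using integrable_freq[OF \<nu>, of w] by simp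
  have "(\<integral>x. freq w x - measure \<nu> (cyl w) \<partial>\<nu>) = 0"
    using integrable_freq[OF \<nu>, of w] prob_space by (simp add: integral_freq[OF \<nu>])
  then have "AE x in \<nu>. freq w x - measure \<nu> (cyl w) = 0"
    using * by (subst integral_nonneg_eq_0_iff_AE[OF i, symmetric]) (auto elim: eventually_mono)
  with * have "AE x in \<nu>. False" by eventually_elim simp
  then show False by simp
qed

end

text \<open>For invariant \<open>\<nu>\<close> this says that almost every point is generic: its
  word frequencies are the values of \<open>\<nu>\<close> on cylinders.\<close>

definition ergodic_measure :: "(nat \<Rightarrow> nat) measure \<Rightarrow> bool" where
  "ergodic_measure \<nu> \<longleftrightarrow> (\<forall>w. AE x in \<nu>. freq w x = measure \<nu> (cyl w))"

text \<open>The coordinates of the measure of frequencies of \<open>x\<close>, written down without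
  knowing that such a measure exists, so that the map is Borel on all sequences.\<close>

definition freq_point :: "(nat \<Rightarrow> nat) \<Rightarrow> bounded_seq" where
  "freq_point x = weigh (\<lambda>w. if w = [] \<or> hd w = 0 then 0 else freq w x)"

lemma freq_point_box: "(\<lambda>w. if w = [] \<or> hd w = 0 then 0 else freq w x) \<in> unit_box"
  using freq_bounds by (simp add: unit_box_def)

lemma continuous_on_weigh: "continuous_on unit_box weigh"
  unfolding continuous_on_sequentially o_def
proof (intro ballI allI impI)
  fix p :: "nat \<Rightarrow> nat list \<Rightarrow> real" and q
  assume q: "q \<in> unit_box" and *: "(\<forall>n. p n \<in> unit_box) \<and> p \<longlonglongrightarrow> q"
  have "(\<lambda>n. p n w) \<longlonglongrightarrow> q w" for w
    using continuous_on_tendsto_compose[OF continuous_on_product_coordinates[of w], of p q] * by simp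
  then show "(\<lambda>n. weigh (p n)) \<longlonglongrightarrow> weigh q" using q * by (intro tendsto_weigh) auto
qed

lemma freq_point_measurable [measurable]: "freq_point \<in> borel \<rightarrow>\<^sub>M borel"
proof -
  let ?q = "\<lambda>x w. if w = [] \<or> hd w = 0 then 0 else freq w x"
  have "?q \<in> borel_measurable borel"
    by (rule measurable_coordinatewise_then_product) (auto intro: freq_measurable)
  then have "?q \<in> borel \<rightarrow>\<^sub>M restrict_space borel unit_box"
    using freq_point_box by (intro measurable_restrict_space2) auto
  from measurable_comp[OF this borel_measurable_continuous_on_restrict[OF continuous_on_weigh]]
  have "weigh \<circ> ?q \<in> borel_measurable borel" .
  moreover have "weigh \<circ> ?q = freq_point" by (auto simp: freq_point_def)
  ultimately show ?thesis by simp
qed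

section \<open>Correspondence of ergodic measures and extreme points\<close>

context pointed_shift
begin

text \<open>Both components of a proper convex combination are absolutely continuous with respect to
  \<open>\<nu>\<close>. The frequencies are therefore the same constants almost everywhere for the
  components, and integrating them gives the same values on cylinders.\<close>

lemma ergodic_extreme:
  assumes \<nu>: "\<nu> \<in> IM" and erg: "ergodic_measure \<nu>"
  shows "emb \<nu> extreme_point_of (emb ` IM)"
  unfolding extreme_point_of_def
proof (intro conjI ballI notI)
  show "emb \<nu> \<in> emb ` IM" using \<nu> by simp
  fix a b assume "a \<in> emb ` IM" "b \<in> emb ` IM" and seg: "emb \<nu> \<in> open_segment a b"
  then obtain \<alpha> \<beta> where \<alpha>: "\<alpha> \<in> IM" "a = emb \<alpha>" and \<beta>: "\<beta> \<in> IM" "b = emb \<beta>" by auto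
  obtain u where u: "0 < u" "u < 1" "emb \<nu> = (1 - u) *\<^sub>R emb \<alpha> + u *\<^sub>R emb \<beta>" and "emb \<alpha> \<noteq> emb \<beta>"
    using seg \<alpha> \<beta> by (auto simp: in_segment)
  have "emb (mix (1 - u) \<alpha> \<beta>) = emb \<nu>" "mix (1 - u) \<alpha> \<beta> \<in> IM"
    using u emb_mix[OF \<alpha>(1) \<beta>(1), of "1 - u"] mix_invariant(1)[OF \<alpha>(1) \<beta>(1), of "1 - u"] by auto
  then have eq: "mix (1 - u) \<alpha> \<beta> = \<nu>" using inj_on_emb \<nu> by (auto dest: inj_onD)
  have m: "measure \<nu> A = (1 - u) * measure \<alpha> A + u * measure \<beta> A" if "A \<in> sets borel" for A
    using mix_invariant(2)[OF \<alpha>(1) \<beta>(1) _ _ that, of "1 - u"] u by (simp add: eq)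
  interpret N: prob_space \<nu> by (rule invariant_measuresD(3)[OF \<nu>])
  have "\<gamma> = \<nu>" if \<gamma>: "\<gamma> \<in> IM" and ac: "\<And>A. A \<in> sets borel \<Longrightarrow> measure \<nu> A = 0 \<Longrightarrow> measure \<gamma> A = 0" for \<gamma>
  proof (rule invariant_measures_eqI[OF \<gamma> \<nu>])
    fix w
    interpret G: prob_space \<gamma> by (rule invariant_measuresD(3)[OF \<gamma>])
    have "{x \<in> space borel. freq w x \<noteq> measure \<nu> (cyl w)} \<in> sets borel" by measurable
    then have Z: "{x. freq w x \<noteq> measure \<nu> (cyl w)} \<in> sets borel" by simp
    have "measure \<nu> {x. freq w x \<noteq> measure \<nu> (cyl w)} = 0"
      using erg Z invariant_measuresD(1)[OF \<nu>] by (subst N.prob_eq_0) (auto simp: ergodic_measure_def)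
    then have "measure \<gamma> {x. freq w x \<noteq> measure \<nu> (cyl w)} = 0" using ac Z by blast
    then have "AE x in \<gamma>. freq w x = measure \<nu> (cyl w)"
      using Z invariant_measuresD(1)[OF \<gamma>] by (subst (asm) G.prob_eq_0) auto
    then have "(\<integral>x. freq w x \<partial>\<gamma>) = (\<integral>x. measure \<nu> (cyl w) \<partial>\<gamma>)"
      by (intro integral_cong_AE borel_measurable_invariant[OF \<gamma>] freq_measurable) auto
    then show "measure \<gamma> (cyl w) = measure \<nu> (cyl w)"
      using G.prob_space by (simp add: integral_freq[OF \<gamma>])
  qed
  moreover have "measure \<alpha> A = 0" "measure \<beta> A = 0" if "A \<in> sets borel" "measure \<nu> A = 0" for A
    using m[OF that(1)] that(2) u measure_nonneg[of \<alpha> A] measure_nonneg[of \<beta> A]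
    by (smt (verit) mult_pos_pos mult_nonneg_nonneg)+
  ultimately have "\<alpha> = \<nu>" "\<beta> = \<nu>" using \<alpha>(1) \<beta>(1) by blast+
  then show False using \<open>emb \<alpha> \<noteq> emb \<beta>\<close> by simp
qed

text \<open>If \<open>freq w\<close> is not constant, it exceeds its mean on a set \<open>A\<close>
  of measure strictly between \<open>0\<close> and \<open>1\<close>. Frequencies are invariant, so
  conditioning on \<open>A\<close> and on its complement gives invariant measures, and these split
  \<open>\<nu>\<close>.\<close>

lemma extreme_ergodic:
  assumes \<nu>: "\<nu> \<in> IM" and ext: "emb \<nu> extreme_point_of (emb ` IM)"
  shows "ergodic_measure \<nu>"
proof (rule ccontr)
  note [simp] = invariant_measuresD(1,2)[OF \<nu>]
  interpret prob_space \<nu> by (rule invariant_measuresD(3)[OF \<nu>])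
  assume "\<not> ergodic_measure \<nu>"
  then obtain w where w: "\<not> (AE x in \<nu>. freq w x = prob (cyl w))" by (auto simp: ergodic_measure_def)
  define A where "A = {x. freq w x > prob (cyl w)}"
  have "{x \<in> space borel. freq w x > prob (cyl w)} \<in> sets borel" by measurable
  then have A: "A \<in> sets borel" by (simp add: A_def)
  have "prob A \<noteq> 0"
  proof
    assume "prob A = 0"
    then have "AE x in \<nu>. x \<notin> A" using prob_eq_0[of A] A by simp
    then show False using w freq_const_le[OF \<nu>, of w] by (simp add: A_def not_less)
  qed
  then have posA: "prob A > 0" using measure_nonneg[of \<nu> A] by linarith
  have "prob A \<noteq> 1"
  proof
    assume "prob A = 1"
    then have "AE x in \<nu>. x \<in> A" using prob_eq_1[of A] A by simp
    then show False using not_freq_greater[OF \<nu>, of w] by (simp add: A_def)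
  qed
  then have ltA: "prob A < 1" using prob_le_1[of A] by linarith
  have compl: "prob (- A) = 1 - prob A"
    using prob_compl[of A] A by (simp add: Compl_eq_Diff_UNIV)
  have inv: "AE x in \<nu>. shift_map x \<in> A \<longleftrightarrow> x \<in> A"
    using freq_shift[OF \<nu>] by eventually_elim (simp add: A_def)
  have Ac: "- A \<in> sets borel" using A by (simp add: borel_comp)
  have inv': "AE x in \<nu>. shift_map x \<in> - A \<longleftrightarrow> x \<in> - A" using inv by simp
  define \<alpha> where "\<alpha> = uniform_measure \<nu> A"
  define \<beta> where "\<beta> = uniform_measure \<nu> (- A)"
  have \<alpha>: "\<alpha> \<in> IM" unfolding \<alpha>_def by (rule uniform_measure_invariant[OF \<nu> A posA inv])
  have \<beta>: "\<beta> \<in> IM" unfolding \<beta>_def by (rule uniform_measure_invariant[OF \<nu> Ac _ inv']) (use compl ltA in simp)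
  note neA = measure_pos_emeasure[OF posA]
  have neAc: "emeasure \<nu> (- A) \<noteq> 0" "emeasure \<nu> (- A) \<noteq> \<infinity>"
    using measure_pos_emeasure[of \<nu> "- A"] compl ltA by simp_all
  have mixm: "prob B = prob A * measure \<alpha> B + (1 - prob A) * measure \<beta> B" if B: "B \<in> sets borel" for B
  proof -
    have "prob B = prob (A \<inter> B) + prob (- A \<inter> B)"
      using A Ac B by (subst finite_measure_Union[symmetric]) (auto intro: arg_cong[where f=prob])
    then show ?thesis
      using posA ltA B neA neAc by (simp add: \<alpha>_def \<beta>_def compl)
  qed
  have eq: "mix (prob A) \<alpha> \<beta> = \<nu>"
    using mix_invariant[OF \<alpha> \<beta>, of "prob A"] posA ltA mixm
    by (intro invariant_measures_eqI[OF _ \<nu>]) auto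
  have "\<alpha> \<noteq> \<nu>"
  proof
    assume "\<alpha> = \<nu>"
    have "AE x in \<alpha>. prob (cyl w) < freq w x"
      unfolding \<alpha>_def using A by (intro AE_uniform_measureI) (auto simp: A_def)
    then show False unfolding \<open>\<alpha> = \<nu>\<close> using not_freq_greater[OF \<nu>, of w] by contradiction
  qed
  have "\<alpha> \<noteq> \<beta>"
  proof
    assume "\<alpha> = \<beta>"
    then have "measure \<nu> (cyl u) = measure \<alpha> (cyl u)" for u using mixm[of "cyl u"] by (simp add: algebra_simps)
    then show False using invariant_measures_eqI[OF \<alpha> \<nu>] \<open>\<alpha> \<noteq> \<nu>\<close> by simp
  qed
  then have "emb \<alpha> \<noteq> emb \<beta>" using inj_on_emb \<alpha> \<beta> by (auto dest: inj_onD)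
  moreover have "emb \<nu> = (1 - (1 - prob A)) *\<^sub>R emb \<alpha> + (1 - prob A) *\<^sub>R emb \<beta>"
    using emb_mix[OF \<alpha> \<beta>, of "prob A"] eq posA ltA by simp
  ultimately have "emb \<nu> \<in> open_segment (emb \<alpha>) (emb \<beta>)"
    using posA ltA unfolding in_segment by (intro conjI exI[of _ "1 - prob A"]) auto
  then show False using ext \<alpha> \<beta> by (auto simp: extreme_point_of_def)
qed

definition meas :: "bounded_seq \<Rightarrow> (nat \<Rightarrow> nat) measure" where
  "meas = inv_into IM emb"

lemma meas_emb [simp]: "\<mu> \<in> IM \<Longrightarrow> meas (emb \<mu>) = \<mu>"
  by (simp add: meas_def inv_into_f_f[OF inj_on_emb])

lemma meas_in: "y \<in> emb ` IM \<Longrightarrow> meas y \<in> IM"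
  and emb_meas: "y \<in> emb ` IM \<Longrightarrow> emb (meas y) = y"
  by auto

lemma apply_bcontfun_measurable: "(\<lambda>y. apply_bcontfun y k) \<in> borel_measurable (restrict_space borel (K :: bounded_seq set))"
proof (rule borel_measurable_continuous_on_restrict)
  show "continuous_on K (\<lambda>y. apply_bcontfun y k)"
    unfolding continuous_on_def by (auto intro: tendsto_apply_bcontfun tendsto_ident_at)
qed

lemma coord_meas:
  assumes "y \<in> emb ` IM"
  shows "coord (meas y) w = 2 ^ to_nat w * apply_bcontfun y (to_nat w)"
  using apply_emb[OF meas_in[OF assms], of "to_nat w"] emb_meas[OF assms] by (simp add: power_divide)

text \<open>Cylinders form a generator stable under intersections, and on them
  \<open>measure_eq_coord\<close> is a Borel function of the coordinates, involving a series for
  words of zeros.\<close>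

lemma meas_measurable: "meas \<in> restrict_space borel (emb ` IM) \<rightarrow>\<^sub>M prob_algebra borel"
proof (rule measurable_prob_algebra_generated[OF sets_borel_cyl Int_stable_cyl])
  let ?K = "restrict_space borel (emb ` IM)"
  show "prob_space (meas y)" "sets (meas y) = sets borel" if "y \<in> space ?K" for y
    using that meas_in invariant_measuresD by (auto simp: space_restrict_space)
  fix A :: "(nat \<Rightarrow> nat) set" assume "A \<in> insert {} (range cyl)"
  then consider "A = {}" | w where "A = cyl w" by auto
  then show "(\<lambda>y. emeasure (meas y) A) \<in> borel_measurable ?K"
  proof cases
    case 2
    have c: "(\<lambda>y. coord (meas y) u) \<in> borel_measurable ?K" for u
    proof (subst measurable_cong)
      show "coord (meas y) u = 2 ^ to_nat u * apply_bcontfun y (to_nat u)" if "y \<in> space ?K" for y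
        using that by (intro coord_meas) (simp add: space_restrict_space)
      show "(\<lambda>y. 2 ^ to_nat u * apply_bcontfun y (to_nat u)) \<in> borel_measurable ?K"
        by (intro borel_measurable_times borel_measurable_const apply_bcontfun_measurable)
    qed
    note [measurable] = c
    have "(\<lambda>y. ennreal (case w of [] \<Rightarrow> 1 | a # u \<Rightarrow> if a = 0
      then (if set u \<subseteq> {0} then 1 - (\<Sum>a. coord (meas y) [Suc a]) else 0) else coord (meas y) w)) \<in> borel_measurable ?K"
      by (cases w; simp; measurable)
    moreover have "emeasure (meas y) A = ennreal (case w of [] \<Rightarrow> 1 | a # u \<Rightarrow> if a = 0
      then (if set u \<subseteq> {0} then 1 - (\<Sum>a. coord (meas y) [Suc a]) else 0) else coord (meas y) w)"
      if "y \<in> space ?K" for y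
    proof -
      have y: "meas y \<in> IM" using that by (intro meas_in) (simp add: space_restrict_space)
      interpret prob_space "meas y" by (rule invariant_measuresD(3)[OF y])
      show ?thesis using measure_eq_coord[OF y, of w] 2 by (simp add: emeasure_eq_measure)
    qed
    ultimately show ?thesis by (subst measurable_cong) auto
  qed simp
qed auto

end

section \<open>The Choquet simplex\<close>

text \<open>Traces of open sets generate the trace of the Borel sets. This lets measures in the
  sense of \<open>borel_probs\<close> be treated on \<open>restrict_space\<close>.\<close>

lemma sets_borel_measure_of_subset:
  assumes "S \<in> sets borel"
  shows "sets (borel_measure_of (top_of_set S)) = sets (restrict_space borel S)"
proof -
  have eq: "{U. openin (top_of_set S) U} = (\<inter>) S ` {U. open U}"
    by (auto simp: openin_open)
  have "sets (borel_measure_of (top_of_set S)) = sigma_sets S ((\<inter>) S ` {U. open U})"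
    unfolding borel_measure_of_def eq by (subst sets_measure_of) auto
  also have "\<dots> = (\<inter>) S ` sigma_sets UNIV {U. open U}"
    using assms by (intro sigma_sets_Int[symmetric]) (auto simp: borel_def)
  finally show ?thesis by (simp add: sets_restrict_space borel_def)
qed

lemma apply_bcontfun_linear:
  "linear (\<lambda>y :: bounded_seq. apply_bcontfun y k)" "continuous_on UNIV (\<lambda>y :: bounded_seq. apply_bcontfun y k)"
proof -
  show "linear (\<lambda>y :: bounded_seq. apply_bcontfun y k)"
    by (rule linearI) (simp_all add: plus_bcontfun.rep_eq scaleR_bcontfun.rep_eq)
  show "continuous_on UNIV (\<lambda>y :: bounded_seq. apply_bcontfun y k)"
    unfolding continuous_on_def by (auto intro: tendsto_apply_bcontfun tendsto_ident_at)
qed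

definition unit_seq :: "nat \<Rightarrow> bounded_seq" where
  "unit_seq k = Bcontfun (\<lambda>j. if j = k then 1 else 0)"

lemma apply_unit_seq: "apply_bcontfun (unit_seq k) j = (if j = k then 1 else 0)"
proof -
  have "(\<lambda>j. if j = k then 1 else 0 :: real) \<in> bcontfun"
    by (auto simp: bcontfun_def bounded_iff intro!: exI[of _ 1])
  then show ?thesis by (simp add: unit_seq_def Bcontfun_inverse)
qed

lemma apply_sum_bcontfun: "apply_bcontfun (\<Sum>k\<in>A. f k) j = (\<Sum>k\<in>A. apply_bcontfun (f k :: bounded_seq) j)"
  using linear_sum[OF apply_bcontfun_linear(1)] by blast

definition truncate :: "nat \<Rightarrow> bounded_seq \<Rightarrow> bounded_seq" where
  "truncate n y = (\<Sum>k<n. apply_bcontfun y k *\<^sub>R unit_seq k)"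

lemma apply_truncate: "apply_bcontfun (truncate n y) j = (if j < n then apply_bcontfun y j else 0)"
  by (simp add: truncate_def apply_sum_bcontfun apply_unit_seq scaleR_bcontfun.rep_eq if_distrib cong: if_cong)

lemma weigh_bound:
  assumes "y \<in> weigh ` unit_box"
  shows "\<bar>apply_bcontfun y k\<bar> \<le> (1/2) ^ k"
proof -
  obtain q where q: "q \<in> unit_box" "y = weigh q" using assms by auto
  have "(1/2 :: real) ^ k * q (from_nat k) \<le> (1/2) ^ k"
    using q(1) by (intro mult_left_le) (auto simp: unit_box_def)
  then show ?thesis using q by (simp add: apply_weigh unit_box_def abs_mult)
qed

lemma norm_truncate_le:
  assumes "y \<in> weigh ` unit_box"
  shows "norm (truncate n y) \<le> 1"
proof (rule norm_bound)
  fix k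
  show "norm (apply_bcontfun (truncate n y) k) \<le> 1"
    using weigh_bound[OF assms, of k] power_le_one[of "1/2 :: real" k] by (simp add: apply_truncate)
qed

text \<open>The entries of points of the weighted box decay like \<open>(1/2) ^ k\<close>; for
  arbitrary bounded sequences the truncations may fail to converge in norm.\<close>

lemma truncate_tendsto:
  assumes y: "y \<in> weigh ` unit_box"
  shows "(\<lambda>n. truncate n y) \<longlonglongrightarrow> y"
proof (rule LIM_zero_cancel)
  show "(\<lambda>n. truncate n y - y) \<longlonglongrightarrow> 0"
  proof (rule Lim_null_comparison)
    show "\<forall>\<^sub>F n in sequentially. norm (truncate n y - y) \<le> (1/2) ^ n"
    proof (intro always_eventually allI norm_bound)
      fix n k
      have "n \<le> k \<Longrightarrow> (1/2 :: real) ^ k \<le> (1/2) ^ n" by (intro power_decreasing) auto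
      then show "norm (apply_bcontfun (truncate n y - y) k) \<le> (1/2) ^ n"
        using weigh_bound[OF y, of k] by (auto simp: apply_truncate minus_bcontfun.rep_eq not_less intro: order_trans)
    qed
    show "(\<lambda>n. (1/2 :: real) ^ n) \<longlonglongrightarrow> 0" by (rule LIMSEQ_power_zero) simp
  qed
qed

lemma continuous_linear_bounded:
  fixes f :: "'a::real_normed_vector \<Rightarrow> real"
  assumes f: "linear f" "continuous_on UNIV f"
  obtains C where "\<And>v. norm v \<le> 1 \<Longrightarrow> \<bar>f v\<bar> \<le> C"
proof -
  have "isCont f 0" using f(2) by (simp add: continuous_on_eq_continuous_at)
  then have "\<exists>d>0. \<forall>v. dist v 0 < d \<longrightarrow> dist (f v) (f 0) < 1"
    unfolding continuous_at_eps_delta by (rule allE[of _ 1]) auto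
  then obtain d where d: "d > 0" "\<And>v. norm v < d \<Longrightarrow> \<bar>f v\<bar> < 1"
    by (auto simp: dist_norm linear_0[OF f(1)])
  have "\<bar>f v\<bar> \<le> 2 / d" if "norm v \<le> 1" for v
  proof -
    have "norm ((d / 2) *\<^sub>R v) < d" using that d(1) by (simp add: mult_left_le le_less_trans[of _ "d / 2"])
    then have "\<bar>(d / 2) * f v\<bar> < 1" using d(2)[of "(d / 2) *\<^sub>R v"] linear_cmul[OF f(1), of "d / 2" v] by simp
    then show ?thesis using d(1) by (simp add: abs_mult field_simps)
  qed
  then show ?thesis using that by blast
qed

text \<open>Continuous linear functionals on the box are limits of combinations of coordinates.\<close>

lemma barycenter_of_coordinates:
  assumes m: "prob_space m" and sets: "sets m = sets (restrict_space borel K)" and K: "K \<subseteq> weigh ` unit_box"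
    and x: "x \<in> weigh ` unit_box"
    and coord: "\<And>k. (\<integral>y. apply_bcontfun y k \<partial>m) = apply_bcontfun x k"
  shows "barycenter_of K m x"
  unfolding barycenter_of_def
proof (intro allI impI)
  fix f :: "bounded_seq \<Rightarrow> real" assume f: "linear f \<and> continuous_on UNIV f"
  interpret prob_space m by fact
  have sp: "space m = K" using sets_eq_imp_space_eq[OF sets] by (simp add: space_restrict_space)
  have meas: "h \<in> borel_measurable m" if "continuous_on UNIV h" for h :: "bounded_seq \<Rightarrow> real"
    using borel_measurable_continuous_on_restrict[of K h] continuous_on_subset[OF that, of K]
      measurable_cong_sets[OF sets refl, of borel] by blast
  obtain C where C: "\<And>v. norm v \<le> 1 \<Longrightarrow> \<bar>f v\<bar> \<le> C"
    using continuous_linear_bounded[of f] f by blast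
  have lim: "(\<lambda>n. f (truncate n y)) \<longlonglongrightarrow> f y" if "y \<in> weigh ` unit_box" for y
    by (rule continuous_on_tendsto_compose[OF conjunct2[OF f] truncate_tendsto[OF that]]) auto
  have ftr: "f (truncate n y) = (\<Sum>k<n. apply_bcontfun y k * f (unit_seq k))" for n y
    using f by (simp add: truncate_def linear_sum linear_cmul)
  have "integrable m (\<lambda>y. apply_bcontfun y k)" for k
  proof (rule integrable_const_bound[of _ 1])
    show "AE y in m. norm (apply_bcontfun y k) \<le> 1"
    proof (rule AE_I2)
      fix y assume "y \<in> space m"
      then have "\<bar>apply_bcontfun y k\<bar> \<le> (1/2) ^ k" using sp K by (intro weigh_bound) auto
      then show "norm (apply_bcontfun y k) \<le> 1" using power_le_one[of "1/2 :: real" k] by simp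
    qed
  qed (rule meas[OF apply_bcontfun_linear(2)])
  then have "(\<integral>y. f (truncate n y) \<partial>m) = f (truncate n x)" for n
    unfolding ftr by (simp add: coord)
  moreover have "(\<lambda>n. \<integral>y. f (truncate n y) \<partial>m) \<longlonglongrightarrow> (\<integral>y. f y \<partial>m)"
  proof (rule integral_dominated_convergence[where w="\<lambda>_. C"])
    show "f \<in> borel_measurable m" using f meas by blast
    show "(\<lambda>y. f (truncate n y)) \<in> borel_measurable m" for n
      unfolding ftr by (intro meas continuous_on_sum continuous_on_mult_right apply_bcontfun_linear(2))
    show "AE y in m. (\<lambda>n. f (truncate n y)) \<longlonglongrightarrow> f y"
      using lim K sp by (intro AE_I2) auto
    show "AE y in m. norm (f (truncate n y)) \<le> C" for n
      using C norm_truncate_le K sp by (intro AE_I2) auto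
  qed auto
  ultimately show "(\<integral>y. f y \<partial>m) = f x"
    using lim[OF x] LIMSEQ_unique by auto
qed

section \<open>Representing measures from the ergodic decomposition\<close>

context loop_finite_shift
begin

abbreviation "K \<equiv> emb ` IM"
abbreviation "KM \<equiv> restrict_space borel K"

lemma K_borel [measurable, simp]: "K \<in> sets borel"
  using compact_emb by (intro borel_closed compact_imp_closed)

lemma K_box: "K \<subseteq> weigh ` unit_box"
  using emb_box by (auto simp: emb_def)

lemma space_KM [simp]: "space KM = K"
  by (simp add: space_restrict_space)

lemma measurable_from_K:
  assumes "sets m = sets KM" "f \<in> KM \<rightarrow>\<^sub>M N"
  shows "f \<in> m \<rightarrow>\<^sub>M N"
  using assms measurable_cong_sets[OF assms(1) refl, of N] by simp

lemma measure_meas_measurable: "A \<in> sets borel \<Longrightarrow> (\<lambda>y. measure (meas y) A) \<in> borel_measurable KM"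
  using measurable_compose[OF measurable_prob_algebraD[OF meas_measurable] measurable_measure_subprob_algebra] .

text \<open>Combines extremality, ergodicity and vanishing variance of the frequencies, for the sake
  of the measurability of the extreme points.\<close>

lemma extreme_points_eq:
  "extreme_points K = {y \<in> K. \<forall>w. (\<integral>x. (freq w x)\<^sup>2 \<partial>meas y) = (measure (meas y) (cyl w))\<^sup>2}" (is "_ = ?E")
proof -
  have "emb \<nu> extreme_point_of K \<longleftrightarrow> (\<forall>w. (\<integral>x. (freq w x)\<^sup>2 \<partial>\<nu>) = (measure \<nu> (cyl w))\<^sup>2)" if "\<nu> \<in> IM" for \<nu>
    using ergodic_extreme[OF that] extreme_ergodic[OF that] freq_const_iff[OF that]
    by (auto simp: ergodic_measure_def)
  then have "y \<in> extreme_points K \<longleftrightarrow> y \<in> ?E" if "y \<in> K" for y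
    using that by (auto simp: extreme_points_def)
  moreover have "extreme_points K \<subseteq> K" by (auto simp: extreme_points_def extreme_point_of_def)
  ultimately show ?thesis by blast
qed

lemma extreme_points_measurable: "extreme_points K \<in> sets KM"
proof -
  have [measurable]: "(\<lambda>y. measure (meas y) (cyl w)) \<in> borel_measurable KM" for w
    by (rule measure_meas_measurable) simp
  have [measurable]: "(\<lambda>y. \<integral>x. (freq w x)\<^sup>2 \<partial>meas y) \<in> borel_measurable KM" for w
    by (rule measurable_compose[OF measurable_prob_algebraD[OF meas_measurable] integral_measurable_subprob_algebra]) measurable
  have "{y \<in> space KM. \<forall>w. (\<integral>x. (freq w x)\<^sup>2 \<partial>meas y) = (measure (meas y) (cyl w))\<^sup>2} \<in> sets KM"
    by measurable
  then show ?thesis by (simp add: extreme_points_eq)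
qed

text \<open>The ergodic component of \<open>x\<close> as a point of \<open>K\<close>. The fallback
  value makes it a total Borel map into \<open>K\<close>; it matters only on a set that is null for
  every measure in \<open>IM\<close>.\<close>

definition freq_proj :: "(nat \<Rightarrow> nat) \<Rightarrow> bounded_seq" where
  "freq_proj x = (if freq_point x \<in> K then freq_point x else emb (SOME \<mu>. \<mu> \<in> IM))"

lemma freq_proj_measurable:
  assumes "IM \<noteq> {}"
  shows "freq_proj \<in> borel \<rightarrow>\<^sub>M KM"
proof (rule measurable_restrict_space2)
  have "(SOME \<mu>. \<mu> \<in> IM) \<in> IM" using assms by (simp add: some_in_eq)
  then show "freq_proj \<in> space borel \<rightarrow> K" by (auto simp: freq_proj_def)
  show "freq_proj \<in> borel \<rightarrow>\<^sub>M borel" unfolding freq_proj_def by measurable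
qed

lemma freq_proj_eq:
  assumes \<nu>: "\<nu> \<in> IM" and eq: "\<And>w. measure \<nu> (cyl w) = freq w x"
  shows "freq_proj x = emb \<nu>"
proof -
  have "coord \<nu> = (\<lambda>w. if w = [] \<or> hd w = 0 then 0 else freq w x)"
    using eq by (auto simp: coord_def)
  then have "freq_point x = emb \<nu>" by (simp add: freq_point_def emb_def)
  then show ?thesis using \<nu> by (simp add: freq_proj_def)
qed

lemma meas_freq_proj:
  assumes \<mu>: "\<mu> \<in> IM"
  shows "AE x in \<mu>. \<forall>w. measure (meas (freq_proj x)) (cyl w) = freq w x"
  using freq_invariant_measure[OF \<mu>]
proof eventually_elim
  case (elim x)
  then obtain \<nu> where "\<nu> \<in> IM" "\<And>w. measure \<nu> (cyl w) = freq w x" by blast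
  then show ?case using freq_proj_eq[of \<nu> x] by simp
qed

text \<open>On a cylinder the mixture has the integral of \<open>freq w\<close> as its value, and
  this integral is \<open>measure \<mu> (cyl w)\<close> by the ergodic theorem.\<close>

lemma disintegration:
  assumes \<mu>: "\<mu> \<in> IM"
  shows "\<mu> \<bind> (\<lambda>x. meas (freq_proj x)) = \<mu>"
proof -
  note [simp] = invariant_measuresD(1,2)[OF \<mu>]
  interpret prob_space \<mu> by (rule invariant_measuresD(3)[OF \<mu>])
  have ne: "IM \<noteq> {}" using \<mu> by auto
  have \<kappa>: "(\<lambda>x. meas (freq_proj x)) \<in> borel \<rightarrow>\<^sub>M prob_algebra borel"
    by (rule measurable_compose[OF freq_proj_measurable[OF ne] meas_measurable])
  then have \<kappa>': "(\<lambda>x. meas (freq_proj x)) \<in> \<mu> \<rightarrow>\<^sub>M prob_algebra borel"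
    using measurable_cong_sets[OF invariant_measuresD(1)[OF \<mu>] refl] by blast
  have inv: "meas (freq_proj x) \<in> IM" for x
    using measurable_space[OF freq_proj_measurable[OF ne], of x] by (intro meas_in) simp
  show ?thesis
  proof (rule invariant_measures_eqI[OF bind_invariant_measures[OF prob_space_axioms \<kappa>' inv] \<mu>])
    fix w
    have "emeasure (\<mu> \<bind> (\<lambda>x. meas (freq_proj x))) (cyl w) = (\<integral>\<^sup>+x. emeasure (meas (freq_proj x)) (cyl w) \<partial>\<mu>)"
      by (rule emeasure_bind[OF not_empty measurable_prob_algebraD[OF \<kappa>']]) simp
    also have "\<dots> = (\<integral>\<^sup>+x. ennreal (freq w x) \<partial>\<mu>)"
    proof (rule nn_integral_cong_AE)
      show "AE x in \<mu>. emeasure (meas (freq_proj x)) (cyl w) = ennreal (freq w x)"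
        using meas_freq_proj[OF \<mu>]
      proof eventually_elim
        case (elim x)
        interpret N: prob_space "meas (freq_proj x)" using invariant_measuresD(3)[OF inv] .
        show ?case using elim by (simp add: N.emeasure_eq_measure)
      qed
    qed
    also have "\<dots> = ennreal (\<integral>x. freq w x \<partial>\<mu>)"
      by (rule nn_integral_eq_integral[OF integrable_freq[OF \<mu>]]) (simp add: freq_bounds)
    finally show "measure (\<mu> \<bind> (\<lambda>x. meas (freq_proj x))) (cyl w) = measure \<mu> (cyl w)"
      by (simp add: measure_def integral_freq[OF \<mu>])
  qed
qed

text \<open>The square \<open>g\<close> of \<open>freq w\<close> is integrated in two ways. By
  \<open>disintegration\<close> its integral over \<open>\<mu>\<close> is the mean of its integrals
  over the components \<open>?\<kappa> x\<close>; almost surely each of these is at least the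
  squared mean, which is \<open>g x\<close>. Equality of the totals forces equality almost
  everywhere, so the frequencies have variance zero on almost every component.\<close>

lemma freq_proj_extreme:
  assumes \<mu>: "\<mu> \<in> IM"
  shows "AE x in \<mu>. freq_proj x \<in> extreme_points K"
proof -
  note [simp] = invariant_measuresD(1,2)[OF \<mu>]
  interpret prob_space \<mu> by (rule invariant_measuresD(3)[OF \<mu>])
  have ne: "IM \<noteq> {}" using \<mu> by auto
  let ?\<kappa> = "\<lambda>x. meas (freq_proj x)"
  have \<kappa>: "?\<kappa> \<in> \<mu> \<rightarrow>\<^sub>M subprob_algebra borel"
    using measurable_prob_algebraD[OF measurable_compose[OF freq_proj_measurable[OF ne] meas_measurable]]
      measurable_cong_sets[OF invariant_measuresD(1)[OF \<mu>] refl] by blast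
  have inK: "freq_proj x \<in> K" for x
    using measurable_space[OF freq_proj_measurable[OF ne], of x] by simp
  then have inv: "?\<kappa> x \<in> IM" for x by (rule meas_in)
  have "AE x in \<mu>. (\<integral>y. (freq w y)\<^sup>2 \<partial>?\<kappa> x) = (measure (?\<kappa> x) (cyl w))\<^sup>2" for w
  proof -
    define g where "g y = (freq w y)\<^sup>2" for y
    have g [measurable]: "g \<in> borel_measurable borel" unfolding g_def by measurable
    have gb: "\<bar>g y\<bar> \<le> 1" for y using freq_bounds[of w y] by (simp add: g_def power_le_one)
    have m1: "(\<lambda>x. \<integral>y. g y \<partial>?\<kappa> x) \<in> borel_measurable \<mu>"
      by (rule measurable_compose[OF \<kappa> integral_measurable_subprob_algebra[OF g]])
    have b1: "\<bar>\<integral>y. g y \<partial>?\<kappa> x\<bar> \<le> 1" for x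
    proof -
      interpret N: prob_space "?\<kappa> x" using invariant_measuresD(3)[OF inv] .
      have "g \<in> borel_measurable (?\<kappa> x)" by (rule borel_measurable_invariant[OF inv g])
      then have "(\<integral>y. g y \<partial>?\<kappa> x) \<le> 1" "0 \<le> (\<integral>y. g y \<partial>?\<kappa> x)"
        using gb by (auto intro!: N.integral_le_const N.integrable_const_bound[of _ 1] integral_nonneg_AE simp: abs_le_iff)
          (simp add: g_def)
      then show ?thesis by simp
    qed
    have i1: "integrable \<mu> (\<lambda>x. \<integral>y. g y \<partial>?\<kappa> x)"
    proof (rule integrable_const_bound[of _ 1])
      show "AE x in \<mu>. norm (\<integral>y. g y \<partial>?\<kappa> x) \<le> 1" using b1 by (intro AE_I2) (simp only: real_norm_def)
    qed (rule m1)
    have i2: "integrable \<mu> g"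
      using integrable_freq_square[OF \<mu>] unfolding g_def .
    have "(\<integral>x. g x \<partial>(\<mu> \<bind> ?\<kappa>)) = (\<integral>x. \<integral>y. g y \<partial>?\<kappa> x \<partial>\<mu>)"
    proof (rule integral_bind[where K=borel and B=1 and B'=1])
      show "AE x in \<mu>. emeasure (?\<kappa> x) (space (?\<kappa> x)) \<le> ennreal 1"
        using invariant_measuresD(3)[OF inv] by (simp add: prob_space.emeasure_space_1)
    qed (use \<kappa> gb g in auto)
    then have "(\<integral>x. (\<integral>y. g y \<partial>?\<kappa> x) - g x \<partial>\<mu>) = 0"
      using i1 i2 by (simp add: disintegration[OF \<mu>])
    moreover have le: "AE x in \<mu>. 0 \<le> (\<integral>y. g y \<partial>?\<kappa> x) - g x"
      using meas_freq_proj[OF \<mu>]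
    proof eventually_elim
      case (elim x)
      then show ?case using freq_square_ge[OF inv[of x], of w] by (simp add: g_def)
    qed
    ultimately have "AE x in \<mu>. (\<integral>y. g y \<partial>?\<kappa> x) - g x = 0"
      using i1 i2 by (subst integral_nonneg_eq_0_iff_AE[symmetric]) auto
    with meas_freq_proj[OF \<mu>] show ?thesis
      by eventually_elim (simp add: g_def)
  qed
  then have "AE x in \<mu>. \<forall>w. (\<integral>y. (freq w y)\<^sup>2 \<partial>?\<kappa> x) = (measure (?\<kappa> x) (cyl w))\<^sup>2"
    unfolding AE_all_countable by blast
  then show ?thesis
    by eventually_elim (simp add: extreme_points_eq inK)
qed

lemma representing_measure_exists:
  assumes \<mu>: "\<mu> \<in> IM"
  defines "m \<equiv> distr \<mu> KM freq_proj"
  shows "prob_space m" "sets m = sets KM" "emeasure m (extreme_points K) = 1" "barycenter_of K m (emb \<mu>)"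
proof -
  note [simp] = invariant_measuresD(1,2)[OF \<mu>]
  interpret prob_space \<mu> by (rule invariant_measuresD(3)[OF \<mu>])
  have ne: "IM \<noteq> {}" using \<mu> by auto
  have p: "freq_proj \<in> \<mu> \<rightarrow>\<^sub>M KM"
    using freq_proj_measurable[OF ne] measurable_cong_sets[OF invariant_measuresD(1)[OF \<mu>] refl] by blast
  show pm: "prob_space m" unfolding m_def by (rule prob_space_distr[OF p])
  show sm: "sets m = sets KM" by (simp add: m_def)
  have "emeasure m (extreme_points K) = emeasure \<mu> (freq_proj -` extreme_points K \<inter> space \<mu>)"
    unfolding m_def by (rule emeasure_distr[OF p extreme_points_measurable])
  also have "\<dots> = emeasure \<mu> (space \<mu>)"
    using freq_proj_extreme[OF \<mu>] measurable_sets[OF p extreme_points_measurable]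
    by (intro emeasure_eq_AE) auto
  finally show "emeasure m (extreme_points K) = 1" using emeasure_space_1 by simp
  show "barycenter_of K m (emb \<mu>)"
  proof (rule barycenter_of_coordinates[OF pm sm K_box])
    show "emb \<mu> \<in> weigh ` unit_box" using K_box \<mu> by auto
    fix k
    have inK: "freq_proj x \<in> K" for x
      using measurable_space[OF freq_proj_measurable[OF ne], of x] by simp
    let ?w = "from_nat k :: nat list"
    \<comment> \<open>The factor that turns the frequency of \<open>?w\<close> into the coordinate
      \<open>k\<close> of the embedding; it vanishes for the dropped words.\<close>
    let ?c = "if ?w = [] \<or> hd ?w = 0 then 0 else (1/2 :: real) ^ k"
    have "(\<integral>y. apply_bcontfun y k \<partial>m) = (\<integral>x. apply_bcontfun (freq_proj x) k \<partial>\<mu>)"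
      unfolding m_def by (rule integral_distr[OF p apply_bcontfun_measurable])
    also have "\<dots> = (\<integral>x. ?c * freq ?w x \<partial>\<mu>)"
    proof (rule integral_cong_AE)
      show "(\<lambda>x. apply_bcontfun (freq_proj x) k) \<in> borel_measurable \<mu>"
        by (rule measurable_compose[OF p apply_bcontfun_measurable])
      show "(\<lambda>x. ?c * freq ?w x) \<in> borel_measurable \<mu>"
        by (intro borel_measurable_times borel_measurable_const borel_measurable_invariant[OF \<mu>] freq_measurable)
      show "AE x in \<mu>. apply_bcontfun (freq_proj x) k = ?c * freq ?w x"
        using meas_freq_proj[OF \<mu>]
      proof eventually_elim
        case (elim x)
        show ?case
          using apply_emb[OF meas_in[OF inK[of x]], of k] elim emb_meas[OF inK[of x]] by (simp add: coord_def)
      qed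
    qed
    also have "\<dots> = apply_bcontfun (emb \<mu>) k"
      by (simp add: apply_emb[OF \<mu>] coord_def integral_freq[OF \<mu>])
    finally show "(\<integral>y. apply_bcontfun y k \<partial>m) = apply_bcontfun (emb \<mu>) k" .
  qed
qed

text \<open>A representing measure \<open>m\<close> turns \<open>\<mu>\<close> into a mixture of ergodic measures \<open>meas y\<close>, and
  \<open>freq_proj\<close> equals \<open>y\<close> almost surely for \<open>meas y\<close>; hence \<open>m\<close> is the image of \<open>\<mu>\<close> under it.\<close>

lemma representing_measure_unique:
  assumes \<mu>: "\<mu> \<in> IM" and m: "prob_space m" "sets m = sets KM" and carried: "emeasure m (extreme_points K) = 1"
    and bary: "barycenter_of K m (emb \<mu>)"
  shows "m = distr \<mu> KM freq_proj"
proof -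
  interpret prob_space m by fact
  note [simp] = invariant_measuresD(1,2)[OF \<mu>]
  have ne: "IM \<noteq> {}" using \<mu> by auto
  have p: "freq_proj \<in> \<mu> \<rightarrow>\<^sub>M KM"
    using freq_proj_measurable[OF ne] measurable_cong_sets[OF invariant_measuresD(1)[OF \<mu>] refl] by blast
  have spm: "space m = K" using sets_eq_imp_space_eq[OF m(2)] by simp
  have \<kappa>: "meas \<in> m \<rightarrow>\<^sub>M prob_algebra borel" by (rule measurable_from_K[OF m(2) meas_measurable])
  have inv: "meas y \<in> IM" if "y \<in> space m" for y using that spm meas_in by simp
  have bind: "m \<bind> meas \<in> IM" by (rule bind_invariant_measures[OF m(1) \<kappa>, where R=R, OF inv])
  have "coord (m \<bind> meas) w = coord \<mu> w" for w
  proof (cases "w = [] \<or> hd w = 0")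
    case False
    interpret B: prob_space "m \<bind> meas" by (rule invariant_measuresD(3)[OF bind])
    have mm: "measure (meas y) (cyl w) = 2 ^ to_nat w * apply_bcontfun y (to_nat w)" if "y \<in> space m" for y
      using coord_meas[of y w] that spm False by (simp add: coord_def)
    have "emeasure (m \<bind> meas) (cyl w) = (\<integral>\<^sup>+y. emeasure (meas y) (cyl w) \<partial>m)"
      by (rule emeasure_bind[OF not_empty measurable_prob_algebraD[OF \<kappa>]]) simp
    also have "\<dots> = (\<integral>\<^sup>+y. ennreal (measure (meas y) (cyl w)) \<partial>m)"
      by (intro nn_integral_cong finite_measure.emeasure_eq_measure prob_space.finite_measure invariant_measuresD(3)[OF inv])
    also have "\<dots> = ennreal (\<integral>y. measure (meas y) (cyl w) \<partial>m)"
    proof (rule nn_integral_eq_integral)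
      show "integrable m (\<lambda>y. measure (meas y) (cyl w))"
        using measurable_from_K[OF m(2) measure_meas_measurable[OF cyl_sets, of w]] invariant_measuresD(3)[OF inv]
        by (intro integrable_const_bound[of _ 1]) (auto simp: prob_space.prob_le_1)
    qed simp
    also have "(\<integral>y. measure (meas y) (cyl w) \<partial>m) = (\<integral>y. 2 ^ to_nat w * apply_bcontfun y (to_nat w) \<partial>m)"
      by (intro Bochner_Integration.integral_cong mm) auto
    also have "\<dots> = 2 ^ to_nat w * apply_bcontfun (emb \<mu>) (to_nat w)"
      using bary apply_bcontfun_linear unfolding barycenter_of_def by simp
    also have "\<dots> = coord \<mu> w"
      using coord_meas[of "emb \<mu>" w] \<mu> by simp
    finally show ?thesis using False by (simp add: coord_def B.emeasure_eq_measure)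
  qed (auto simp: coord_def)
  then have "coord (m \<bind> meas) = coord \<mu>" by (rule ext)
  then have "emb (m \<bind> meas) = emb \<mu>" by (simp add: emb_def)
  then have eq: "m \<bind> meas = \<mu>" using inj_on_emb bind \<mu> by (auto dest: inj_onD)
  have ext': "AE y in m. y \<in> extreme_points K"
    using carried extreme_points_measurable m(2) by (subst prob_eq_1[symmetric]) (auto simp: emeasure_eq_measure)
  show ?thesis
  proof (rule measure_eqI)
    fix D assume "D \<in> sets m"
    then have D: "D \<in> sets KM" by (simp add: m(2))
    have pD: "freq_proj -` D \<in> sets borel"
      using measurable_sets[OF freq_proj_measurable[OF ne] D] by simp
    have "emeasure (distr \<mu> KM freq_proj) D = emeasure \<mu> (freq_proj -` D)"
      by (simp add: emeasure_distr[OF p D])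
    also have "\<dots> = (\<integral>\<^sup>+y. emeasure (meas y) (freq_proj -` D) \<partial>m)"
      using emeasure_bind[OF not_empty measurable_prob_algebraD[OF \<kappa>] pD] by (simp add: eq)
    also have "\<dots> = (\<integral>\<^sup>+y. indicator D y \<partial>m)"
    proof (rule nn_integral_cong_AE)
      show "AE y in m. emeasure (meas y) (freq_proj -` D) = indicator D y"
        using ext' AE_space
      proof eventually_elim
        case (elim y)
        have y: "meas y \<in> IM" "emb (meas y) = y" using elim(2) spm meas_in emb_meas by auto
        interpret N: prob_space "meas y" by (rule invariant_measuresD(3)[OF y(1)])
        have "ergodic_measure (meas y)"
          using elim(1) y by (intro extreme_ergodic) (auto simp: extreme_points_def)
        then have "AE x in meas y. \<forall>w. freq w x = measure (meas y) (cyl w)"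
          unfolding AE_all_countable ergodic_measure_def .
        then have "AE x in meas y. freq_proj x = y"
          by eventually_elim (use freq_proj_eq[OF y(1)] y(2) in simp)
        then have ae: "AE x in meas y. x \<in> freq_proj -` D \<longleftrightarrow> y \<in> D" by eventually_elim simp
        show ?case
        proof (cases "y \<in> D")
          case True
          have "emeasure (meas y) (freq_proj -` D) = emeasure (meas y) (space (meas y))"
            using ae True pD invariant_measuresD(1)[OF y(1)] by (intro emeasure_eq_AE) auto
          then show ?thesis using True N.emeasure_space_1 by simp
        next
          case False
          have "emeasure (meas y) (freq_proj -` D) = emeasure (meas y) {}"
            using ae False pD invariant_measuresD(1)[OF y(1)] by (intro emeasure_eq_AE) auto
          then show ?thesis using False by simp
        qed
      qed
    qed
    also have "\<dots> = emeasure m D" using D m(2) by simp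
    finally show "emeasure m D = emeasure (distr \<mu> KM freq_proj) D" by simp
  qed (simp add: m(2))
qed

theorem choquet_simplex: "metrizable_choquet_simplex K"
  unfolding metrizable_choquet_simplex_def
proof (intro conjI ballI)
  show "compact K" by (rule compact_emb)
  show "convex K" by (rule convex_emb)
  show "metrizable_space (top_of_set K)"
    by (intro metrizable_space_subtopology metrizable_space_euclidean)
  fix x assume "x \<in> K"
  then obtain \<mu> where \<mu>: "\<mu> \<in> IM" "x = emb \<mu>" by auto
  have sets: "sets (borel_measure_of (top_of_set K)) = sets KM" by (rule sets_borel_measure_of_subset) simp
  show "\<exists>!m. m \<in> borel_probs (top_of_set K) \<and> emeasure m (extreme_points K) = 1 \<and> barycenter_of K m x"
  proof (rule ex1I[of _ "distr \<mu> KM freq_proj"])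
    show "distr \<mu> KM freq_proj \<in> borel_probs (top_of_set K) \<and>
      emeasure (distr \<mu> KM freq_proj) (extreme_points K) = 1 \<and> barycenter_of K (distr \<mu> KM freq_proj) x"
      using representing_measure_exists[OF \<mu>(1)] \<mu>(2) sets by (simp add: borel_probs_def)
    fix m assume "m \<in> borel_probs (top_of_set K) \<and> emeasure m (extreme_points K) = 1 \<and> barycenter_of K m x"
    then show "m = distr \<mu> KM freq_proj"
      using representing_measure_unique[OF \<mu>(1), of m] \<mu>(2) sets by (simp add: borel_probs_def)
  qed
qed

end

section \<open>Periodic orbits\<close>

lemma sum_indicator_card: "finite A \<Longrightarrow> (\<Sum>j\<in>A. indicator B j :: real) = card (A \<inter> B)"
  by (simp add: indicator_def sum.If_cases)

definition occ :: "nat list \<Rightarrow> nat \<Rightarrow> (nat \<Rightarrow> nat) \<Rightarrow> real" where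
  "occ w n x = (\<Sum>j<n. indicator (cyl w) ((shift_map ^^ j) x))"

lemma freq_avg_occ: "freq_avg w n x = occ w n x / n"
  by (simp add: freq_avg_eq occ_def)

lemma occ_bounds: "0 \<le> occ w n x" "occ w n x \<le> n"
proof -
  show "0 \<le> occ w n x" by (simp add: occ_def sum_nonneg)
  have "occ w n x \<le> (\<Sum>j<n. 1)" unfolding occ_def by (intro sum_mono) (simp add: indicator_def)
  then show "occ w n x \<le> n" by simp
qed

lemma occ_add: "occ w (m + n) x = occ w m x + occ w n ((shift_map ^^ m) x)"
proof -
  have "(\<Sum>j<m + n. indicator (cyl w) ((shift_map ^^ j) x) :: real) =
    (\<Sum>j<m. indicator (cyl w) ((shift_map ^^ j) x)) + (\<Sum>j<n. indicator (cyl w) ((shift_map ^^ (j + m)) x))"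
    by (induction n) (simp_all add: add.commute)
  then show ?thesis by (simp add: occ_def funpow_add)
qed

text \<open>Whether \<open>w\<close> occurs at time \<open>j\<close> is decided by the letters
  before time \<open>j + length w\<close>, so the counts can differ only at the last
  \<open>length w\<close> times.\<close>

lemma occ_agree:
  assumes "\<And>j. j < n \<Longrightarrow> x j = y j"
  shows "\<bar>occ w n x - occ w n y\<bar> \<le> length w"
proof -
  let ?d = "\<lambda>j. indicator (cyl w) ((shift_map ^^ j) x) - indicator (cyl w) ((shift_map ^^ j) y) :: real"
  have z: "?d j = 0" if "j + length w \<le> n" for j
    using that assms by (auto simp: indicator_def cyl_def shift_map_pow)
  have "\<bar>occ w n x - occ w n y\<bar> \<le> (\<Sum>j<n. \<bar>?d j\<bar>)"
    unfolding occ_def sum_subtractf[symmetric] by (rule sum_abs)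
  also have "\<dots> \<le> (\<Sum>j<n. indicator {n - length w..<n} j)"
    using z by (intro sum_mono) (auto simp: indicator_def)
  also have "\<dots> = card ({..<n} \<inter> {n - length w..<n})" by (simp add: sum_indicator_card)
  also have "\<dots> \<le> length w"
    using card_mono[of "{n - length w..<n}" "{..<n} \<inter> {n - length w..<n}"] by simp
  finally show ?thesis by simp
qed

text \<open>Meant for the frequency \<open>b / N\<close> in a word and \<open>a / L\<close> in a
  loop obtained from it with at most \<open>c\<close> further letters; one \<open>c / N\<close>
  comes from the counts, the other from the lengths.\<close>

lemma ratio_diff_bound:
  fixes a b N L c :: real
  assumes "0 < N" "N \<le> L" "L \<le> N + c" "\<bar>a - b\<bar> \<le> c" "0 \<le> b" "b \<le> N"
  shows "\<bar>a / L - b / N\<bar> \<le> 2 * c / N"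
proof -
  have L: "L > 0" using assms by linarith
  have "\<bar>a / L - b / L\<bar> \<le> c / N"
  proof -
    have "\<bar>a / L - b / L\<bar> = \<bar>a - b\<bar> / L" using L by (simp add: abs_divide flip: diff_divide_distrib)
    also have "\<dots> \<le> c / N" using assms L by (intro frac_le) auto
    finally show ?thesis .
  qed
  moreover have "\<bar>b / L - b / N\<bar> \<le> c / N"
  proof -
    have "b / N - b / L = (b / N) * ((L - N) / L)" using L assms(1) by (simp add: field_simps)
    also have "\<dots> \<le> 1 * (c / N)"
      using assms L by (intro mult_mono frac_le) (auto simp: divide_le_eq)
    finally have "b / N - b / L \<le> c / N" by simp
    moreover have "b / L \<le> b / N" using assms by (intro frac_le) auto
    ultimately show ?thesis by linarith
  qed
  ultimately show ?thesis by (simp add: abs_le_iff)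
qed

text \<open>The uniform distribution on times is pushed forward, instead of being put on the points
  of the orbit, so that the measure is right for every period \<open>L\<close>, minimal or
  not.\<close>

definition orbit_measure :: "(nat \<Rightarrow> nat) \<Rightarrow> nat \<Rightarrow> (nat \<Rightarrow> nat) measure" where
  "orbit_measure x L = distr (measure_pmf (pmf_of_set {..<L})) borel (\<lambda>j. (shift_map ^^ j) x)"

lemma measure_orbit_measure:
  assumes "L \<ge> 1" "A \<in> sets borel"
  shows "measure (orbit_measure x L) A = (\<Sum>j<L. indicator A ((shift_map ^^ j) x)) / L"
proof -
  have ne: "{..<L} \<noteq> {}" using assms(1) by (auto simp: lessThan_empty_iff)
  have "measure (orbit_measure x L) A = measure (measure_pmf (pmf_of_set {..<L})) ((\<lambda>j. (shift_map ^^ j) x) -` A)"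
    unfolding orbit_measure_def using assms(2) by (subst measure_distr) auto
  also have "\<dots> = card ({..<L} \<inter> (\<lambda>j. (shift_map ^^ j) x) -` A) / L"
    using measure_pmf_of_set[OF ne] by simp
  also have "\<dots> = (\<Sum>j<L. indicator ((\<lambda>j. (shift_map ^^ j) x) -` A) j) / L"
    by (simp add: sum_indicator_card)
  finally show ?thesis by (simp add: indicator_def)
qed

context pointed_shift
begin

definition periodic :: "(nat \<Rightarrow> nat) \<Rightarrow> nat \<Rightarrow> bool" where
  "periodic x L \<longleftrightarrow> L \<ge> 1 \<and> (\<forall>n. x (n + L) = x n) \<and> (\<forall>n. R (x n) (x (Suc n)))"

lemma periodic_shift:
  assumes "periodic x L"
  shows "(shift_map ^^ (k * L)) x = x"
proof (induction k)
  case (Suc k)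
  have "(shift_map ^^ L) x = x" using assms by (auto simp: periodic_def shift_map_pow)
  then show ?case using Suc by (simp add: funpow_add)
qed simp

lemma occ_periodic:
  assumes "periodic x L"
  shows "occ w (k * L) x = k * occ w L x"
proof (induction k)
  case (Suc k)
  have "occ w (k * L + L) x = occ w (k * L) x + occ w L x"
    by (simp add: occ_add periodic_shift[OF assms])
  then show ?case using Suc by (simp add: add.commute distrib_right)
qed (simp add: occ_def)

lemma orbit_measure_invariant:
  assumes "periodic x L"
  shows "orbit_measure x L \<in> IM"
  unfolding invariant_measures_def
proof (intro CollectI conjI)
  have L: "L \<ge> 1" using assms by (simp add: periodic_def)
  let ?p = "measure_pmf (pmf_of_set {..<L})"
  let ?O = "orbit_measure x L"
  show s: "sets ?O = sets borel" by (simp add: orbit_measure_def)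
  then have [simp]: "space ?O = UNIV" using sets_eq_imp_space_eq[OF s] by simp
  have m: "(\<lambda>j. (shift_map ^^ j) x) \<in> ?p \<rightarrow>\<^sub>M borel" by simp
  show P: "prob_space ?O"
    unfolding orbit_measure_def by (rule prob_space.prob_space_distr[OF prob_space_measure_pmf m])
  interpret prob_space ?O by fact
  have S: "shift_map \<in> ?O \<rightarrow>\<^sub>M ?O"
    by (subst measurable_cong_sets[where M'=borel and N'=borel]) (simp_all add: s)
  show "distr ?O ?O shift_map = ?O"
  proof (rule measure_eqI)
    fix A assume "A \<in> sets (distr ?O ?O shift_map)"
    then have A: "A \<in> sets borel" by (simp add: s)
    have v: "shift_map -` A \<in> sets borel" using measurable_sets[OF shift_map_measurable A] by simp
    let ?i = "\<lambda>j. indicator A ((shift_map ^^ j) x) :: real"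
    have "(\<Sum>j<L. indicator (shift_map -` A) ((shift_map ^^ j) x) :: real) = (\<Sum>j<L. ?i (Suc j))"
      by (simp add: indicator_def)
    also have "\<dots> = (\<Sum>j<Suc L. ?i j) - ?i 0" by (subst sum.lessThan_Suc_shift) simp
    also have "\<dots> = (\<Sum>j<L. ?i j)" using periodic_shift[OF assms, of 1] by simp
    finally have "measure ?O (shift_map -` A) = measure ?O A"
      using measure_orbit_measure[OF L A, of x] measure_orbit_measure[OF L v, of x] by simp
    then show "emeasure (distr ?O ?O shift_map) A = emeasure ?O A"
      using A v by (simp add: emeasure_distr[OF S] s emeasure_eq_measure)
  qed simp
  have "AE j in ?p. R ((shift_map ^^ j) x 0) ((shift_map ^^ j) x 1)"
    using assms by (intro AE_I2) (simp add: periodic_def shift_map_pow)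
  moreover have "{y \<in> space borel. R (y 0) (y 1)} \<in> sets (borel :: (nat \<Rightarrow> nat) measure)"
    using coordinate_rel_sets[of R 0 1] by simp
  ultimately show "AE y in ?O. R (y 0) (y 1)"
    unfolding orbit_measure_def by (subst AE_distr_iff[OF m]) auto
qed

lemma measure_orbit_cyl:
  assumes "periodic x L"
  shows "measure (orbit_measure x L) (cyl w) = occ w L x / L"
  using measure_orbit_measure[of L "cyl w" x] assms by (simp add: occ_def periodic_def)

text \<open>Over \<open>k\<close> full periods the count is exactly \<open>k * occ w L x\<close>.
  The incomplete period changes both the count and its expected value by at most \<open>L\<close>,
  so the averages differ from the limit by at most \<open>2 * L / n\<close>.\<close>

lemma freq_periodic:
  assumes "periodic x L"
  shows "freq w ((shift_map ^^ i) x) = occ w L x / L"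
proof -
  have L: "L \<ge> 1" using assms by (simp add: periodic_def)
  have "(\<lambda>n. freq_avg w n x - occ w L x / L) \<longlonglongrightarrow> 0"
  proof (rule Lim_null_comparison)
    show "\<forall>\<^sub>F n in sequentially. norm (freq_avg w n x - occ w L x / L) \<le> 2 * real L * inverse (real n)"
    proof (rule eventually_sequentiallyI[of 1])
      fix n :: nat assume n: "n \<ge> 1"
      define k r where "k = n div L" and "r = n mod L"
      have nk: "n = k * L + r" and r: "r < L" using L by (simp_all add: k_def r_def)
      have "occ w n x = k * occ w L x + occ w r x"
        unfolding nk occ_add by (simp add: occ_periodic[OF assms] periodic_shift[OF assms])
      then have eq: "occ w n x - n * (occ w L x / L) = occ w r x - r * (occ w L x / L)"
        using L by (simp add: nk algebra_simps)
      have A: "\<bar>occ w r x\<bar> \<le> L" using occ_bounds[of w r x] r by simp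
      have B: "\<bar>r * (occ w L x / L)\<bar> \<le> real L * 1"
        unfolding abs_mult using occ_bounds[of w L x] r L by (intro mult_mono) (auto simp: divide_le_eq)
      have "\<bar>occ w n x - n * (occ w L x / L)\<bar> \<le> real L + real L * 1"
        unfolding eq by (rule order_trans[OF abs_triangle_ineq4 add_mono[OF A B]])
      moreover have "freq_avg w n x - occ w L x / L = (occ w n x - n * (occ w L x / L)) / n"
        using n by (simp add: freq_avg_occ diff_divide_distrib)
      ultimately show "norm (freq_avg w n x - occ w L x / L) \<le> 2 * real L * inverse (real n)"
        using n by (simp only: real_norm_def abs_divide) (simp add: field_simps)
    qed
    show "(\<lambda>n. 2 * real L * inverse (real n)) \<longlonglongrightarrow> 0"
      by (rule tendsto_mult_right_zero) (rule lim_inverse_n)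
  qed
  then have lim: "(\<lambda>n. freq_avg w n x) \<longlonglongrightarrow> occ w L x / L" by (rule LIM_zero_cancel)
  have "(\<lambda>n. freq_avg w n ((shift_map ^^ i) x)) \<longlonglongrightarrow> occ w L x / L"
    by (induction i) (use lim freq_avg_tendsto_shift in auto)
  then show ?thesis by (rule freq_eqI)
qed

lemma orbit_measure_ergodic:
  assumes "periodic x L"
  shows "ergodic_measure (orbit_measure x L)"
  unfolding ergodic_measure_def
proof
  fix w
  have m: "(\<lambda>j. (shift_map ^^ j) x) \<in> measure_pmf (pmf_of_set {..<L}) \<rightarrow>\<^sub>M borel" by simp
  have "{y \<in> space borel. freq w y = occ w L x / L} \<in> sets borel" by measurable
  then have "AE y in orbit_measure x L. freq w y = occ w L x / L"
    unfolding orbit_measure_def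
    by (subst AE_distr_iff[OF m]) (auto simp: freq_periodic[OF assms])
  then show "AE y in orbit_measure x L. freq w y = measure (orbit_measure x L) (cyl w)"
    using measure_orbit_cyl[OF assms] by simp
qed

lemma orbit_measure_extreme:
  "periodic x L \<Longrightarrow> emb (orbit_measure x L) extreme_point_of (emb ` IM)"
  using ergodic_extreme orbit_measure_invariant orbit_measure_ergodic by blast

lemma coord_orbit_measure:
  assumes "periodic x L" "x 0 \<noteq> 0"
  shows "coord (orbit_measure x L) w = (if w = [] then 0 else occ w L x / L)"
proof -
  have "x n \<noteq> 0" for n using path_zero_iff[of x n] assms by (simp add: periodic_def)
  then have "(shift_map ^^ j) x \<notin> cyl w" if "w \<noteq> []" "hd w = 0" for j
    using that by (cases w) (auto simp: cyl_Cons shift_map_pow)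
  then have "occ w L x = 0" if "w \<noteq> []" "hd w = 0"
    using that by (simp add: occ_def)
  then show ?thesis using measure_orbit_cyl[OF assms(1)] by (auto simp: coord_def)
qed

section \<open>Approximation by periodic orbits\<close>

lemma periodic_of_list:
  assumes "z \<noteq> []" "successively R (z @ [hd z])"
  shows "periodic (\<lambda>n. z ! (n mod length z)) (length z)"
  unfolding periodic_def
proof (intro conjI allI)
  show "length z \<ge> 1" using assms(1) by (simp add: Suc_leI)
  fix n
  show "z ! ((n + length z) mod length z) = z ! (n mod length z)" by simp
  let ?j = "n mod length z"
  have j: "?j < length z" using assms(1) by simp
  have "R ((z @ [hd z]) ! ?j) ((z @ [hd z]) ! Suc ?j)"
    using successively_nth[OF assms(2), of ?j] j by simp
  moreover have "(z @ [hd z]) ! Suc ?j = z ! (Suc n mod length z)"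
  proof -
    have "Suc ?j < length z \<or> Suc ?j = length z" using j by linarith
    then show ?thesis using assms(1) by (auto simp: nth_append mod_Suc hd_conv_nth)
  qed
  ultimately show "R (z ! (n mod length z)) (z ! (Suc n mod length z))"
    using j by (simp add: nth_append)
qed

text \<open>Agreement up to \<open>e\<close> on finitely many words describes a basic neighbourhood
  in \<open>K\<close>. The target \<open>q\<close> is any function, since partial sums and the zero
  function are not given as coordinates of a measure; \<open>x 0 \<noteq> 0\<close> keeps out the
  cemetery orbit, which cannot be joined to other loops.\<close>

definition approximable :: "(nat list \<Rightarrow> real) \<Rightarrow> bool" where
  "approximable q \<longleftrightarrow> (\<forall>W e. finite W \<longrightarrow> e > 0 \<longrightarrow>
     (\<exists>x L. periodic x L \<and> x 0 \<noteq> 0 \<and> (\<forall>w\<in>W. \<bar>coord (orbit_measure x L) w - q w\<bar> \<le> e)))"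

lemma approximableD:
  assumes "approximable q" "finite W" "e > 0"
  obtains x L where "periodic x L" "x 0 \<noteq> 0" "\<And>w. w \<in> W \<Longrightarrow> \<bar>coord (orbit_measure x L) w - q w\<bar> \<le> e"
  using assms(1)[unfolded approximable_def, rule_format, OF assms(2,3)] that by auto

lemma approximable_closed:
  assumes "\<And>W e. finite W \<Longrightarrow> e > 0 \<Longrightarrow> \<exists>p. approximable p \<and> (\<forall>w\<in>W. \<bar>p w - q w\<bar> \<le> e)"
  shows "approximable q"
  unfolding approximable_def
proof (intro allI impI)
  fix W :: "nat list set" and e :: real assume W: "finite W" and e: "e > 0"
  obtain p where p: "approximable p" "\<And>w. w \<in> W \<Longrightarrow> \<bar>p w - q w\<bar> \<le> e / 2"
    using assms[OF W, of "e / 2"] e by auto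
  obtain x L where x: "periodic x L" "x 0 \<noteq> 0" "\<And>w. w \<in> W \<Longrightarrow> \<bar>coord (orbit_measure x L) w - p w\<bar> \<le> e / 2"
    using approximableD[OF p(1) W, of "e / 2"] e by auto
  show "\<exists>x L. periodic x L \<and> x 0 \<noteq> 0 \<and> (\<forall>w\<in>W. \<bar>coord (orbit_measure x L) w - q w\<bar> \<le> e)"
  proof (intro exI conjI ballI)
    fix w assume "w \<in> W"
    then show "\<bar>coord (orbit_measure x L) w - q w\<bar> \<le> e" using p(2)[of w] x(3)[of w] by linarith
  qed (use x in auto)
qed

lemma approximable_orbit: "periodic x L \<Longrightarrow> x 0 \<noteq> 0 \<Longrightarrow> approximable (coord (orbit_measure x L))"
  unfolding approximable_def by (intro allI impI exI[of _ x] exI[of _ L]) auto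

text \<open>Given \<open>e\<close>, only the words with codes below some \<open>m\<close> matter,
  because the weights make all later entries differ by less than \<open>e / 2\<close>.\<close>

lemma approximable_closure:
  assumes \<mu>: "\<mu> \<in> IM" and ap: "approximable (coord \<mu>)"
  shows "emb \<mu> \<in> closure (extreme_points (emb ` IM))"
  unfolding closure_approachable
proof (intro allI impI)
  fix e :: real assume "e > 0"
  obtain m where m: "(1/2 :: real) ^ m < e / 2"
    using real_arch_pow_inv[of "e / 2" "1/2"] \<open>e > 0\<close> by auto
  obtain x L where x: "periodic x L" "x 0 \<noteq> 0"
    "\<And>w. w \<in> from_nat ` {..<m} \<Longrightarrow> \<bar>coord (orbit_measure x L) w - coord \<mu> w\<bar> \<le> e / 2"
    using approximableD[OF ap, of "from_nat ` {..<m}" "e / 2"] \<open>e > 0\<close> by auto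
  have "dist (weigh (coord (orbit_measure x L))) (weigh (coord \<mu>)) \<le> e / 2"
    using x(3) m \<open>e > 0\<close>
    by (intro weigh_near[where m=m] emb_box \<mu> orbit_measure_invariant[OF x(1)]) auto
  then have "dist (emb (orbit_measure x L)) (emb \<mu>) < e"
    using \<open>e > 0\<close> by (simp add: emb_def)
  then show "\<exists>y\<in>extreme_points (emb ` IM). dist y (emb \<mu>) < e"
    using orbit_measure_extreme[OF x(1)] by (auto simp: extreme_points_def)
qed

end

section \<open>Density of the extreme points\<close>

lemma successively_glue:
  "successively P (u @ [hd v]) \<Longrightarrow> successively P v \<Longrightarrow> v \<noteq> [] \<Longrightarrow> successively P (u @ v)"
  by (cases v) (auto simp: successively_append_iff)

lemma successively_map_path:
  "(\<And>n. P (x n) (x (Suc n))) \<Longrightarrow> successively P (map x [m..<n])"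
  by (auto simp: successively_conv_nth)

locale transitive_pointed_shift = loop_finite_shift +
  assumes connected: "i \<noteq> 0 \<Longrightarrow> j \<noteq> 0 \<Longrightarrow> \<exists>s. successively R (i # s @ [j])"
begin

text \<open>The loop runs \<open>a\<close> times through \<open>x\<close>, along \<open>s\<close>,
  \<open>b\<close> times through \<open>y\<close> and back along \<open>r\<close>. The connections
  begin with extra copies of \<open>x 0\<close> and \<open>y 0\<close>, so that the loop closes up
  also for \<open>a = 0\<close> or \<open>b = 0\<close>; these copies account for the
  \<open>2\<close>. Each periodic stretch costs \<open>length w\<close> by \<open>occ_agree\<close>,
  each connection at most its own length.\<close>

lemma periodic_splice:
  assumes x: "periodic x L" and y: "periodic y M"
    and s: "successively R (x 0 # s @ [y 0])" and r: "successively R (y 0 # r @ [x 0])"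
  obtains z T where "periodic z T" "z 0 = x 0" "T = a * L + b * M + (length s + length r + 2)"
    "\<And>w. \<bar>occ w T z - (a * occ w L x + b * occ w M y)\<bar> \<le> 2 * length w + (length s + length r + 2)"
proof -
  define v3 where "v3 = y 0 # r @ [x 0]"
  define v2 where "v2 = map y [0..<b * M] @ v3"
  define v1 where "v1 = (x 0 # s) @ v2"
  define v0 where "v0 = map x [0..<a * L] @ v1"
  define l where "l = map x [0..<a * L] @ (x 0 # s) @ map y [0..<b * M] @ (y 0 # r)"
  define T where "T = length l"
  define z where "z n = l ! (n mod length l)" for n
  have xL: "x (a * L) = x 0" and yM: "y (b * M) = y 0"
    using fun_cong[OF periodic_shift[OF x, of a], of 0] fun_cong[OF periodic_shift[OF y, of b], of 0]
    by (simp_all add: shift_map_pow)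
  have px: "successively R (map x [0..<n])" and py: "successively R (map y [0..<n])" for n
    using x y by (auto intro!: successively_map_path simp: periodic_def)
  have p3: "successively R v3" using r by (simp add: v3_def)
  have px': "successively R (map x [0..<a * L] @ [x 0])" using px[of "Suc (a * L)"] xL by simp
  have py': "successively R (map y [0..<b * M] @ [y 0])" using py[of "Suc (b * M)"] yM by simp
  have h3: "hd v3 = y 0" "v3 \<noteq> []" by (simp_all add: v3_def)
  have p2: "successively R v2"
    unfolding v2_def by (rule successively_glue[OF _ p3]) (simp_all only: h3 py' not_False_eq_True)
  have h2: "hd v2 = y 0" "v2 \<noteq> []"
    using h3 by (cases "b * M = 0"; simp add: v2_def hd_append hd_map del: mult_eq_0_iff)+
  have p1: "successively R v1"
    unfolding v1_def by (rule successively_glue[OF _ p2]) (use s h2 in simp_all)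
  have h1: "hd v1 = x 0" "v1 \<noteq> []" by (simp_all add: v1_def)
  have p0: "successively R v0"
    unfolding v0_def by (rule successively_glue[OF _ p1]) (simp_all only: h1 px' not_False_eq_True)
  have hl: "hd l = x 0" by (cases "a * L = 0") (auto simp: l_def hd_map simp del: mult_eq_0_iff)
  have "l @ [hd l] = v0" using hl by (simp add: l_def v0_def v1_def v2_def v3_def)
  then have per: "periodic z T"
    unfolding z_def[abs_def] T_def using p0 by (intro periodic_of_list) (auto simp: l_def)
  have T: "T = a * L + b * M + (length s + length r + 2)" by (simp add: T_def l_def)
  have "z 0 = x 0" using hl by (simp add: z_def hd_conv_nth l_def)
  moreover have "\<bar>occ w T z - (a * occ w L x + b * occ w M y)\<bar> \<le> 2 * length w + (length s + length r + 2)" for w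
  proof -
    let ?n = "a * L" and ?m = "b * M" and ?k = "length s + 1" and ?k' = "length r + 1"
    have "occ w T z = occ w (?n + (?k + (?m + ?k'))) z" by (simp add: T algebra_simps)
    also have "\<dots> = occ w ?n z + (occ w ?k ((shift_map ^^ ?n) z) +
       (occ w ?m ((shift_map ^^ ?k) ((shift_map ^^ ?n) z)) + occ w ?k' ((shift_map ^^ ?m) ((shift_map ^^ ?k) ((shift_map ^^ ?n) z)))))"
      by (simp only: occ_add)
    finally have eq: "occ w T z = \<dots>" .
    have "\<bar>occ w ?n z - occ w ?n x\<bar> \<le> length w"
    proof (rule occ_agree)
      fix j assume "j < ?n"
      then show "z j = x j" by (simp add: z_def l_def nth_append)
    qed
    moreover have "\<bar>occ w ?m ((shift_map ^^ ?k) ((shift_map ^^ ?n) z)) - occ w ?m y\<bar> \<le> length w"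
    proof (rule occ_agree)
      fix j assume j: "j < ?m"
      have "(shift_map ^^ ?k) ((shift_map ^^ ?n) z) j = z (length (map x [0..<?n] @ (x 0 # s)) + j)"
        by (simp add: shift_map_pow shift_map_def algebra_simps)
      also have "\<dots> = l ! (length (map x [0..<?n] @ (x 0 # s)) + j)"
        unfolding z_def using j by (subst mod_less) (auto simp: l_def)
      also have "l = (map x [0..<?n] @ (x 0 # s)) @ (map y [0..<?m] @ (y 0 # r))" by (simp add: l_def)
      also have "\<dots> ! (length (map x [0..<?n] @ (x 0 # s)) + j) = y j"
        using j by (subst nth_append_length_plus) (simp add: nth_append)
      finally show "(shift_map ^^ ?k) ((shift_map ^^ ?n) z) j = y j" .
    qed
    moreover have "occ w ?n x = a * occ w L x" "occ w ?m y = b * occ w M y"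
      using occ_periodic[OF x] occ_periodic[OF y] by auto
    ultimately show ?thesis
      unfolding eq using occ_bounds[of w ?k "(shift_map ^^ ?n) z"]
        occ_bounds[of w ?k' "(shift_map ^^ ?m) ((shift_map ^^ ?k) ((shift_map ^^ ?n) z))"]
      by (simp add: abs_le_iff)
  qed
  ultimately show ?thesis using that per T by blast
qed

lemma approximable_orbit_mix:
  assumes x: "periodic x L" "x 0 \<noteq> 0" and y: "periodic y M" "y 0 \<noteq> 0" and t: "0 \<le> t" "t \<le> 1"
  shows "approximable (\<lambda>w. t * coord (orbit_measure x L) w + (1 - t) * coord (orbit_measure y M) w)"
  unfolding approximable_def
proof (intro allI impI)
  fix W :: "nat list set" and e :: real assume W: "finite W" and e: "e > 0"
  obtain s r where s: "successively R (x 0 # s @ [y 0])" and r: "successively R (y 0 # r @ [x 0])"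
    using connected x(2) y(2) by blast
  obtain m where m: "\<And>w. w \<in> W \<Longrightarrow> length w \<le> m"
    using finite_maxlen[OF W] less_imp_le by blast
  define c where "c = 2 * m + (length s + length r + 2)"
  \<comment> \<open>The first bound makes the splicing error \<open>2 * c / k\<close> at most
    \<open>e / 2\<close>, the second does the same for the error \<open>1 / k\<close> of rounding
    \<open>t * k\<close> to an integer.\<close>
  obtain k :: nat where k: "real k > max (4 * real c / e) (2 / e)" using reals_Archimedean2 by blast
  then have "real k > 0" using e by (smt (verit) divide_pos_pos max.strict_boundedE)
  have k1: "2 * real c / k \<le> e / 2" "1 / k \<le> e / 2"
    using k e \<open>real k > 0\<close> by (auto simp: field_simps)
  define \<alpha> where "\<alpha> = nat \<lfloor>t * k\<rfloor>"
  have \<alpha>: "real \<alpha> \<le> t * k" "t * k - 1 \<le> real \<alpha>"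
    using t by (auto simp: \<alpha>_def)
  have "t * k \<le> 1 * real k" using t by (intro mult_right_mono) auto
  then have \<alpha>k: "\<alpha> \<le> k" using \<alpha>(1) by simp
  have LM: "L \<ge> 1" "M \<ge> 1" using x y by (auto simp: periodic_def)
  \<comment> \<open>The factors \<open>M\<close> and \<open>L\<close> equalise the two periods: the
    stretches get the lengths \<open>\<alpha> * L * M\<close> and
    \<open>(k - \<alpha>) * L * M\<close>, hence the proportions \<open>\<alpha> / k\<close> and
    \<open>1 - \<alpha> / k\<close> up to the connections.\<close>
  obtain z T where z: "periodic z T" "z 0 = x 0"
    and T: "T = (\<alpha> * M) * L + ((k - \<alpha>) * L) * M + (length s + length r + 2)"
    and oz: "\<And>w. \<bar>occ w T z - ((\<alpha> * M) * occ w L x + ((k - \<alpha>) * L) * occ w M y)\<bar> \<le> 2 * length w + (length s + length r + 2)"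
    using periodic_splice[OF x(1) y(1) s r, of "\<alpha> * M" "(k - \<alpha>) * L"] by metis
  let ?N = "real (L * M * k)"
  have NT: "real T = ?N + (length s + length r + 2)"
  proof -
    have "(\<alpha> * M) * L + ((k - \<alpha>) * L) * M = L * M * (\<alpha> + (k - \<alpha>))" by (simp add: algebra_simps)
    then show ?thesis using T \<alpha>k by simp
  qed
  have "real (1 * 1 * k) \<le> ?N" unfolding of_nat_le_iff using LM by (intro mult_le_mono) auto
  then have Nk: "real k \<le> ?N" by simp
  show "\<exists>x' L'. periodic x' L' \<and> x' 0 \<noteq> 0 \<and> (\<forall>w\<in>W. \<bar>coord (orbit_measure x' L') w -
    (t * coord (orbit_measure x L) w + (1 - t) * coord (orbit_measure y M) w)\<bar> \<le> e)"
  proof (intro exI conjI ballI)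
    show "periodic z T" "z 0 \<noteq> 0" using z x by auto
    fix w assume w: "w \<in> W"
    show "\<bar>coord (orbit_measure z T) w -
      (t * coord (orbit_measure x L) w + (1 - t) * coord (orbit_measure y M) w)\<bar> \<le> e"
    proof (cases "w = []")
      case False
      define f g where "f = occ w L x / L" and "g = occ w M y / M"
      have fg: "0 \<le> f" "f \<le> 1" "0 \<le> g" "g \<le> 1"
        using occ_bounds[of w L x] occ_bounds[of w M y] LM by (auto simp: f_def g_def divide_le_eq)
      define b where "b = (\<alpha> * M) * occ w L x + ((k - \<alpha>) * L) * occ w M y"
      have b: "b = L * M * (\<alpha> * f + (real k - \<alpha>) * g)"
      proof -
        have "occ w L x = L * f" "occ w M y = M * g" using LM by (simp_all add: f_def g_def)
        then show ?thesis using \<alpha>k by (simp add: b_def of_nat_diff algebra_simps)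
      qed
      have "\<bar>occ w T z / T - b / ?N\<bar> \<le> 2 * real c / ?N"
      proof (rule ratio_diff_bound)
        show "0 < ?N" using Nk \<open>real k > 0\<close> by linarith
        show "?N \<le> T" "T \<le> ?N + c" using NT by (auto simp: c_def)
        have "2 * length w + (length s + length r + 2) \<le> c" using m[OF w] by (simp add: c_def)
        then show "\<bar>occ w T z - b\<bar> \<le> c" using oz[of w] unfolding b_def by linarith
        have "0 \<le> \<alpha> * f + (real k - \<alpha>) * g" using fg \<alpha>k by simp
        then show "0 \<le> b" unfolding b by simp
        have "\<alpha> * f + (real k - \<alpha>) * g \<le> real \<alpha> * 1 + (real k - \<alpha>) * 1"
          using fg \<alpha>k by (intro add_mono mult_left_mono) auto
        then have "real (L * M) * (\<alpha> * f + (real k - \<alpha>) * g) \<le> real (L * M) * real k"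
          by (intro mult_left_mono) auto
        then show "b \<le> ?N" unfolding b by simp
      qed
      also have "\<dots> \<le> 2 * real c / k" using Nk \<open>real k > 0\<close> by (intro frac_le) auto
      finally have 1: "\<bar>occ w T z / T - b / ?N\<bar> \<le> e / 2" using k1 by linarith
      have bN: "b / ?N = (\<alpha> / k) * f + (1 - \<alpha> / k) * g"
        using LM \<open>real k > 0\<close> unfolding b by (simp add: field_simps)
      have "\<bar>\<alpha> / k - t\<bar> \<le> 1 / k"
      proof -
        have "\<bar>\<alpha> - t * k\<bar> \<le> 1" using \<alpha> by (simp only: abs_le_iff) linarith
        then have "\<bar>\<alpha> - t * k\<bar> / k \<le> 1 / k" by (intro divide_right_mono) auto
        moreover have "\<alpha> / k - t = (\<alpha> - t * k) / k" using \<open>real k > 0\<close> by (simp add: diff_divide_distrib)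
        ultimately show ?thesis by (simp only: abs_divide abs_of_nat)
      qed
      then have r: "\<bar>\<alpha> / k - t\<bar> * 1 \<le> e / 2" using k1 by simp
      have "\<bar>b / ?N - (t * f + (1 - t) * g)\<bar> = \<bar>\<alpha> / k - t\<bar> * \<bar>f - g\<bar>"
      proof -
        have "\<rho> * f + (1 - \<rho>) * g - (t * f + (1 - t) * g) = (\<rho> - t) * (f - g)" for \<rho>
          by (simp add: algebra_simps)
        then show ?thesis unfolding bN by (simp only: abs_mult)
      qed
      also have "\<dots> \<le> \<bar>\<alpha> / k - t\<bar> * 1"
        using fg by (intro mult_left_mono) auto
      also note r
      finally have 2: "\<bar>b / ?N - (t * f + (1 - t) * g)\<bar> \<le> e / 2" .
      have "z 0 \<noteq> 0" using z x by simp
      then have c: "coord (orbit_measure z T) w = occ w T z / T" "coord (orbit_measure x L) w = f"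
        "coord (orbit_measure y M) w = g"
        using coord_orbit_measure x y z(1) False by (simp_all add: f_def g_def)
      have "\<bar>u - v\<bar> \<le> e" if "\<bar>u - u'\<bar> \<le> e / 2" "\<bar>u' - v\<bar> \<le> e / 2" for u u' v
        using that by linarith
      from this[OF 1 2] show ?thesis unfolding c .
    qed (use e in \<open>simp add: coord_def\<close>)
  qed
qed

lemma approximable_mix:
  assumes p: "approximable p" and q: "approximable q" and t: "0 \<le> t" "t \<le> 1"
  shows "approximable (\<lambda>w. t * p w + (1 - t) * q w)"
proof (rule approximable_closed)
  fix W :: "nat list set" and e :: real assume W: "finite W" and e: "e > 0"
  obtain x L where x: "periodic x L" "x 0 \<noteq> 0" "\<And>w. w \<in> W \<Longrightarrow> \<bar>coord (orbit_measure x L) w - p w\<bar> \<le> e"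
    using approximableD[OF p W e] by blast
  obtain y M where y: "periodic y M" "y 0 \<noteq> 0" "\<And>w. w \<in> W \<Longrightarrow> \<bar>coord (orbit_measure y M) w - q w\<bar> \<le> e"
    using approximableD[OF q W e] by blast
  let ?c = "\<lambda>w. t * coord (orbit_measure x L) w + (1 - t) * coord (orbit_measure y M) w"
  show "\<exists>r. approximable r \<and> (\<forall>w\<in>W. \<bar>r w - (t * p w + (1 - t) * q w)\<bar> \<le> e)"
  proof (intro exI[of _ ?c] conjI ballI)
    show "approximable ?c" by (rule approximable_orbit_mix[OF x(1,2) y(1,2) t])
    fix w assume w: "w \<in> W"
    have "?c w - (t * p w + (1 - t) * q w) = t * (coord (orbit_measure x L) w - p w) + (1 - t) * (coord (orbit_measure y M) w - q w)"
      by (simp add: algebra_simps)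
    also have "\<bar>\<dots>\<bar> \<le> \<bar>t * (coord (orbit_measure x L) w - p w)\<bar> + \<bar>(1 - t) * (coord (orbit_measure y M) w - q w)\<bar>"
      by (rule abs_triangle_ineq)
    also have "\<dots> = t * \<bar>coord (orbit_measure x L) w - p w\<bar> + (1 - t) * \<bar>coord (orbit_measure y M) w - q w\<bar>"
      using t by (simp add: abs_mult)
    also have "\<dots> \<le> t * e + (1 - t) * e"
      using t by (intro add_mono mult_left_mono x(3) y(3) w) auto
    also have "\<dots> = e" by (simp add: algebra_simps)
    finally show "\<bar>?c w - (t * p w + (1 - t) * q w)\<bar> \<le> e" .
  qed
qed

text \<open>In a path of least length no letter repeats, since the piece between two visits to it
  could be cut out.\<close>

lemma distinct_path:
  assumes "i \<noteq> 0" "j \<noteq> 0"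
  obtains p where "p \<noteq> []" "hd p = i" "last p = j" "successively R p" "distinct p"
proof -
  define P where "P p \<longleftrightarrow> p \<noteq> [] \<and> hd p = i \<and> last p = j \<and> successively R p" for p
  obtain s where "successively R (i # s @ [j])" using connected[OF assms] by blast
  then have "P (i # s @ [j])" by (simp add: P_def)
  from ex_has_least_nat[of P, OF this, of length]
  obtain p where p: "P p" "\<And>q. P q \<Longrightarrow> length p \<le> length q" by auto
  have "distinct p"
  proof (rule ccontr)
    assume "\<not> distinct p"
    then obtain xs ys zs y where d: "p = xs @ [y] @ ys @ [y] @ zs" using not_distinct_decomp by blast
    have "p = (xs @ [y]) @ (ys @ y # zs)" "p = (xs @ y # ys) @ (y # zs)" by (simp_all add: d)
    then have "successively R (xs @ [y])" "successively R (y # zs)"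
      using p(1) successively_append_iff unfolding P_def by metis+
    then have "successively R (xs @ (y # zs))" using successively_glue[of R xs "y # zs"] by simp
    moreover have "hd (xs @ y # zs) = i" "last (xs @ y # zs) = j"
      using p(1) unfolding P_def d by (simp_all add: hd_append split: if_splits)
    ultimately have "P (xs @ y # zs)" by (simp add: P_def)
    from p(2)[OF this] show False by (simp add: d)
  qed
  then show ?thesis using p(1) that unfolding P_def by blast
qed

text \<open>Loops through a far away letter are long, but can be chosen to visit each letter at most twice.\<close>

lemma approximable_zero: "approximable (\<lambda>_. 0)"
  unfolding approximable_def
proof (intro allI impI)
  fix W :: "nat list set" and e :: real assume e: "e > 0"
  obtain n :: nat where n: "real n > 2 / e" using reals_Archimedean2 by blast
  obtain N where N: "\<And>w a. \<lbrakk>length w \<le> n + 1; w \<noteq> []; hd w = 1; last w = 1; successively R w; a \<in> set w\<rbrakk> \<Longrightarrow> a < N"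
    using loop_letters_bounded[of 1 "n + 1"] by auto
  define a where "a = N + 2"
  obtain p where p: "p \<noteq> []" "hd p = 1" "last p = a" "successively R p" "distinct p"
    using distinct_path[of 1 a] by (auto simp: a_def)
  obtain p' where p': "p' \<noteq> []" "hd p' = a" "last p' = 1" "successively R p'" "distinct p'"
    using distinct_path[of a 1] by (auto simp: a_def)
  define z where "z = butlast p @ butlast p'"
  have np: "butlast p \<noteq> []"
  proof
    assume "butlast p = []"
    then have "p = [last p]" using append_butlast_last_id[OF p(1)] by simp
    then have "hd p = last p" by (metis list.sel(1))
    then show False using p by (simp add: a_def)
  qed
  have np': "butlast p' \<noteq> []"
  proof
    assume "butlast p' = []"
    then have "p' = [last p']" using append_butlast_last_id[OF p'(1)] by simp
    then have "hd p' = last p'" by (metis list.sel(1))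
    then show False using p' by (simp add: a_def)
  qed
  have "hd (butlast p) = hd (butlast p @ [last p])" using np by simp
  then have "hd (butlast p) = hd p" unfolding append_butlast_last_id[OF p(1)] .
  then have hz: "hd z = 1" using np p by (simp add: z_def)
  have zz: "z @ [hd z] = butlast p @ p'"
    using append_butlast_last_id[OF p'(1)] p'(3) hz by (simp add: z_def)
  have "butlast p @ [hd p'] = p" using append_butlast_last_id[OF p(1)] p(3) p'(2) by simp
  then have "successively R (butlast p @ [hd p'])" using p(4) by (simp only:)
  then have sz: "successively R (z @ [hd z])"
    unfolding zz by (rule successively_glue[OF _ p'(4,1)])
  have z: "z \<noteq> []" using np by (simp add: z_def)
  define x where "x k = z ! (k mod length z)" for k
  have x: "periodic x (length z)" unfolding x_def[abs_def] by (rule periodic_of_list[OF z sz])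
  have x0: "x 0 = 1" using hz z by (simp add: x_def hd_conv_nth)
  have "a \<in> set (z @ [hd z])" using hd_in_set[OF p'(1)] unfolding p'(2) zz by simp
  then have "\<not> length (z @ [hd z]) \<le> n + 1" using N[of "z @ [hd z]" a] sz z hz unfolding a_def by force
  then have len: "real (length z) > 2 / e" using n by simp
  have two: "card {j. j < length z \<and> z ! j = b} \<le> 2" for b
  proof -
    have one: "length (filter ((=) b) l) \<le> 1" if "distinct l" for l :: "nat list"
    proof -
      have "length (filter ((=) b) l) = card (set (filter ((=) b) l))"
        by (rule distinct_card[symmetric]) (use that in simp)
      also have "\<dots> \<le> card {b}" by (intro card_mono) auto
      finally show ?thesis by simp
    qed
    have "card {j. j < length z \<and> z ! j = b} = length (filter ((=) b) z)"
      unfolding length_filter_conv_card by (rule arg_cong[where f=card]) auto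
    also have "\<dots> \<le> 1 + 1"
      unfolding z_def filter_append length_append by (intro add_mono one distinct_butlast p(5) p'(5))
    finally show ?thesis by simp
  qed
  show "\<exists>x L. periodic x L \<and> x 0 \<noteq> 0 \<and> (\<forall>w\<in>W. \<bar>coord (orbit_measure x L) w - 0\<bar> \<le> e)"
  proof (intro exI conjI ballI)
    show "periodic x (length z)" "x 0 \<noteq> 0" using x x0 by auto
    fix w assume "w \<in> W"
    show "\<bar>coord (orbit_measure x (length z)) w - 0\<bar> \<le> e"
    proof (cases w)
      case (Cons b u)
      have "occ w (length z) x \<le> (\<Sum>j<length z. indicator {j. j < length z \<and> z ! j = b} j)"
        unfolding occ_def
      proof (rule sum_mono)
        fix j assume "j \<in> {..<length z}"
        then show "indicator (cyl w) ((shift_map ^^ j) x) \<le> (indicator {j. j < length z \<and> z ! j = b} j :: real)"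
          by (auto simp: indicator_def Cons cyl_Cons shift_map_pow x_def)
      qed
      also have "\<dots> = card ({..<length z} \<inter> {j. j < length z \<and> z ! j = b})"
        by (simp add: sum_indicator_card)
      also have "\<dots> = card {j. j < length z \<and> z ! j = b}"
        by (rule arg_cong[where f="\<lambda>A. real (card A)"]) auto
      also have "\<dots> \<le> 2" using two by simp
      finally have "occ w (length z) x / length z \<le> 2 / length z" by (intro divide_right_mono) auto
      also have "\<dots> \<le> e" using len e z by (simp add: field_simps)
      finally show ?thesis
        using coord_orbit_measure[OF x, of w] x0 occ_bounds[of w "length z" x] by (simp add: Cons)
    qed (use e in \<open>simp add: coord_def\<close>)
  qed
qed

text \<open>Weights of total less than \<open>1\<close> are allowed because the induction starts
  from the zero function. Peeling off \<open>q k\<close> divides the remaining weights by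
  \<open>1 - t k\<close>, so the case \<open>t k = 1\<close> is separate.\<close>

lemma approximable_sum:
  assumes "finite I" "\<And>i. i \<in> I \<Longrightarrow> approximable (q i)" "\<And>i. i \<in> I \<Longrightarrow> 0 \<le> t i" "(\<Sum>i\<in>I. t i) \<le> 1"
  shows "approximable (\<lambda>w. \<Sum>i\<in>I. t i * q i w)"
  using assms
proof (induction I arbitrary: t)
  case empty
  then show ?case using approximable_zero by simp
next
  case (insert k I)
  have nn: "0 \<le> (\<Sum>i\<in>I. t i)" using insert by (intro sum_nonneg) auto
  have sum: "t k + (\<Sum>i\<in>I. t i) \<le> 1" using insert by simp
  have tk: "0 \<le> t k" using insert by simp
  show ?case
  proof (cases "t k = 1")
    case True
    then have "(\<Sum>i\<in>I. t i) = 0" using sum nn by simp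
    then have "\<forall>i\<in>I. t i = 0" using insert by (simp add: sum_nonneg_eq_0_iff)
    then have "(\<lambda>w. \<Sum>i\<in>insert k I. t i * q i w) = q k" using insert True by simp
    then show ?thesis using insert by simp
  next
    case False
    then have lt: "t k < 1" using sum nn by simp
    have "approximable (\<lambda>w. \<Sum>i\<in>I. t i / (1 - t k) * q i w)"
    proof (rule insert.IH)
      show "(\<Sum>i\<in>I. t i / (1 - t k)) \<le> 1"
        using sum lt by (simp flip: sum_divide_distrib)
    qed (use insert lt in auto)
    then have "approximable (\<lambda>w. t k * q k w + (1 - t k) * (\<Sum>i\<in>I. t i / (1 - t k) * q i w))"
      using insert.prems(1)[of k] tk lt by (intro approximable_mix) simp_all
    moreover have "(1 - t k) * (\<Sum>i\<in>I. t i / (1 - t k) * q i w) = (\<Sum>i\<in>I. t i * q i w)" for w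
      using lt by (simp add: sum_distrib_left)
    ultimately show ?thesis using insert.hyps(1,2) by (simp only: sum.insert not_False_eq_True if_False)
  qed
qed

text \<open>By invariance one bound for the first letter serves all times \<open>j\<close>.\<close>

lemma letter_tail:
  assumes \<mu>: "\<mu> \<in> IM" and "e > 0"
  shows "\<exists>M. \<forall>j. measure \<mu> {x. x j > M} \<le> e"
proof -
  note [simp] = invariant_measuresD(1,2)[OF \<mu>]
  interpret prob_space \<mu> by (rule invariant_measuresD(3)[OF \<mu>])
  have m: "{x :: nat \<Rightarrow> nat. x j > M} \<in> sets borel" for j M by (rule coordinate_sets)
  have "(\<lambda>M. prob {x. x 0 > M}) \<longlonglongrightarrow> prob (\<Inter>M. {x. x 0 > M})"
    using m by (intro finite_Lim_measure_decseq) (auto simp: decseq_def)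
  moreover have "(\<Inter>M. {x :: nat \<Rightarrow> nat. x 0 > M}) = {}" by auto
  ultimately have "(\<lambda>M. prob {x. x 0 > M}) \<longlonglongrightarrow> 0" by simp
  then have "\<forall>\<^sub>F M in sequentially. prob {x. x 0 > M} < e" using \<open>e > 0\<close> by (rule order_tendstoD)
  then obtain M where M: "prob {x. x 0 > M} < e" by (auto simp: eventually_sequentially)
  have "prob {x. x j > M} \<le> e" for j
  proof -
    have "{x :: nat \<Rightarrow> nat. x 0 > M} \<in> sets borel" by (rule m)
    from measure_funpow_vimage[OF \<mu> this, of j] M show ?thesis by (simp add: vimage_def shift_map_pow)
  qed
  then show ?thesis by blast
qed

lemma bounded_connections:
  "\<exists>D. \<forall>i\<in>{1..n}. \<forall>j\<in>{1..n}. \<exists>s. successively R (i # s @ [j]) \<and> length s \<le> D"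
proof -
  define s where "s i j = (SOME s. successively R (i # s @ [j]))" for i j
  have s: "successively R (i # s i j @ [j])" if "i \<in> {1..n}" "j \<in> {1..n}" for i j
    unfolding s_def by (rule someI_ex[OF connected]) (use that in auto)
  define D where "D = (\<Sum>(i, j)\<in>{1..n} \<times> {1..n}. length (s i j))"
  have "length (s i j) \<le> D" if "i \<in> {1..n}" "j \<in> {1..n}" for i j
    using member_le_sum[of "(i, j)" "{1..n} \<times> {1..n}" "\<lambda>(i, j). length (s i j)"] that by (simp add: D_def)
  then show ?thesis using s by blast
qed

text \<open>The word \<open>u\<close> followed by \<open>s\<close> is read cyclically. All
  \<open>y\<close> in the cylinder of \<open>u\<close> can be compared with it at once, because they
  share their first \<open>length u\<close> letters.\<close>

lemma word_loop:
  assumes u: "u \<noteq> []" "successively R u" "hd u \<noteq> 0" and s: "successively R (last u # s @ [hd u])"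
  obtains x L where "periodic x L" "x 0 \<noteq> 0"
    "\<And>w y. y \<in> cyl u \<Longrightarrow> \<bar>occ w L x / L - occ w (length u) y / length u\<bar> \<le> 2 * (length w + length s) / length u"
proof -
  define z where "z = u @ s"
  define x where "x k = z ! (k mod length z)" for k
  have "z @ [hd z] = butlast u @ (last u # s @ [hd u])" using u(1) by (simp add: z_def)
  moreover have "successively R (butlast u @ (last u # s @ [hd u]))"
    by (rule successively_glue[OF _ s]) (use u(1,2) in simp_all)
  ultimately have sz: "successively R (z @ [hd z])" by (simp only:)
  have x: "periodic x (length z)"
    unfolding x_def[abs_def] by (rule periodic_of_list[OF _ sz]) (use u(1) in \<open>simp add: z_def\<close>)
  moreover have "x 0 \<noteq> 0" using u by (simp add: x_def z_def hd_conv_nth nth_append)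
  moreover have "\<bar>occ w (length z) x / length z - occ w (length u) y / length u\<bar> \<le> 2 * (length w + length s) / length u"
    if y: "y \<in> cyl u" for w y
  proof -
    have "\<bar>occ w (length z) x / length z - occ w (length u) y / length u\<bar> \<le> 2 * real (length w + length s) / length u"
    proof (rule ratio_diff_bound)
      have "\<bar>occ w (length u) x - occ w (length u) y\<bar> \<le> length w"
        by (rule occ_agree) (use y in \<open>auto simp: cyl_def x_def z_def nth_append\<close>)
      then show "\<bar>occ w (length z) x - occ w (length u) y\<bar> \<le> real (length w + length s)"
        using occ_add[of w "length u" "length s" x] occ_bounds[of w "length s" "(shift_map ^^ length u) x"]
        by (simp add: z_def abs_le_iff)
    qed (use u occ_bounds in \<open>auto simp: z_def\<close>)
    then show ?thesis by simp
  qed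
  ultimately show ?thesis using that by blast
qed

text \<open>By invariance, \<open>\<mu>\<close> of a cylinder is the average of its frequencies in the words \<open>x\<^sub>0 \<dots> x\<^sub>N\<^sub>-\<^sub>1\<close>; up to
  small mass these words have end letters in a fixed finite set and close up to loops at bounded cost.\<close>

theorem approximable_coord:
  assumes \<mu>: "\<mu> \<in> IM"
  shows "approximable (coord \<mu>)"
proof (rule approximable_closed)
  fix W :: "nat list set" and e :: real assume W: "finite W" and e: "e > 0"
  note [simp] = invariant_measuresD(1,2)[OF \<mu>]
  interpret measure_preserving_self \<mu> shift_map by (rule invariant_measuresD(6)[OF \<mu>])
  obtain l where l: "\<And>w. w \<in> W \<Longrightarrow> length w \<le> l"
    using finite_maxlen[OF W] less_imp_le by blast
  \<comment> \<open>The error is split into four quarters: a first letter beyond \<open>N0\<close>,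
    a last letter beyond \<open>N0\<close>, any of the \<open>N\<close> letters beyond
    \<open>M\<close>, and the cost of closing up. The order of choices matters: \<open>N0\<close>
    determines \<open>D\<close>, \<open>N\<close> has to be large compared with \<open>D\<close>,
    and \<open>M\<close> depends on \<open>N\<close> and makes \<open>U\<close> finite.\<close>
  obtain N0 where N0: "\<And>j. prob {x. x j > N0} \<le> e / 4" using letter_tail[OF \<mu>, of "e / 4"] e by auto
  obtain D where D: "\<And>i j. i \<in> {1..N0} \<Longrightarrow> j \<in> {1..N0} \<Longrightarrow> \<exists>s. successively R (i # s @ [j]) \<and> length s \<le> D"
    using bounded_connections[of N0] by blast
  obtain N' :: nat where "real N' > 8 * real (l + D) / e" using reals_Archimedean2 by blast
  define N where "N = Suc N'"
  have N: "N \<ge> 1" "real N > 8 * real (l + D) / e" using \<open>real N' > _\<close> by (auto simp: N_def)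
  have \<delta>: "2 * real (l + D) / N \<le> e / 4" using N e by (simp add: field_simps)
  obtain M where M: "\<And>j. prob {x. x j > M} \<le> e / (4 * N)" using letter_tail[OF \<mu>, of "e / (4 * N)"] e N by auto
  define U where "U = {u. length u = N \<and> set u \<subseteq> {1..M} \<and> hd u \<le> N0 \<and> last u \<le> N0 \<and> successively R u}"
  have finU: "finite U"
    by (rule finite_subset[OF _ finite_lists_length_eq[of "{1..M}" N]]) (auto simp: U_def)
  have "\<exists>x L. periodic x L \<and> x 0 \<noteq> 0 \<and>
      (\<forall>w y. y \<in> cyl u \<longrightarrow> \<bar>occ w L x / L - occ w N y / N\<bar> \<le> 2 * (length w + D) / N)" if u: "u \<in> U" for u
  proof -
    have ne: "u \<noteq> []" using u N by (auto simp: U_def)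
    then have "hd u \<in> set u" "last u \<in> set u" by auto
    then have hl: "hd u \<in> {1..N0}" "last u \<in> {1..N0}" using u by (auto simp: U_def)
    obtain s where s: "successively R (last u # s @ [hd u])" "length s \<le> D" using D[OF hl(2,1)] by blast
    have lu: "length u = N" and su: "successively R u" using u by (auto simp: U_def)
    obtain x L where x: "periodic x L" "x 0 \<noteq> 0"
      "\<And>w y. y \<in> cyl u \<Longrightarrow> \<bar>occ w L x / L - occ w N y / N\<bar> \<le> 2 * (length w + length s) / N"
      using word_loop[OF ne su _ s(1)] hl(1) unfolding lu by auto
    have "\<bar>occ w L x / L - occ w N y / N\<bar> \<le> 2 * (length w + D) / N" if "y \<in> cyl u" for w y
    proof -
      have "real (2 * (length w + length s)) / N \<le> real (2 * (length w + D)) / N"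
        using s(2) by (intro divide_right_mono) auto
      with x(3)[OF that, of w] show ?thesis by (rule order_trans)
    qed
    with x(1,2) show ?thesis by (intro exI[of _ x] exI[of _ L]) simp
  qed
  then have "\<forall>u\<in>U. \<exists>x L. periodic x L \<and> x 0 \<noteq> 0 \<and>
      (\<forall>w y. y \<in> cyl u \<longrightarrow> \<bar>occ w L x / L - occ w N y / N\<bar> \<le> 2 * (length w + D) / N)" by (intro ballI)
  from bchoice[OF this] obtain X where "\<forall>u\<in>U. \<exists>L. periodic (X u) L \<and> X u 0 \<noteq> 0 \<and>
      (\<forall>w y. y \<in> cyl u \<longrightarrow> \<bar>occ w L (X u) / L - occ w N y / N\<bar> \<le> 2 * (length w + D) / N)" by (elim exE) (rule that)
  from bchoice[OF this] obtain L where "\<forall>u\<in>U. periodic (X u) (L u) \<and> X u 0 \<noteq> 0 \<and>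
      (\<forall>w y. y \<in> cyl u \<longrightarrow> \<bar>occ w (L u) (X u) / L u - occ w N y / N\<bar> \<le> 2 * (length w + D) / N)" by (elim exE) (rule that)
  then have X: "\<And>u. u \<in> U \<Longrightarrow> periodic (X u) (L u)" "\<And>u. u \<in> U \<Longrightarrow> X u 0 \<noteq> 0"
    "\<And>u w y. u \<in> U \<Longrightarrow> y \<in> cyl u \<Longrightarrow> \<bar>occ w (L u) (X u) / L u - occ w N y / N\<bar> \<le> 2 * (length w + D) / N"
    by simp_all
  define c where "c u = coord (orbit_measure (X u) (L u))" for u
  \<comment> \<open>The weights may add up to less than \<open>1\<close>: points outside the
    cylinders of \<open>U\<close> contribute nothing, which is the correct contribution for the mass
    on the cemetery.\<close>
  define q where "q w = (\<Sum>u\<in>U. prob (cyl u) * c u w)" for w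
  have cU: "0 \<le> c u w" "c u w \<le> 1" if "u \<in> U" for u w
    using emb_box[OF orbit_measure_invariant[OF X(1)[OF that]]] by (auto simp: c_def unit_box_def)
  have disj: "disjoint_family_on cyl U"
    by (auto simp: disjoint_family_on_def U_def in_cyl_iff)
  have "approximable q"
    unfolding q_def[abs_def]
  proof (rule approximable_sum[OF finU])
    show "approximable (c u)" if "u \<in> U" for u
      unfolding c_def by (rule approximable_orbit[OF X(1,2)[OF that]])
    have "(\<Sum>u\<in>U. prob (cyl u)) = prob (\<Union>u\<in>U. cyl u)"
      by (rule finite_measure_finite_Union[symmetric, OF finU _ disj]) auto
    then show "(\<Sum>u\<in>U. prob (cyl u)) \<le> 1" by simp
  qed simp
  moreover have "\<bar>q w - coord \<mu> w\<bar> \<le> e" if w: "w \<in> W" for w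
  proof (cases "w = [] \<or> hd w = 0")
    case True
    then show ?thesis using e by (auto simp: q_def c_def coord_def)
  next
    case False
    define bad where "bad = {x :: nat \<Rightarrow> nat. x 0 > N0} \<union> {x. x (N - 1) > N0} \<union> (\<Union>j\<in>{..<N}. {x. x j > M})"
    have cs: "{x :: nat \<Rightarrow> nat. x j > m} \<in> sets borel" for j m by (rule coordinate_sets)
    have bad: "bad \<in> sets borel" unfolding bad_def using cs by (intro sets.Un sets.countable_UN'') auto
    have U: "(\<Union>j\<in>{..<N}. {x. x j > M}) \<in> sets borel" using cs by (intro sets.countable_UN'') auto
    have "prob (\<Union>j\<in>{..<N}. {x. x j > M}) \<le> (\<Sum>j<N. prob {x. x j > M})"
      using cs by (intro finite_measure_subadditive_finite) auto
    also have "\<dots> \<le> (\<Sum>j<N. e / (4 * N))" by (intro sum_mono M)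
    finally have 3: "prob (\<Union>j\<in>{..<N}. {x. x j > M}) \<le> (\<Sum>j<N. e / (4 * N))" .
    have "prob ({x. x 0 > N0} \<union> {x. x (N - 1) > N0}) \<le> e / 4 + e / 4"
      by (rule order_trans[OF measure_Un_le add_mono[OF N0 N0]]) (use cs in simp_all)
    from order_trans[OF measure_Un_le add_mono[OF this 3]]
    have "prob bad \<le> e / 4 + e / 4 + (\<Sum>j<N. e / (4 * N))"
      unfolding bad_def using sets.Un[OF cs cs] U by simp
    also have "\<dots> = 3 * e / 4" using N by simp
    finally have pbad: "prob bad \<le> 3 * e / 4" .
    have occ_m: "(\<lambda>x. occ w N x) \<in> borel_measurable \<mu>"
    proof -
      have "(\<lambda>x. N * freq_avg w N x) \<in> borel_measurable borel" by (intro borel_measurable_times borel_measurable_const freq_avg_measurable)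
      then have "(\<lambda>x. occ w N x) \<in> borel_measurable borel" using N by (simp add: freq_avg_occ)
      then show ?thesis by (rule borel_measurable_invariant[OF \<mu>])
    qed
    define E where "E x = occ w N x / N" for x
    define E' where "E' x = (\<Sum>u\<in>U. c u w * indicator (cyl u) x)" for x
    have Eb: "0 \<le> E x" "E x \<le> 1" for x
      using occ_bounds[of w N x] N by (auto simp: E_def divide_le_eq)
    have iE: "integrable \<mu> E"
    proof (rule integrable_const_bound[of _ 1])
      show "AE x in \<mu>. norm (E x) \<le> 1" using Eb by (intro AE_I2) (simp add: abs_of_nonneg)
      show "E \<in> borel_measurable \<mu>"
        unfolding E_def[abs_def] by (intro borel_measurable_divide occ_m borel_measurable_const)
    qed
    have iE': "integrable \<mu> E'"
      unfolding E'_def[abs_def]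
      by (intro Bochner_Integration.integrable_sum integrable_mult_right integrable_real_indicator) (auto simp: emeasure_eq_measure)
    have "(\<integral>x. E x \<partial>\<mu>) = prob (cyl w)"
    proof -
      have f: "(indicator (cyl w) :: _ \<Rightarrow> real) \<in> borel_measurable \<mu>"
        by (intro borel_measurable_invariant[OF \<mu>] borel_measurable_indicator cyl_sets)
      have "integrable \<mu> (\<lambda>x. indicator (cyl w) ((shift_map ^^ j) x) :: real)" for j
        by (rule integrable_const_bound[of _ 1, OF _ measurable_compose[OF funpow_T_measurable f]]) (simp add: indicator_def)
      then have "(\<integral>x. occ w N x \<partial>\<mu>) = N * prob (cyl w)"
        unfolding occ_def by (simp add: integral_funpow_T[OF f])
      then show ?thesis using N by (simp add: E_def)
    qed
    then have EE: "(\<integral>x. E x \<partial>\<mu>) = coord \<mu> w" using False by (simp add: coord_def)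
    have EE': "(\<integral>x. E' x \<partial>\<mu>) = q w"
    proof -
      have "integrable \<mu> (\<lambda>x. c u w * indicator (cyl u) x)" for u
        by (intro integrable_mult_right integrable_real_indicator) (auto simp: emeasure_eq_measure)
      then show ?thesis
        unfolding E'_def[abs_def] q_def by (simp add: mult.commute)
    qed
    have E'_eq: "E' x = (if map x [0..<N] \<in> U then c (map x [0..<N]) w else 0)" for x
    proof -
      have "E' x = (\<Sum>u\<in>U. if u = map x [0..<N] then c u w else 0)"
        unfolding E'_def by (intro sum.cong) (auto simp: U_def in_cyl_iff indicator_def)
      then show ?thesis using finU by (simp add: sum.delta')
    qed
    have "AE x in \<mu>. \<bar>E' x - E x\<bar> \<le> e / 4 + indicator bad x"
      using invariant_measures_AE_path[OF \<mu>]
    proof eventually_elim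
      case (elim x)
      let ?u = "map x [0..<N]"
      have diff1: "\<bar>E' x - E x\<bar> \<le> 1" 
      proof (cases "?u \<in> U")
        case True
        then show ?thesis using Eb[of x] cU[OF True, of w] by (simp add: E'_eq abs_le_iff)
      next
        case False
        then show ?thesis using Eb[of x] by (simp add: E'_eq abs_le_iff)
      qed
      consider "x \<in> bad" | "x \<notin> bad" "x 0 = 0" | "x \<notin> bad" "x 0 \<noteq> 0" by blast
      then show ?case
      proof cases
        case 1
        then show ?thesis using diff1 e by simp
      next
        \<comment> \<open>On the cemetery path both sides vanish: \<open>w\<close> starts with a
          nonzero letter, and the words of \<open>U\<close> contain no \<open>0\<close>.\<close>
        case 2
        then have x0: "x n = 0" for n using path_zero_iff[OF elim] by simp
        have "(shift_map ^^ j) x \<notin> cyl w" for j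
          using False x0 by (cases w) (auto simp: cyl_Cons shift_map_pow)
        then have "E x = 0" by (simp add: E_def occ_def)
        moreover have "?u \<notin> U"
        proof
          assume "?u \<in> U"
          then have "x 0 \<in> {1..M}" using N by (force simp: U_def)
          then show False using 2 by simp
        qed
        ultimately show ?thesis using e by (simp add: E'_eq indicator_def)
      next
        case 3
        then have x0: "x n \<noteq> 0" for n using path_zero_iff[OF elim] by simp
        have "x j \<in> {1..M}" if "j < N" for j
          using 3 that x0[of j] by (auto simp: bad_def not_less Suc_le_eq)
        moreover have "successively R ?u" by (rule successively_map_path) (use elim in auto)
        moreover have "hd ?u = x 0" "last ?u = x (N - 1)" using N by (auto simp: hd_map last_map)
        ultimately have "?u \<in> U" using 3 by (auto simp: U_def bad_def not_less)
        then have "\<bar>occ w (L ?u) (X ?u) / L ?u - occ w N x / N\<bar> \<le> 2 * (length w + D) / N"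
          by (rule X(3)) simp
        also have "\<dots> \<le> 2 * real (l + D) / N" using l[OF w] by (intro divide_right_mono) auto
        also have "\<dots> \<le> e / 4" by (rule \<delta>)
        also have "occ w (L ?u) (X ?u) / L ?u = c ?u w"
          using coord_orbit_measure[OF X(1,2)[OF \<open>?u \<in> U\<close>], of w] False by (simp add: c_def)
        finally show ?thesis using \<open>?u \<in> U\<close> 3 by (simp add: E'_eq E_def indicator_def)
      qed
    qed
    moreover have ib: "integrable \<mu> (\<lambda>x. e / 4 + indicator bad x)"
      using bad by (intro Bochner_Integration.integrable_add integrable_real_indicator) (auto simp: emeasure_eq_measure)
    ultimately have "(\<integral>x. \<bar>E' x - E x\<bar> \<partial>\<mu>) \<le> (\<integral>x. e / 4 + indicator bad x \<partial>\<mu>)"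
      using iE iE' by (intro integral_mono_AE) auto
    also have "\<dots> = e / 4 + prob bad"
    proof -
      have "integrable \<mu> (indicator bad :: _ \<Rightarrow> real)"
        using bad by (intro integrable_real_indicator) (auto simp: emeasure_eq_measure)
      then show ?thesis using prob_space by simp
    qed
    also have "\<dots> \<le> e" using pbad by simp
    finally have "\<bar>\<integral>x. E' x - E x \<partial>\<mu>\<bar> \<le> e"
      using integral_abs_bound[of \<mu> "\<lambda>x. E' x - E x"] by linarith
    then show ?thesis using iE iE' by (simp add: EE EE')
  qed
  ultimately show "\<exists>p. approximable p \<and> (\<forall>w\<in>W. \<bar>p w - coord \<mu> w\<bar> \<le> e)" by blast
qed

theorem poulsen: "poulsen_simplex K"
  unfolding poulsen_simplex_def
proof (intro conjI)
  show "metrizable_choquet_simplex K" by (rule choquet_simplex)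
  have z: "periodic (\<lambda>_. 0) 1" using R_zero_left by (simp add: periodic_def)
  obtain x L where x: "periodic x L" "x 0 \<noteq> 0" using approximableD[OF approximable_zero, of "{}" 1] by auto
  have "L \<ge> 1" using x by (simp add: periodic_def)
  have "indicator (cyl [x 0]) ((shift_map ^^ 0) x) \<le> occ [x 0] L x"
    unfolding occ_def using \<open>L \<ge> 1\<close> by (intro member_le_sum) auto
  then have "measure (orbit_measure x L) (cyl [x 0]) > 0"
    using \<open>L \<ge> 1\<close> by (simp add: measure_orbit_cyl[OF x(1)] cyl_Cons)
  moreover have "measure (orbit_measure (\<lambda>_. 0) 1) (cyl [x 0]) = 0"
    using x(2) measure_orbit_cyl[OF z, of "[x 0]"] by (simp add: occ_def cyl_Cons)
  ultimately have "orbit_measure x L \<noteq> orbit_measure (\<lambda>_. 0) 1" by auto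
  then have "emb (orbit_measure x L) \<noteq> emb (orbit_measure (\<lambda>_. 0) 1)"
    using inj_on_emb orbit_measure_invariant[OF x(1)] orbit_measure_invariant[OF z] by (auto dest: inj_onD)
  then show "\<exists>x\<in>K. \<exists>y\<in>K. x \<noteq> y"
    using orbit_measure_invariant[OF x(1)] orbit_measure_invariant[OF z] by blast
  show "K \<subseteq> closure (extreme_points K)"
    using approximable_closure approximable_coord by blast
qed

end

section \<open>Weak convergence and the cemetery shift\<close>

text \<open>On the cylinders of \<open>U\<close> the error is \<open>e\<close>; off them the step
  function is \<open>0\<close> while \<open>F\<close> is bounded by \<open>C\<close>, which gives
  the second term.\<close>

lemma piecewise_constant_approx:
  assumes p: "prob_space \<nu>" "sets \<nu> = sets borel" and A: "AE x in \<nu>. x \<in> A"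
    and F: "F \<in> borel_measurable borel" "\<And>x. \<bar>F x\<bar> \<le> C"
    and U: "finite U" "disjoint_family_on cyl U" "\<And>u x. u \<in> U \<Longrightarrow> x \<in> A \<Longrightarrow> x \<in> cyl u \<Longrightarrow> \<bar>F x - \<phi> u\<bar> \<le> e"
    and e: "0 \<le> e"
  shows "\<bar>(\<integral>x. F x \<partial>\<nu>) - (\<Sum>u\<in>U. \<phi> u * measure \<nu> (cyl u))\<bar> \<le> e + C * (1 - (\<Sum>u\<in>U. measure \<nu> (cyl u)))"
proof -
  interpret prob_space \<nu> by fact
  have sp: "space \<nu> = UNIV" using sets_eq_imp_space_eq[OF p(2)] by simp
  have ii: "integrable \<nu> (\<lambda>x. indicator (cyl u) x :: real)" for u
    by (rule integrable_real_indicator) (simp_all add: p(2) emeasure_eq_measure)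
  have iF: "integrable \<nu> F"
  proof (rule integrable_const_bound[of _ C])
    show "F \<in> borel_measurable \<nu>" using F(1) measurable_cong_sets[OF p(2) refl] by blast
  qed (use F(2) in simp)
  have iS: "integrable \<nu> (\<lambda>x. \<Sum>u\<in>U. \<phi> u * indicator (cyl u) x)"
    by (intro Bochner_Integration.integrable_sum integrable_mult_right ii)
  have iT: "integrable \<nu> (\<lambda>x. e + C * (1 - (\<Sum>u\<in>U. indicator (cyl u) x)))"
    by (intro Bochner_Integration.integrable_add integrable_mult_right Bochner_Integration.integrable_diff
        Bochner_Integration.integrable_sum ii integrable_const)
  have S: "(\<integral>x. (\<Sum>u\<in>U. \<phi> u * indicator (cyl u) x) \<partial>\<nu>) = (\<Sum>u\<in>U. \<phi> u * measure \<nu> (cyl u))"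
    using ii by (simp add: sp)
  have T: "(\<integral>x. e + C * (1 - (\<Sum>u\<in>U. indicator (cyl u) x)) \<partial>\<nu>) = e + C * (1 - (\<Sum>u\<in>U. measure \<nu> (cyl u)))"
    using ii prob_space by (simp add: sp)
  have "AE x in \<nu>. \<bar>F x - (\<Sum>u\<in>U. \<phi> u * indicator (cyl u) x)\<bar> \<le> e + C * (1 - (\<Sum>u\<in>U. indicator (cyl u) x))"
    using A
  proof eventually_elim
    case (elim x)
    show ?case
    proof (cases "\<exists>u\<in>U. x \<in> cyl u")
      case True
      then obtain u where u: "u \<in> U" "x \<in> cyl u" by blast
      have ind: "indicator (cyl v) x = (if v = u then 1 else 0 :: real)" if "v \<in> U" for v
        using u that U(2) by (auto simp: disjoint_family_on_def indicator_def)
      have "(\<Sum>v\<in>U. \<phi> v * indicator (cyl v) x) = (\<Sum>v\<in>U. if v = u then \<phi> v else 0)"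
        by (intro sum.cong) (auto simp: ind)
      also have "\<dots> = \<phi> u" using U(1) u(1) by simp
      finally have 1: "(\<Sum>v\<in>U. \<phi> v * indicator (cyl v) x) = \<phi> u" .
      have "(\<Sum>v\<in>U. indicator (cyl v) x :: real) = (\<Sum>v\<in>U. if v = u then 1 else 0)"
        by (intro sum.cong) (auto simp: ind)
      also have "\<dots> = 1" using U(1) u(1) by simp
      finally have 2: "(\<Sum>v\<in>U. indicator (cyl v) x :: real) = 1" .
      show ?thesis unfolding 1 2 using U(3)[OF u(1) elim u(2)] by simp
    next
      case False
      then have "(\<Sum>u\<in>U. \<phi> u * indicator (cyl u) x) = 0" "(\<Sum>u\<in>U. indicator (cyl u) x :: real) = 0"
        by (auto intro!: sum.neutral)
      then show ?thesis using F(2)[of x] e by simp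
    qed
  qed
  then have "(\<integral>x. \<bar>F x - (\<Sum>u\<in>U. \<phi> u * indicator (cyl u) x)\<bar> \<partial>\<nu>) \<le> (\<integral>x. e + C * (1 - (\<Sum>u\<in>U. indicator (cyl u) x)) \<partial>\<nu>)"
    using iF iS iT by (intro integral_mono_AE integrable_abs Bochner_Integration.integrable_diff) auto
  moreover have "\<bar>\<integral>x. F x - (\<Sum>u\<in>U. \<phi> u * indicator (cyl u) x) \<partial>\<nu>\<bar> \<le> (\<integral>x. \<bar>F x - (\<Sum>u\<in>U. \<phi> u * indicator (cyl u) x)\<bar> \<partial>\<nu>)"
    by (rule integral_abs_bound)
  moreover have "(\<integral>x. F x - (\<Sum>u\<in>U. \<phi> u * indicator (cyl u) x) \<partial>\<nu>) = (\<integral>x. F x \<partial>\<nu>) - (\<Sum>u\<in>U. \<phi> u * measure \<nu> (cyl u))"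
    using iF iS by (simp only: Bochner_Integration.integral_diff S)
  ultimately show ?thesis unfolding T by simp
qed

text \<open>The good words without a good proper prefix have disjoint cylinders, and these cover
  \<open>A\<close>. There are countably many, so finitely many of them carry mass more than
  \<open>1 - e\<close>.\<close>

lemma good_partition:
  assumes p: "prob_space \<nu>" "sets \<nu> = sets borel" and A: "AE x in \<nu>. x \<in> A"
    and good: "\<And>x. x \<in> A \<Longrightarrow> \<exists>m. good (map x [0..<m])" and e: "e > 0"
  obtains U where "finite U" "disjoint_family_on cyl U" "\<And>u. u \<in> U \<Longrightarrow> good u"
    "(\<Sum>u\<in>U. measure \<nu> (cyl u)) > 1 - e"
proof -
  interpret prob_space \<nu> by fact
  have sp: "space \<nu> = UNIV" using sets_eq_imp_space_eq[OF p(2)] by simp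
  define G where "G = {u. good u \<and> (\<forall>k<length u. \<not> good (take k u))}"
  define U where "U n = from_nat ` {..<n :: nat} \<inter> G" for n
  have disj: "disjoint_family_on cyl G"
    unfolding disjoint_family_on_def
  proof (intro ballI impI)
    have key: "u = v" if "u \<in> G" "v \<in> G" "x \<in> cyl u" "x \<in> cyl v" "length u \<le> length v" for u v x
    proof -
      have uv: "u = map x [0..<length u]" "v = map x [0..<length v]" using that by (simp_all add: in_cyl_iff)
      have "take (length u) v = take (length u) (map x [0..<length v])" using uv(2) by simp
      also have "\<dots> = map x [0..<length u]" using that(5) by (simp add: take_map)
      finally have "take (length u) v = u" using uv(1) by simp
      then have "\<not> length u < length v" using that(1,2) by (auto simp: G_def)
      then have "length u = length v" using that(5) by simp
      then show "u = v" using uv by metis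
    qed
    fix u v assume uv: "u \<in> G" "v \<in> G" "u \<noteq> v"
    show "cyl u \<inter> cyl v = {}"
    proof (rule equals0I)
      fix x assume "x \<in> cyl u \<inter> cyl v"
      then have "u = v" using key[OF uv(1,2), of x] key[OF uv(2,1), of x] by (cases "length u \<le> length v") auto
      with uv(3) show False by contradiction
    qed
  qed
  have cov: "A \<subseteq> (\<Union>u\<in>G. cyl u)"
  proof
    fix x assume "x \<in> A"
    define m where "m = (LEAST m. good (map x [0..<m]))"
    have "good (map x [0..<m])" unfolding m_def using good[OF \<open>x \<in> A\<close>] by (rule LeastI_ex)
    moreover have "\<not> good (take k (map x [0..<m]))" if "k < m" for k
      using not_less_Least[of k "\<lambda>m. good (map x [0..<m])"] that by (simp add: m_def[symmetric] take_map)
    ultimately have "map x [0..<m] \<in> G" by (simp add: G_def)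
    then show "x \<in> (\<Union>u\<in>G. cyl u)" using in_cyl_map by blast
  qed
  have UG: "(\<Union>n. U n) = G"
  proof
    show "G \<subseteq> (\<Union>n. U n)"
    proof
      fix u assume "u \<in> G"
      then have "u \<in> U (Suc (to_nat u))" by (auto simp: U_def intro!: image_eqI[of _ _ "to_nat u"])
      then show "u \<in> (\<Union>n. U n)" by blast
    qed
  qed (auto simp: U_def)
  have ms: "(\<Union>u\<in>U n. cyl u) \<in> sets \<nu>" for n
    unfolding p(2) by (intro sets.countable_UN'') auto
  have "(\<lambda>n. prob (\<Union>u\<in>U n. cyl u)) \<longlonglongrightarrow> prob (\<Union>n. \<Union>u\<in>U n. cyl u)"
  proof (rule finite_Lim_measure_incseq)
    show "range (\<lambda>n. \<Union>u\<in>U n. cyl u) \<subseteq> events" using ms by auto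
    show "incseq (\<lambda>n. \<Union>u\<in>U n. cyl u)"
      unfolding incseq_def U_def by (intro allI impI UN_mono Int_mono image_mono) auto
  qed
  moreover have eqU: "(\<Union>n. \<Union>u\<in>U n. cyl u) = (\<Union>u\<in>G. cyl u)" unfolding UG[symmetric] by blast
  moreover have "prob (\<Union>u\<in>G. cyl u) = 1"
  proof -
    have "(\<Union>u\<in>G. cyl u) \<in> events" unfolding p(2) by (intro sets.countable_UN'') auto
    moreover have "AE x in \<nu>. x \<in> (\<Union>u\<in>G. cyl u)" using A by eventually_elim (use cov in blast)
    ultimately show ?thesis by (subst prob_eq_1) auto
  qed
  ultimately have "(\<lambda>n. prob (\<Union>u\<in>U n. cyl u)) \<longlonglongrightarrow> 1" by simp
  then have "\<forall>\<^sub>F n in sequentially. 1 - e < prob (\<Union>u\<in>U n. cyl u)"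
    by (rule order_tendstoD) (use e in simp)
  then obtain n where n: "1 - e < prob (\<Union>u\<in>U n. cyl u)" by (auto simp: eventually_sequentially)
  have dU: "disjoint_family_on cyl (U n)" using disj by (rule disjoint_family_on_mono[rotated]) (simp add: U_def)
  have fU: "finite (U n)" by (simp add: U_def)
  have "(\<Sum>u\<in>U n. prob (cyl u)) = prob (\<Union>u\<in>U n. cyl u)"
    by (rule finite_measure_finite_Union[symmetric, OF fU _ dU]) (auto simp: p(2))
  with n have "(\<Sum>u\<in>U n. prob (cyl u)) > 1 - e" by (simp only:)
  moreover have "\<And>u. u \<in> U n \<Longrightarrow> good u" by (simp add: U_def G_def)
  ultimately show ?thesis using that[OF fU dU] by blast
qed

text \<open>Continuity is asked only relative to the set \<open>A\<close> that carries all the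
  measures. Tightness follows from the limit being a probability measure: finitely many cylinders on
  which \<open>F\<close> is nearly constant carry almost all of it, and since their masses converge,
  eventually almost all of \<open>\<nu> n\<close> as well.\<close>

lemma portmanteau_cyl:
  fixes F :: "(nat \<Rightarrow> nat) \<Rightarrow> real"
  assumes p: "\<And>n. prob_space (\<nu> n)" "\<And>n. sets (\<nu> n) = sets borel" "\<And>n. AE x in \<nu> n. x \<in> A"
    and p': "prob_space \<nu>'" "sets \<nu>' = sets borel" "AE x in \<nu>'. x \<in> A"
    and F: "F \<in> borel_measurable borel" "\<And>x. \<bar>F x\<bar> \<le> C"
    and cont: "\<And>x e. x \<in> A \<Longrightarrow> e > 0 \<Longrightarrow> \<exists>m. \<forall>y\<in>A \<inter> cyl (map x [0..<m]). \<bar>F y - F x\<bar> \<le> e"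
    and lim: "\<And>u. (\<lambda>n. measure (\<nu> n) (cyl u)) \<longlonglongrightarrow> measure \<nu>' (cyl u)"
  shows "(\<lambda>n. \<integral>x. F x \<partial>\<nu> n) \<longlonglongrightarrow> (\<integral>x. F x \<partial>\<nu>')"
proof (rule LIMSEQ_I)
  fix e :: real assume "e > 0"
  have C0: "C \<ge> 0" by (rule order_trans[OF abs_ge_zero F(2)[of undefined]])
  \<comment> \<open>The total error is less than \<open>3 * d + 2 * C * d\<close>, which is at most
    \<open>4 * (C + 1) * d\<close>; the \<open>1\<close> keeps \<open>k\<close> positive when
    \<open>C = 0\<close>.\<close>
  define k where "k = 4 * (C + 1)"
  define d where "d = e / k"
  have k: "k > 0" using C0 by (simp add: k_def)
  then have d: "d > 0" using \<open>e > 0\<close> by (simp add: d_def)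
  define good where "good u \<longleftrightarrow> (\<exists>c. \<forall>y\<in>A \<inter> cyl u. \<bar>F y - c\<bar> \<le> d)" for u
  have "\<exists>m. good (map x [0..<m])" if "x \<in> A" for x
    using cont[OF that d] by (auto simp: good_def)
  then obtain U where U: "finite U" "disjoint_family_on cyl U" "\<And>u. u \<in> U \<Longrightarrow> good u"
    "(\<Sum>u\<in>U. measure \<nu>' (cyl u)) > 1 - d"
    using good_partition[OF p'(1,2,3) _ d, of good] by blast
  define \<phi> where "\<phi> u = (SOME c. \<forall>y\<in>A \<inter> cyl u. \<bar>F y - c\<bar> \<le> d)" for u
  have \<phi>: "\<bar>F y - \<phi> u\<bar> \<le> d" if "u \<in> U" "y \<in> A" "y \<in> cyl u" for u y
    using someI_ex[of "\<lambda>c. \<forall>y\<in>A \<inter> cyl u. \<bar>F y - c\<bar> \<le> d"] U(3)[OF that(1)] that(2,3)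
    unfolding good_def \<phi>_def by blast
  let ?s = "\<lambda>\<mu>. \<Sum>u\<in>U. \<phi> u * measure \<mu> (cyl u)" and ?t = "\<lambda>\<mu>. \<Sum>u\<in>U. measure \<mu> (cyl u)"
  have a: "\<bar>(\<integral>x. F x \<partial>\<nu> n) - ?s (\<nu> n)\<bar> \<le> d + C * (1 - ?t (\<nu> n))" for n
    by (rule piecewise_constant_approx[OF p(1,2,3) F U(1,2) \<phi>]) (use d in auto)
  have a': "\<bar>(\<integral>x. F x \<partial>\<nu>') - ?s \<nu>'\<bar> \<le> d + C * (1 - ?t \<nu>')"
    by (rule piecewise_constant_approx[OF p'(1,2,3) F U(1,2) \<phi>]) (use d in auto)
  have "(\<lambda>n. ?s (\<nu> n)) \<longlonglongrightarrow> ?s \<nu>'" by (intro tendsto_intros lim)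
  then have "\<forall>\<^sub>F n in sequentially. \<bar>?s (\<nu> n) - ?s \<nu>'\<bar> < d" using d by (auto simp: tendsto_iff dist_real_def)
  moreover have "(\<lambda>n. ?t (\<nu> n)) \<longlonglongrightarrow> ?t \<nu>'" by (intro tendsto_intros lim)
  then have "\<forall>\<^sub>F n in sequentially. 1 - d < ?t (\<nu> n)" using U(4) by (rule order_tendstoD)
  ultimately have "\<forall>\<^sub>F n in sequentially. norm ((\<integral>x. F x \<partial>\<nu> n) - (\<integral>x. F x \<partial>\<nu>')) < e"
  proof eventually_elim
    case (elim n)
    have "C * (1 - ?t (\<nu> n)) \<le> C * d" "C * (1 - ?t \<nu>') \<le> C * d"
      using elim(2) U(4) C0 by (auto intro!: mult_left_mono)
    then have "\<bar>(\<integral>x. F x \<partial>\<nu> n) - (\<integral>x. F x \<partial>\<nu>')\<bar> < 3 * d + 2 * (C * d)"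
      using a[of n] a' elim(1) by (simp only: abs_less_iff abs_le_iff) linarith
    also have "\<dots> \<le> k * d" using C0 d by (simp add: k_def algebra_simps)
    also have "\<dots> = e" using k by (simp add: d_def)
    finally show ?case by simp
  qed
  then show "\<exists>N. \<forall>n\<ge>N. norm ((\<integral>x. F x \<partial>\<nu> n) - (\<integral>x. F x \<partial>\<nu>')) < e"
    by (simp add: eventually_sequentially)
qed

section \<open>Adding the cemetery letter to a transition matrix\<close>

definition cemetery_rel :: "(nat \<Rightarrow> nat \<Rightarrow> bool) \<Rightarrow> nat \<Rightarrow> nat \<Rightarrow> bool" where
  "cemetery_rel B a b \<longleftrightarrow> a = 0 \<and> b = 0 \<or> 0 < a \<and> 0 < b \<and> B (a - 1) (b - 1)"

text \<open>Without zero rows every letter has a chosen successor \<open>f\<close>, and iterating it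
  continues the word to a point of the shift.\<close>

lemma successively_admissible:
  assumes rows: "\<And>i. \<exists>j. B i j" and w: "w \<noteq> []" "successively B w"
  shows "admissible B w"
proof -
  obtain f where f: "\<And>i. B i (f i)" using rows by metis
  \<comment> \<open>Truncated subtraction makes the exponent \<open>0\<close> inside the word;
    beyond it \<open>f\<close> is iterated on the last letter.\<close>
  define x where "x n = (f ^^ (Suc n - length w)) (w ! min n (length w - 1))" for n
  have "B (x n) (x (Suc n))" for n
  proof (cases "Suc n < length w")
    case True
    then have "min n (length w - 1) = n" "min (Suc n) (length w - 1) = Suc n" by auto
    then show ?thesis using successively_nth[OF w(2) True] True by (simp add: x_def)
  next
    case False
    then have "Suc (Suc n) - length w = Suc (Suc n - length w)" "min (Suc n) (length w - 1) = min n (length w - 1)"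
      by auto
    then show ?thesis using f by (simp add: x_def)
  qed
  moreover have "x j = w ! j" if "j < length w" for j
  proof -
    have "Suc j - length w = 0" "min j (length w - 1) = j" using that by auto
    then show ?thesis by (simp add: x_def)
  qed
  ultimately have "x \<in> cylinder B w" by (simp add: cylinder_def markov_shift_def)
  then show ?thesis by (auto simp: admissible_def)
qed

lemma transitive_pointed_shift_cemetery:
  assumes nz: "no_zero_row_or_column B" and tr: "transitive_shift B" and fp: "F_property B"
  shows "transitive_pointed_shift (cemetery_rel B)"
proof
  have rows: "\<And>i. \<exists>j. B i j" using nz by (simp add: no_zero_row_or_column_def)
  show "cemetery_rel B 0 b = (b = 0)" "cemetery_rel B a 0 = (a = 0)" for a b
    by (auto simp: cemetery_rel_def)
  fix i n :: nat assume i: "i \<noteq> 0"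
  let ?W = "{w. length w = n \<and> w \<noteq> [] \<and> hd w = i \<and> last w = i \<and> successively (cemetery_rel B) w}"
  let ?V = "{w. admissible B w \<and> length w = n \<and> hd w = i - 1 \<and> last w = i - 1}"
  \<comment> \<open>Lowering letters by truncated subtraction confuses \<open>0\<close> and
    \<open>1\<close>. It is injective on the loops because a loop at \<open>i \<noteq> 0\<close>
    never meets \<open>0\<close>.\<close>
  have pos: "w ! k > 0" if "w \<in> ?W" "k < length w" for w k
    using that(2)
  proof (induction k)
    case 0
    then show ?case using that(1) i by (simp add: hd_conv_nth)
  next
    case (Suc k)
    have "cemetery_rel B (w ! k) (w ! Suc k)" using successively_nth[of "cemetery_rel B" w k] that(1) Suc.prems by simp
    then show ?case using Suc by (auto simp: cemetery_rel_def)
  qed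
  have inj: "inj_on (map (\<lambda>a. a - 1)) ?W"
  proof
    fix u v assume u: "u \<in> ?W" and v: "v \<in> ?W" and eq: "map (\<lambda>a. a - 1) u = map (\<lambda>a. a - 1) v"
    show "u = v"
    proof (rule nth_equalityI)
      show len: "length u = length v" using u v by simp
      fix k assume k: "k < length u"
      have "u ! k - 1 = v ! k - 1" using arg_cong[OF eq, of "\<lambda>l. l ! k"] k len by simp
      then show "u ! k = v ! k" using pos[OF u, of k] pos[OF v, of k] k len by simp
    qed
  qed
  have "map (\<lambda>a. a - 1) w \<in> ?V" if w: "w \<in> ?W" for w
  proof -
    have "B (w ! k - 1) (w ! Suc k - 1)" if "Suc k < length w" for k
    proof -
      have "cemetery_rel B (w ! k) (w ! Suc k)" using successively_nth[of "cemetery_rel B" w k] w that by simp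
      then show ?thesis using pos[OF w, of k] that by (simp add: cemetery_rel_def)
    qed
    then have "successively B (map (\<lambda>a. a - 1) w)" by (simp add: successively_conv_nth)
    moreover have "map (\<lambda>a. a - 1) w \<noteq> []" using w by simp
    ultimately show ?thesis
      using successively_admissible[OF rows] w by (simp add: hd_map last_map)
  qed
  then have sub: "map (\<lambda>a. a - 1) ` ?W \<subseteq> ?V" by blast
  show "finite ?W"
  proof (cases "n \<ge> 1")
    case True
    then have "finite ?V" using fp by (simp add: F_property_def)
    then show ?thesis using inj_on_finite[OF inj sub] by blast
  next
    case False
    then have "?W = {}" by (auto simp: Suc_le_eq)
    then show ?thesis by (simp only: finite.emptyI)
  qed
next
  have rows: "\<And>i. \<exists>j. B i j" using nz by (simp add: no_zero_row_or_column_def)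
  fix i j :: nat assume ij: "i \<noteq> 0" "j \<noteq> 0"
  have "openin (markov_topology B) (cylinder B [a]) \<and> cylinder B [a] \<noteq> {}" for a
    using successively_admissible[OF rows, of "[a]"] unfolding markov_topology_def admissible_def
    by (auto intro: topology_generated_by_Basis)
  then obtain n where n: "n \<ge> 1" "cylinder B [i - 1] \<inter> (shift_map ^^ n) -` cylinder B [j - 1] \<noteq> {}"
    using tr unfolding transitive_shift_def by meson
  then obtain x where x: "x \<in> cylinder B [i - 1]" "(shift_map ^^ n) x \<in> cylinder B [j - 1]" by blast
  have "successively (cemetery_rel B) (map (\<lambda>k. Suc (x k)) [0..<Suc n])"
    using x(1) by (intro successively_map_path[of _ "\<lambda>k. Suc (x k)"]) (auto simp: cylinder_def markov_shift_def cemetery_rel_def)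
  \<comment> \<open>As \<open>n \<ge> 1\<close>, the first and the last letter are different entries
    of the word, also when \<open>i = j\<close>.\<close>
  moreover have "map (\<lambda>k. Suc (x k)) [0..<Suc n] = i # map (\<lambda>k. Suc (x k)) [1..<n] @ [j]"
    using x n(1) ij by (simp add: cylinder_def shift_map_pow upt_rec[of 0])
  ultimately show "\<exists>s. successively (cemetery_rel B) (i # s @ [j])" by metis
qed

section \<open>The Markov shift\<close>

lemma topspace_markov_topology: "topspace (markov_topology B) = markov_shift B"
proof -
  have "x \<in> cylinder B [x 0]" if "x \<in> markov_shift B" for x using that by (simp add: cylinder_def)
  then have "markov_shift B \<subseteq> (\<Union>w\<in>{w. w \<noteq> []}. cylinder B w)" by blast
  moreover have "cylinder B w \<subseteq> markov_shift B" for w by (auto simp: cylinder_def)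
  moreover have "{cylinder B w | w. w \<noteq> []} = cylinder B ` {w. w \<noteq> []}" by blast
  ultimately have "\<Union> {cylinder B w | w. w \<noteq> []} = markov_shift B" by (simp add: subset_antisym UN_least)
  then show ?thesis by (simp add: markov_topology_def topology_generated_by_topspace)
qed

lemma openin_markov_cylinder:
  assumes "openin (markov_topology B) U" "x \<in> U"
  shows "\<exists>n. cylinder B (map x [0..<n]) \<subseteq> U"
proof -
  have "generate_topology_on {cylinder B w | w. w \<noteq> []} U"
    using assms(1) by (simp add: markov_topology_def openin_topology_generated_by_iff)
  then show ?thesis
    using assms(2)
  proof (induction rule: generate_topology_on.induct)
    case Empty
    then show ?case by simp
  next
    case (Int a b)
    then obtain m n where "cylinder B (map x [0..<m]) \<subseteq> a" "cylinder B (map x [0..<n]) \<subseteq> b" by blast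
    moreover have "cylinder B (map x [0..<max m n]) \<subseteq> cylinder B (map x [0..<m]) \<inter> cylinder B (map x [0..<n])"
      by (auto simp: cylinder_def)
    ultimately show ?case by (intro exI[of _ "max m n"]) blast
  next
    case (UN K)
    then show ?case by (meson Union_iff Union_upper subset_trans)
  next
    case (Basis s)
    then obtain w where "s = cylinder B w" by auto
    then have "cylinder B (map x [0..<length w]) \<subseteq> s"
      using Basis.prems by (auto simp: cylinder_def)
    then show ?case by blast
  qed
qed

lemma openin_markov_cylinder_ne: "w \<noteq> [] \<Longrightarrow> openin (markov_topology B) (cylinder B w)"
  unfolding markov_topology_def by (intro topology_generated_by_Basis) blast

lemma openin_markov: "openin (markov_topology B) (cylinder B w)"
proof (cases "w = []")
  case True
  then have "cylinder B w = topspace (markov_topology B)" by (simp add: topspace_markov_topology cylinder_def)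
  then show ?thesis by simp
qed (rule openin_markov_cylinder_ne)

abbreviation markov_borel :: "(nat \<Rightarrow> nat \<Rightarrow> bool) \<Rightarrow> (nat \<Rightarrow> nat) measure" where
  "markov_borel B \<equiv> borel_measure_of (markov_topology B)"

lemma space_markov_borel [simp]: "space (markov_borel B) = markov_shift B"
  by (simp add: borel_measure_of_def topspace_markov_topology space_measure_of_conv)

lemma openin_sets_markov_borel: "openin (markov_topology B) U \<Longrightarrow> U \<in> sets (markov_borel B)"
  using openin_subset[of "markov_topology B"] unfolding borel_measure_of_def
  by (subst sets_measure_of) (auto simp: topspace_markov_topology)

text \<open>There are only countably many words, so every open set is a countable union of
  cylinders.\<close>

lemma sets_markov_borel: "sets (markov_borel B) = sigma_sets (markov_shift B) (range (cylinder B))"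
proof
  have "U \<in> sigma_sets (markov_shift B) (range (cylinder B))" if U: "openin (markov_topology B) U" for U
  proof -
    have "U = (\<Union>w\<in>{w. cylinder B w \<subseteq> U}. cylinder B w)"
    proof (intro equalityI subsetI)
      fix x assume x: "x \<in> U"
      then have "x \<in> markov_shift B" using openin_subset[OF U] by (auto simp: topspace_markov_topology)
      then have "x \<in> cylinder B (map x [0..<n])" for n by (simp add: cylinder_def)
      then show "x \<in> (\<Union>w\<in>{w. cylinder B w \<subseteq> U}. cylinder B w)"
        using openin_markov_cylinder[OF U x] by blast
    qed blast
    also have "\<dots> \<in> sigma_sets (markov_shift B) (range (cylinder B))"
      by (rule sigma_sets_UNION) (auto intro: sigma_sets.Basic)
    finally show ?thesis .
  qed
  then have "sigma_sets (markov_shift B) {U. openin (markov_topology B) U} \<subseteq> sigma_sets (markov_shift B) (range (cylinder B))"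
    by (intro sigma_sets_mono) auto
  moreover have "{U. openin (markov_topology B) U} \<subseteq> Pow (markov_shift B)"
    using openin_subset[of "markov_topology B"] by (auto simp: topspace_markov_topology)
  ultimately show "sets (markov_borel B) \<subseteq> sigma_sets (markov_shift B) (range (cylinder B))"
    by (simp add: borel_measure_of_def topspace_markov_topology)
  have "sigma_sets (space (markov_borel B)) (range (cylinder B)) \<subseteq> sets (markov_borel B)"
    by (rule sets.sigma_sets_subset) (auto intro: openin_sets_markov_borel openin_markov)
  then show "sigma_sets (markov_shift B) (range (cylinder B)) \<subseteq> sets (markov_borel B)" by simp
qed

definition lift_letters :: "(nat \<Rightarrow> nat) \<Rightarrow> nat \<Rightarrow> nat" where
  "lift_letters x = (\<lambda>n. Suc (x n))"

lemma lift_letters_measurable: "lift_letters \<in> markov_borel B \<rightarrow>\<^sub>M borel"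
proof (rule measurable_sigma_sets[OF sets_borel_cyl])
  fix A :: "(nat \<Rightarrow> nat) set" assume "A \<in> insert {} (range cyl)"
  then consider "A = {}" | w where "A = cyl w" by auto
  then show "lift_letters -` A \<inter> space (markov_borel B) \<in> sets (markov_borel B)"
  proof cases
    case (2 w)
    show ?thesis
    proof (cases "0 \<in> set w")
      case True
      then have "lift_letters -` A = {}"
        using 2 by (auto simp: cyl_def lift_letters_def in_set_conv_nth)
      then show ?thesis by simp
    next
      case False
      have "w ! j \<noteq> 0" if "j < length w" for j using False that nth_mem by metis
      then have "Suc (x j) = w ! j \<longleftrightarrow> x j = w ! j - 1" if "j < length w" for x :: "nat \<Rightarrow> nat" and j
        using that by (metis Suc_pred' bot_nat_0.not_eq_extremum diff_Suc_1)
      then have "lift_letters -` A \<inter> space (markov_borel B) = cylinder B (map (\<lambda>a. a - 1) w)"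
        using 2 by (auto simp: cyl_def lift_letters_def cylinder_def)
      then show ?thesis by (simp add: openin_sets_markov_borel openin_markov)
    qed
  qed simp
qed auto

section \<open>Transfer between the Markov shift and its pointed extension\<close>

context
  fixes B :: "nat \<Rightarrow> nat \<Rightarrow> bool"
  assumes hyp: "no_zero_row_or_column B" "transitive_shift B" "F_property B"
begin

interpretation S: transitive_pointed_shift "cemetery_rel B"
  by (rule transitive_pointed_shift_cemetery[OF hyp])

abbreviation "\<Sigma> \<equiv> markov_shift B"

definition live :: "(nat \<Rightarrow> nat) set" where
  "live = {y. \<forall>n. y n \<noteq> 0 \<and> cemetery_rel B (y n) (y (Suc n))}"

definition base_point :: "nat \<Rightarrow> nat" where
  "base_point = (SOME x. x \<in> \<Sigma>)"

text \<open>Sequences that are not live go to one chosen point of \<open>\<Sigma>\<close>, so that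
  \<open>lower\<close> is a total Borel map into \<open>\<Sigma>\<close>; invariant measures without
  cemetery mass do not see them.\<close>

definition lower :: "(nat \<Rightarrow> nat) \<Rightarrow> nat \<Rightarrow> nat" where
  "lower y = (if y \<in> live then (\<lambda>n. y n - 1) else base_point)"

definition lift_measure :: "(nat \<Rightarrow> nat) measure \<Rightarrow> (nat \<Rightarrow> nat) measure" where
  "lift_measure \<mu> = distr \<mu> borel lift_letters"

definition lower_measure :: "(nat \<Rightarrow> nat) measure \<Rightarrow> (nat \<Rightarrow> nat) measure" where
  "lower_measure \<nu> = distr \<nu> (markov_borel B) lower"

lemma base_point: "base_point \<in> \<Sigma>"
proof -
  have "admissible B [0]"
    using hyp(1) by (intro successively_admissible) (auto simp: no_zero_row_or_column_def)
  then have "\<exists>x. x \<in> \<Sigma>" by (auto simp: admissible_def cylinder_def)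
  then show ?thesis unfolding base_point_def by (rule someI_ex)
qed

lemma live_iff: "y \<in> live \<longleftrightarrow> (\<forall>n. y n \<noteq> 0) \<and> (\<lambda>n. y n - 1) \<in> \<Sigma>"
proof (cases "\<forall>n. y n \<noteq> 0")
  case True
  have "cemetery_rel B (y n) (y (Suc n)) \<longleftrightarrow> B (y n - 1) (y (Suc n) - 1)" for n
    using True[rule_format, of n] True[rule_format, of "Suc n"] by (simp add: cemetery_rel_def)
  then show ?thesis using True by (simp add: live_def markov_shift_def)
next
  case False
  then have "\<not> (\<forall>n. y n \<noteq> 0 \<and> cemetery_rel B (y n) (y (Suc n)))" by blast
  then show ?thesis using False unfolding live_def mem_Collect_eq by (simp only: False_implies_equals simp_thms)
qed

lemma lower_in: "lower y \<in> \<Sigma>"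
  using base_point by (simp add: lower_def live_iff)

lemma lower_lift: "x \<in> \<Sigma> \<Longrightarrow> lower (lift_letters x) = x"
  by (simp add: lower_def live_iff lift_letters_def)

lemma lift_lower: "y \<in> live \<Longrightarrow> lift_letters (lower y) = y"
  by (auto simp: lower_def live_iff lift_letters_def)

lemma lift_live: "x \<in> \<Sigma> \<Longrightarrow> lift_letters x \<in> live"
  by (simp add: live_iff lift_letters_def)

lemma shift_lift: "shift_map (lift_letters x) = lift_letters (shift_map x)"
  by (simp add: shift_map_def lift_letters_def)

lemma shift_lower: "y \<in> live \<Longrightarrow> shift_map (lower y) = lower (shift_map y)"
  by (auto simp: lower_def live_def shift_map_def)

lemma live_sets: "live \<in> sets borel"
proof -
  have "live = (\<Inter>n\<in>UNIV. {y. y n \<noteq> 0 \<and> cemetery_rel B (y n) (y (Suc n))})" by (auto simp: live_def)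
  also have "\<dots> \<in> sets borel"
  proof (rule sets.countable_INT'')
    show "{y. y n \<noteq> 0 \<and> cemetery_rel B (y n) (y (Suc n))} \<in> sets borel" for n
      by (rule coordinate_rel_sets[of "\<lambda>a b. a \<noteq> 0 \<and> cemetery_rel B a b" n "Suc n"])
  qed auto
  finally show ?thesis .
qed

lemma lower_measurable: "lower \<in> borel \<rightarrow>\<^sub>M markov_borel B"
proof (rule measurable_sigma_sets[OF sets_markov_borel])
  show "range (cylinder B) \<subseteq> Pow \<Sigma>" by (auto simp: cylinder_def)
  show "lower \<in> space borel \<rightarrow> \<Sigma>" using lower_in by auto
  fix A assume "A \<in> range (cylinder B)"
  then obtain w where A: "A = cylinder B w" by auto
  have "lower y \<in> A \<longleftrightarrow> y \<in> (live \<inter> cyl (map Suc w)) \<union> (if base_point \<in> A then - live else {})" for y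
  proof (cases "y \<in> live")
    case True
    then have "y j \<noteq> 0" for j by (simp add: live_iff)
    then have "y j - 1 = a \<longleftrightarrow> y j = Suc a" for j a by (metis Suc_pred' diff_Suc_1 gr0I)
    then show ?thesis
      using True lower_in[of y] unfolding A cylinder_def cyl_def by (simp add: lower_def)
  next
    case False
    then show ?thesis by (simp add: lower_def)
  qed
  then have "lower -` A \<inter> space borel = (live \<inter> cyl (map Suc w)) \<union> (if base_point \<in> A then - live else {})"
    unfolding vimage_def space_borel Int_UNIV_right by (simp only: Collect_mem_eq)
  also have "\<dots> \<in> sets borel" using live_sets by (simp add: borel_comp sets.Int sets.Un)
  finally show "lower -` A \<inter> space borel \<in> sets borel" .
qed

lemma invariant_probsD:
  assumes "\<mu> \<in> invariant_probs B"
  shows "sets \<mu> = sets (markov_borel B)" "space \<mu> = \<Sigma>" "prob_space \<mu>"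
    "\<And>A. A \<in> sets (markov_borel B) \<Longrightarrow> emeasure \<mu> (shift_map -` A \<inter> \<Sigma>) = emeasure \<mu> A"
    "lift_letters \<in> \<mu> \<rightarrow>\<^sub>M borel"
proof -
  show 1: "sets \<mu> = sets (markov_borel B)" "prob_space \<mu>"
    "\<And>A. A \<in> sets (markov_borel B) \<Longrightarrow> emeasure \<mu> (shift_map -` A \<inter> \<Sigma>) = emeasure \<mu> A"
    using assms by (auto simp: invariant_probs_def borel_probs_def)
  show "space \<mu> = \<Sigma>" using sets_eq_imp_space_eq[OF 1(1)] by simp
  show "lift_letters \<in> \<mu> \<rightarrow>\<^sub>M borel"
    using lift_letters_measurable measurable_cong_sets[OF 1(1) refl] by blast
qed

lemma emeasure_lift_measure:
  assumes "\<mu> \<in> invariant_probs B" "A \<in> sets borel"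
  shows "emeasure (lift_measure \<mu>) A = emeasure \<mu> (lift_letters -` A \<inter> \<Sigma>)"
  unfolding lift_measure_def
  using emeasure_distr[OF invariant_probsD(5)[OF assms(1)] assms(2)] invariant_probsD(2)[OF assms(1)] by simp

lemma lift_measure_live:
  assumes "\<mu> \<in> invariant_probs B"
  shows "AE y in lift_measure \<mu>. y \<in> live"
  unfolding lift_measure_def
proof (subst AE_distr_iff[OF invariant_probsD(5)[OF assms]])
  show "{x \<in> space borel. x \<in> live} \<in> sets borel" using live_sets by simp
  show "AE x in \<mu>. lift_letters x \<in> live"
    using invariant_probsD(2)[OF assms] by (intro AE_I2) (simp add: lift_live)
qed

lemma lift_measure_invariant:
  assumes \<mu>: "\<mu> \<in> invariant_probs B"
  shows "lift_measure \<mu> \<in> S.IM"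
  unfolding invariant_measures_def
proof (intro CollectI conjI)
  show s: "sets (lift_measure \<mu>) = sets borel" by (simp add: lift_measure_def)
  then have [simp]: "space (lift_measure \<mu>) = UNIV" using sets_eq_imp_space_eq[OF s] by simp
  show "prob_space (lift_measure \<mu>)"
    unfolding lift_measure_def by (rule prob_space.prob_space_distr[OF invariant_probsD(3,5)[OF \<mu>]])
  have S: "shift_map \<in> lift_measure \<mu> \<rightarrow>\<^sub>M lift_measure \<mu>"
    by (subst measurable_cong_sets[where M'=borel and N'=borel]) (simp_all add: s)
  show "distr (lift_measure \<mu>) (lift_measure \<mu>) shift_map = lift_measure \<mu>"
  proof (rule measure_eqI)
    fix A assume "A \<in> sets (distr (lift_measure \<mu>) (lift_measure \<mu>) shift_map)"
    then have A: "A \<in> sets borel" by (simp add: s)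
    have v: "shift_map -` A \<in> sets borel" using measurable_sets[OF shift_map_measurable A] by simp
    have l: "lift_letters -` A \<inter> \<Sigma> \<in> sets (markov_borel B)"
      using measurable_sets[OF lift_letters_measurable A] by simp
    have "emeasure (distr (lift_measure \<mu>) (lift_measure \<mu>) shift_map) A = emeasure (lift_measure \<mu>) (shift_map -` A)"
      using A s by (simp add: emeasure_distr[OF S])
    also have "\<dots> = emeasure \<mu> (lift_letters -` (shift_map -` A) \<inter> \<Sigma>)"
      by (rule emeasure_lift_measure[OF \<mu> v])
    also have "lift_letters -` (shift_map -` A) \<inter> \<Sigma> = shift_map -` (lift_letters -` A \<inter> \<Sigma>) \<inter> \<Sigma>"
      by (auto simp: shift_lift) (auto simp: markov_shift_def shift_map_def)
    also have "emeasure \<mu> \<dots> = emeasure \<mu> (lift_letters -` A \<inter> \<Sigma>)"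
      by (rule invariant_probsD(4)[OF \<mu> l])
    also have "\<dots> = emeasure (lift_measure \<mu>) A"
      by (rule emeasure_lift_measure[OF \<mu> A, symmetric])
    finally show "emeasure (distr (lift_measure \<mu>) (lift_measure \<mu>) shift_map) A = emeasure (lift_measure \<mu>) A" .
  qed simp
  show "AE y in lift_measure \<mu>. cemetery_rel B (y 0) (y 1)"
    using lift_measure_live[OF \<mu>] by eventually_elim (auto simp: live_def)
qed

lemma lift_measure_no_cemetery:
  assumes \<mu>: "\<mu> \<in> invariant_probs B"
  shows "measure (lift_measure \<mu>) (cyl [0]) = 0"
proof -
  interpret prob_space "lift_measure \<mu>" by (rule invariant_measuresD(3)[OF lift_measure_invariant[OF \<mu>]])
  have "AE y in lift_measure \<mu>. y \<notin> cyl [0]"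
    using lift_measure_live[OF \<mu>] by eventually_elim (auto simp: live_def cyl_Cons)
  then show ?thesis
    using prob_eq_0[of "cyl [0]"] invariant_measuresD(1)[OF lift_measure_invariant[OF \<mu>]] by simp
qed

lemma lower_lift_measure:
  assumes \<mu>: "\<mu> \<in> invariant_probs B"
  shows "lower_measure (lift_measure \<mu>) = \<mu>"
proof -
  have "lower_measure (lift_measure \<mu>) = distr \<mu> (markov_borel B) (lower \<circ> lift_letters)"
    unfolding lower_measure_def lift_measure_def
    by (rule distr_distr[OF lower_measurable invariant_probsD(5)[OF \<mu>]])
  also have "\<dots> = distr \<mu> \<mu> (\<lambda>x. x)"
    by (rule distr_cong) (use invariant_probsD(1,2)[OF \<mu>] lower_lift in auto)
  also have "\<dots> = \<mu>" by (rule distr_id)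
  finally show ?thesis .
qed

lemma live_AE:
  assumes \<nu>: "\<nu> \<in> S.IM" and c: "measure \<nu> (cyl [0]) = 0"
  shows "AE y in \<nu>. y \<in> live"
proof -
  interpret prob_space \<nu> by (rule invariant_measuresD(3)[OF \<nu>])
  have "AE y in \<nu>. y \<notin> cyl [0]"
    using prob_eq_0[of "cyl [0]"] invariant_measuresD(1)[OF \<nu>] c by simp
  with invariant_measures_AE_path[OF \<nu>] show ?thesis
  proof eventually_elim
    case (elim y)
    have "y n \<noteq> 0" for n using S.path_zero_iff[OF elim(1), of n] elim(2) by (auto simp: cyl_Cons)
    then show ?case using elim(1) by (simp add: live_def)
  qed
qed

lemma lower_measurable':
  assumes "\<nu> \<in> S.IM"
  shows "lower \<in> \<nu> \<rightarrow>\<^sub>M markov_borel B"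
  using lower_measurable measurable_cong_sets[OF invariant_measuresD(1)[OF assms] refl] by blast

text \<open>Such a measure is carried by \<open>live\<close>, where \<open>lower\<close> commutes
  with the shift and is inverted by \<open>lift_letters\<close>; the identities between preimages
  therefore hold up to null sets.\<close>

lemma lower_measure_invariant:
  assumes \<nu>: "\<nu> \<in> S.IM" and c: "measure \<nu> (cyl [0]) = 0"
  shows "lower_measure \<nu> \<in> invariant_probs B" "lift_measure (lower_measure \<nu>) = \<nu>"
proof -
  note s = invariant_measuresD(1,2)[OF \<nu>]
  interpret prob_space \<nu> by (rule invariant_measuresD(3)[OF \<nu>])
  note lm = lower_measurable'[OF \<nu>]
  have em: "emeasure (lower_measure \<nu>) A = emeasure \<nu> (lower -` A)" if "A \<in> sets (markov_borel B)" for A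
    unfolding lower_measure_def using emeasure_distr[OF lm that] s(2) by simp
  have lv: "lower -` A \<in> sets borel" if "A \<in> sets (markov_borel B)" for A
    using measurable_sets[OF lower_measurable that] by simp
  have sh: "(\<lambda>x. shift_map x) \<in> markov_borel B \<rightarrow>\<^sub>M markov_borel B"
  proof (rule measurable_sigma_sets[OF sets_markov_borel])
    show "range (cylinder B) \<subseteq> Pow \<Sigma>" by (auto simp: cylinder_def)
    show "shift_map \<in> space (markov_borel B) \<rightarrow> \<Sigma>" by (auto simp: markov_shift_def shift_map_def)
    fix A assume "A \<in> range (cylinder B)"
    then obtain w where A: "A = cylinder B w" by auto
    have "shift_map -` A \<inter> space (markov_borel B) = (\<Union>a. cylinder B (a # w))"
      unfolding A by (auto simp: cylinder_def shift_map_def markov_shift_def nth_Cons split: nat.splits)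
    also have "\<dots> \<in> sets (markov_borel B)"
      by (intro sets.countable_UN'') (auto intro: openin_sets_markov_borel openin_markov)
    finally show "shift_map -` A \<inter> space (markov_borel B) \<in> sets (markov_borel B)" .
  qed
  show inv: "lower_measure \<nu> \<in> invariant_probs B"
    unfolding invariant_probs_def borel_probs_def
  proof (intro CollectI conjI ballI)
    show "sets (lower_measure \<nu>) = sets (markov_borel B)" by (simp add: lower_measure_def)
    show "prob_space (lower_measure \<nu>)" unfolding lower_measure_def by (rule prob_space_distr[OF lm])
    fix A assume "A \<in> sets (lower_measure \<nu>)"
    then have A: "A \<in> sets (markov_borel B)" by (simp add: lower_measure_def)
    have SA: "shift_map -` A \<inter> \<Sigma> \<in> sets (markov_borel B)" using measurable_sets[OF sh A] by simp
    have "emeasure \<nu> (lower -` (shift_map -` A \<inter> \<Sigma>)) = emeasure \<nu> (shift_map -` (lower -` A))"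
    proof (rule emeasure_eq_AE)
      show "AE y in \<nu>. y \<in> lower -` (shift_map -` A \<inter> \<Sigma>) \<longleftrightarrow> y \<in> shift_map -` (lower -` A)"
        using live_AE[OF \<nu> c] by eventually_elim (simp add: shift_lower lower_in)
      show "shift_map -` (lower -` A) \<in> events"
        using measurable_sets[OF shift_map_measurable lv[OF A]] s(1) by simp
    qed (use lv[OF SA] s(1) in simp)
    also have "\<dots> = emeasure \<nu> (lower -` A)"
      using invariant_measure_vimage[OF \<nu> lv[OF A]] by (simp add: emeasure_eq_measure)
    finally show "emeasure (lower_measure \<nu>) (shift_map -` A \<inter> \<Sigma>) = emeasure (lower_measure \<nu>) A"
      by (simp add: em A SA)
  qed
  have "lift_measure (lower_measure \<nu>) = distr \<nu> borel (lift_letters \<circ> lower)"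
    unfolding lower_measure_def lift_measure_def by (rule distr_distr[OF lift_letters_measurable lm])
  also have "\<dots> = distr \<nu> \<nu> (\<lambda>x. x)"
  proof (rule measure_eqI)
    fix A assume "A \<in> sets (distr \<nu> borel (lift_letters \<circ> lower))"
    then have A: "A \<in> sets borel" by simp
    have m: "lift_letters \<circ> lower \<in> \<nu> \<rightarrow>\<^sub>M borel" by (rule measurable_comp[OF lm lift_letters_measurable])
    have "emeasure \<nu> ((lift_letters \<circ> lower) -` A \<inter> space \<nu>) = emeasure \<nu> A"
    proof (rule emeasure_eq_AE)
      show "AE y in \<nu>. y \<in> (lift_letters \<circ> lower) -` A \<inter> space \<nu> \<longleftrightarrow> y \<in> A"
        using live_AE[OF \<nu> c] by eventually_elim (simp add: lift_lower s)
      show "(lift_letters \<circ> lower) -` A \<inter> space \<nu> \<in> events" by (rule measurable_sets[OF m A])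
      show "A \<in> events" using A s(1) by simp
    qed
    then show "emeasure (distr \<nu> borel (lift_letters \<circ> lower)) A = emeasure (distr \<nu> \<nu> (\<lambda>x. x)) A"
      unfolding emeasure_distr[OF m A] distr_id .
  qed (simp add: s)
  also have "\<dots> = \<nu>" by (rule distr_id)
  finally show "lift_measure (lower_measure \<nu>) = \<nu>" .
qed

section \<open>The affine homeomorphism onto the simplex with the cone at the vertex removed\<close>

definition chart :: "(nat \<Rightarrow> nat) measure \<Rightarrow> bounded_seq" where
  "chart \<mu> = emb (lift_measure \<mu>)"

definition finite_part :: "bounded_seq set" where
  "finite_part = emb ` {\<nu> \<in> S.IM. measure \<nu> (cyl [0]) = 0}"

lemma chart_image: "chart ` invariant_probs B = finite_part"
proof (intro equalityI subsetI)
  fix y assume "y \<in> chart ` invariant_probs B"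
  then show "y \<in> finite_part"
    using lift_measure_invariant lift_measure_no_cemetery by (auto simp: chart_def finite_part_def)
next
  fix y assume "y \<in> finite_part"
  then obtain \<nu> where \<nu>: "\<nu> \<in> S.IM" "measure \<nu> (cyl [0]) = 0" "y = emb \<nu>" by (auto simp: finite_part_def)
  have "y = chart (lower_measure \<nu>)" using lower_measure_invariant(2)[OF \<nu>(1,2)] \<nu>(3) by (simp add: chart_def)
  then show "y \<in> chart ` invariant_probs B" using lower_measure_invariant(1)[OF \<nu>(1,2)] by blast
qed

lemma lower_meas_chart:
  assumes "\<mu> \<in> invariant_probs B"
  shows "lower_measure (S.meas (chart \<mu>)) = \<mu>"
  using lift_measure_invariant[OF assms] lower_lift_measure[OF assms] by (simp add: chart_def)

lemma coord_emb_zero: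
  assumes "\<nu> \<in> S.IM" "emb \<nu> = l *\<^sub>R emb \<alpha>" "\<alpha> \<in> S.IM"
  shows "coord \<nu> w = l * coord \<alpha> w"
proof -
  have "apply_bcontfun (emb \<nu>) (to_nat w) = l * apply_bcontfun (emb \<alpha>) (to_nat w)"
    using assms(2) by (simp add: scaleR_bcontfun.rep_eq)
  then have "(1/2) ^ to_nat w * coord \<nu> w = (1/2) ^ to_nat w * (l * coord \<alpha> w)"
    using S.apply_emb[OF assms(1), of "to_nat w"] S.apply_emb[OF assms(3), of "to_nat w"] by simp
  then show ?thesis by simp
qed

text \<open>With the vertex at the origin the removed points are the multiples
  \<open>l *\<^sub>R x\<close> with \<open>l < 1\<close>. The mass off the cemetery is a sum of
  coordinates of \<open>coord\<close> and scales with \<open>l\<close>, so it cannot be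
  \<open>1\<close> there. Conversely, if the cemetery has mass \<open>c > 0\<close>, conditioning on
  its complement exhibits the point as \<open>1 - c\<close> times a point of
  \<open>K\<close>.\<close>

lemma finite_part_eq:
  "finite_part = S.K - {l *\<^sub>R x + (1 - l) *\<^sub>R 0 | x l. x \<in> S.K \<and> 0 \<le> l \<and> l < 1}"
proof (intro equalityI subsetI)
  fix y assume "y \<in> finite_part"
  then obtain \<nu> where \<nu>: "\<nu> \<in> S.IM" "measure \<nu> (cyl [0]) = 0" "y = emb \<nu>" by (auto simp: finite_part_def)
  have "\<not> (\<exists>x l. y = l *\<^sub>R x + (1 - l) *\<^sub>R 0 \<and> x \<in> S.K \<and> 0 \<le> l \<and> l < 1)"
  proof
    assume "\<exists>x l. y = l *\<^sub>R x + (1 - l) *\<^sub>R 0 \<and> x \<in> S.K \<and> 0 \<le> l \<and> l < 1"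
    then obtain \<alpha> l where \<alpha>: "\<alpha> \<in> S.IM" "emb \<nu> = l *\<^sub>R emb \<alpha>" and l: "0 \<le> l" "l < 1" using \<nu>(3) by auto
    have c: "measure \<nu> (cyl [Suc a]) = l * measure \<alpha> (cyl [Suc a])" for a
      using coord_emb_zero[OF \<nu>(1) \<alpha>(2,1), of "[Suc a]"] by (simp add: coord_def)
    have "(\<lambda>a. measure \<nu> (cyl [Suc a])) sums (l * (1 - measure \<alpha> (cyl [0])))"
      unfolding c by (rule sums_mult[OF S.measure_letters_sums[OF \<alpha>(1)]])
    then have "l * (1 - measure \<alpha> (cyl [0])) = 1"
      using S.measure_letters_sums[OF \<nu>(1)] \<nu>(2) sums_unique2 by fastforce
    moreover have "l * (1 - measure \<alpha> (cyl [0])) \<le> l"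
      using l by (intro mult_left_le) auto
    ultimately show False using l by simp
  qed
  then show "y \<in> S.K - {l *\<^sub>R x + (1 - l) *\<^sub>R 0 | x l. x \<in> S.K \<and> 0 \<le> l \<and> l < 1}"
    using \<nu> by blast
next
  fix y assume y: "y \<in> S.K - {l *\<^sub>R x + (1 - l) *\<^sub>R 0 | x l. x \<in> S.K \<and> 0 \<le> l \<and> l < 1}"
  then obtain \<nu> where \<nu>: "\<nu> \<in> S.IM" "y = emb \<nu>" by auto
  interpret prob_space \<nu> by (rule invariant_measuresD(3)[OF \<nu>(1)])
  note s = invariant_measuresD(1,2)[OF \<nu>(1)]
  let ?c = "prob (cyl [0])"
  have "?c = 0"
  proof (rule ccontr)
    assume "?c \<noteq> 0"
    then have pos: "?c > 0" using measure_nonneg[of \<nu> "cyl [0]"] by linarith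
    define A where "A = - cyl [0]"
    have A: "A \<in> sets borel" unfolding A_def by (intro borel_comp cyl_sets)
    have pA: "prob A = 1 - ?c"
      using prob_compl[of "cyl [0]"] s by (simp add: A_def Compl_eq_Diff_UNIV)
    have sub: "cyl w \<subseteq> A" if "w \<noteq> []" "hd w \<noteq> 0" for w
      using that by (cases w) (auto simp: A_def cyl_Cons)
    obtain \<alpha> where \<alpha>: "\<alpha> \<in> S.IM" "\<And>w. coord \<nu> w = (1 - ?c) * coord \<alpha> w"
    proof (cases "prob A > 0")
      case True
      have "AE x in \<nu>. shift_map x \<in> A \<longleftrightarrow> x \<in> A"
        using invariant_measures_AE_path[OF \<nu>(1)]
      proof eventually_elim
        case (elim x)
        then show ?case using S.path_zero_iff[OF elim, of "Suc 0"] by (simp add: A_def cyl_Cons shift_map_def)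
      qed
      then have u: "uniform_measure \<nu> A \<in> S.IM" by (rule uniform_measure_invariant[OF \<nu>(1) A True])
      have "coord \<nu> w = (1 - ?c) * coord (uniform_measure \<nu> A) w" for w
        using sub[of w] measure_pos_emeasure[OF True] True pA s
        by (auto simp: coord_def Int_absorb1)
      then show ?thesis using u that by blast
    next
      \<comment> \<open>All the mass sits on the cemetery: the factor \<open>1 - ?c\<close> is
        \<open>0\<close>, and any measure in \<open>S.IM\<close> can serve as
        \<open>\<alpha>\<close>.\<close>
      case False
      then have "prob A = 0" using measure_nonneg[of \<nu> A] by linarith
      have "coord \<nu> w = 0" for w
      proof (cases "w = [] \<or> hd w = 0")
        case False
        then have "prob (cyl w) \<le> prob A" using sub[of w] A s by (intro finite_measure_mono) auto
        then show ?thesis using \<open>prob A = 0\<close> measure_nonneg[of \<nu> "cyl w"] by (simp add: coord_def)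
      qed (auto simp: coord_def)
      moreover have "1 - ?c = 0" using pA \<open>prob A = 0\<close> by simp
      ultimately show ?thesis using \<nu>(1) that[of \<nu>] by simp
    qed
    have "emb \<nu> = (1 - ?c) *\<^sub>R emb \<alpha>"
    proof (rule bcontfun_eqI)
      fix k
      show "apply_bcontfun (emb \<nu>) k = apply_bcontfun ((1 - ?c) *\<^sub>R emb \<alpha>) k"
        unfolding scaleR_bcontfun.rep_eq S.apply_emb[OF \<nu>(1)] S.apply_emb[OF \<alpha>(1)] \<alpha>(2) by simp
    qed
    then have "y = (1 - ?c) *\<^sub>R emb \<alpha> + (1 - (1 - ?c)) *\<^sub>R 0" using \<nu>(2) by simp
    moreover have "0 \<le> 1 - ?c" "1 - ?c < 1" using pos by auto
    ultimately show False using y \<alpha>(1) by blast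
  qed
  then show "y \<in> finite_part" using \<nu> by (auto simp: finite_part_def)
qed

text \<open>The origin is the image of the point mass at \<open>000...\<close>, which is a periodic
  orbit measure and therefore extreme.\<close>

lemma zero_extreme: "(0 :: bounded_seq) extreme_point_of S.K"
proof -
  have z: "S.periodic (\<lambda>_. 0) 1" using S.R_zero_left by (simp add: S.periodic_def)
  have "coord (orbit_measure (\<lambda>_. 0) 1) w = 0" for w
    using S.measure_orbit_cyl[OF z, of w] by (cases w) (auto simp: coord_def occ_def cyl_Cons)
  then have "emb (orbit_measure (\<lambda>_. 0) 1) = 0"
    using S.apply_emb[OF S.orbit_measure_invariant[OF z]] by (intro bcontfun_eqI) simp
  then show ?thesis using S.orbit_measure_extreme[OF z] by simp
qed

lemma topspace_invariant_probs: "topspace (invariant_probs_topology B) = invariant_probs B"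
proof -
  let ?X = "markov_topology B"
  let ?G = "{{\<mu> \<in> borel_probs ?X. (\<integral>x. f x \<partial>\<mu>) \<in> U} | f U.
       continuous_map ?X euclideanreal f \<and> bounded (f ` topspace ?X) \<and> open U}"
  \<comment> \<open>The zero function with \<open>U = UNIV\<close> gives a generating open set that
    contains every probability measure.\<close>
  have "borel_probs ?X \<in> ?G"
    by (intro CollectI exI[of _ "\<lambda>_. 0"] exI[of _ UNIV]) (auto simp: bounded_iff)
  then have "borel_probs ?X \<subseteq> topspace (weak_star_topology ?X)"
    unfolding weak_star_topology_def topology_generated_by_topspace by blast
  then show ?thesis
    by (auto simp: invariant_probs_topology_def invariant_probs_def)
qed

lemma continuous_map_integral:
  assumes "continuous_map (markov_topology B) euclideanreal f" "bounded (f ` \<Sigma>)"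
  shows "continuous_map (invariant_probs_topology B) euclideanreal (\<lambda>\<mu>. \<integral>x. f x \<partial>\<mu>)"
  unfolding continuous_map_def
proof (intro conjI allI impI)
  fix U :: "real set" assume "openin euclideanreal U"
  then have U: "open U" by simp
  have "openin (weak_star_topology (markov_topology B)) {\<mu> \<in> borel_probs (markov_topology B). (\<integral>x. f x \<partial>\<mu>) \<in> U}"
    unfolding weak_star_topology_def
    by (intro topology_generated_by_Basis CollectI exI[of _ f] exI[of _ U])
       (use assms U in \<open>simp add: topspace_markov_topology\<close>)
  then have "openin (invariant_probs_topology B) ({\<mu> \<in> borel_probs (markov_topology B). (\<integral>x. f x \<partial>\<mu>) \<in> U} \<inter> invariant_probs B)"
    unfolding invariant_probs_topology_def by (rule openin_subtopology_Int)
  moreover have "{\<mu> \<in> borel_probs (markov_topology B). (\<integral>x. f x \<partial>\<mu>) \<in> U} \<inter> invariant_probs B =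
    {\<mu> \<in> topspace (invariant_probs_topology B). (\<integral>x. f x \<partial>\<mu>) \<in> U}"
    by (auto simp: topspace_invariant_probs invariant_probs_def)
  ultimately show "openin (invariant_probs_topology B) {\<mu> \<in> topspace (invariant_probs_topology B). (\<integral>x. f x \<partial>\<mu>) \<in> U}"
    by simp
qed simp

text \<open>Cylinders are open and closed: a point outside of one has the whole cylinder of its
  first \<open>length w\<close> letters outside.\<close>

lemma continuous_map_cylinder:
  "continuous_map (markov_topology B) euclideanreal (indicator (cylinder B w))"
  unfolding continuous_map_def
proof (intro conjI allI impI)
  fix U :: "real set"
  have compl: "openin (markov_topology B) (\<Sigma> - cylinder B w)"
  proof -
    have "\<Sigma> - cylinder B w = \<Union> {cylinder B u | u. cylinder B u \<subseteq> \<Sigma> - cylinder B w}"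
    proof (intro equalityI subsetI)
      fix x assume x: "x \<in> \<Sigma> - cylinder B w"
      then have "cylinder B (map x [0..<length w]) \<subseteq> \<Sigma> - cylinder B w"
        by (auto simp: cylinder_def)
      moreover have "x \<in> cylinder B (map x [0..<length w])" using x by (simp add: cylinder_def)
      ultimately show "x \<in> \<Union> {cylinder B u | u. cylinder B u \<subseteq> \<Sigma> - cylinder B w}" by blast
    qed blast
    also have "openin (markov_topology B) \<dots>"
      by (rule openin_Union) (auto intro: openin_markov)
    finally show ?thesis .
  qed
  have "{x \<in> topspace (markov_topology B). indicator (cylinder B w) x \<in> U} =
    (if 1 \<in> U then cylinder B w else {}) \<union> (if 0 \<in> U then \<Sigma> - cylinder B w else {})"
    by (auto simp: topspace_markov_topology indicator_def cylinder_def split: if_splits)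
  also have "openin (markov_topology B) \<dots>"
    using compl openin_markov by (intro openin_Un) auto
  finally show "openin (markov_topology B) {x \<in> topspace (markov_topology B). indicator (cylinder B w) x \<in> U}" .
qed simp

text \<open>Writes each coordinate as zero or as the integral of a bounded continuous function on
  the shift, which is what the weak* topology controls.\<close>

lemma coord_lift_measure:
  assumes \<mu>: "\<mu> \<in> invariant_probs B"
  shows "coord (lift_measure \<mu>) w = (if w = [] \<or> 0 \<in> set w then 0 else \<integral>x. indicator (cylinder B (map (\<lambda>a. a - 1) w)) x \<partial>\<mu>)"
proof (cases "w = [] \<or> 0 \<in> set w")
  case True
  then show ?thesis
    using S.coord_zero_in[OF lift_measure_invariant[OF \<mu>], of w] by (auto simp: coord_def)
next
  case False
  have "w ! j \<noteq> 0" if "j < length w" for j using False that nth_mem by metis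
  then have "Suc (x j) = w ! j \<longleftrightarrow> x j = w ! j - 1" if "j < length w" for x :: "nat \<Rightarrow> nat" and j
    using that by (metis Suc_pred' bot_nat_0.not_eq_extremum diff_Suc_1)
  then have v: "lift_letters -` cyl w \<inter> \<Sigma> = cylinder B (map (\<lambda>a. a - 1) w)"
    by (auto simp: cyl_def lift_letters_def cylinder_def)
  have sub: "cylinder B u \<subseteq> \<Sigma>" for u by (auto simp: cylinder_def)
  have "hd w \<noteq> 0" using False by (metis hd_in_set)
  then have "coord (lift_measure \<mu>) w = measure (lift_measure \<mu>) (cyl w)" using False by (simp add: coord_def)
  also have "\<dots> = measure \<mu> (cylinder B (map (\<lambda>a. a - 1) w))"
    using emeasure_lift_measure[OF \<mu> cyl_sets, of w] by (simp add: measure_def v)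
  also have "\<dots> = (\<integral>x. indicator (cylinder B (map (\<lambda>a. a - 1) w)) x \<partial>\<mu>)"
    using sub invariant_probsD(2)[OF \<mu>] by (simp add: Int_absorb2)
  finally show ?thesis using False by simp
qed

text \<open>Convergence is taken along the neighbourhood filter, since sequences would presuppose
  that the weak* topology is first countable. In the other direction sequences suffice, as
  \<open>finite_part\<close> lies in a normed space.\<close>

lemma continuous_map_chart:
  "continuous_map (invariant_probs_topology B) (top_of_set finite_part) chart"
  unfolding continuous_map_in_subtopology
proof
  let ?X = "invariant_probs_topology B"
  show "chart \<in> topspace ?X \<rightarrow> finite_part" using chart_image by (auto simp: topspace_invariant_probs)
  show "continuous_map ?X euclidean chart"
    unfolding continuous_map_atin limitin_canonical_iff
  proof
    fix \<mu> assume "\<mu> \<in> topspace ?X"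
    then have \<mu>: "\<mu> \<in> invariant_probs B" by (simp add: topspace_invariant_probs)
    have ev: "\<forall>\<^sub>F \<nu> in atin ?X \<mu>. \<nu> \<in> invariant_probs B"
      unfolding eventually_atin using \<mu> openin_topspace[of ?X] by (auto simp: topspace_invariant_probs)
    \<comment> \<open>\<open>tendsto_weigh\<close> asks for values in \<open>unit_box\<close> at
      every argument, so \<open>p\<close> is made constant off the invariant measures, which are
      eventually the only arguments.\<close>
    define p where "p \<nu> = (if \<nu> \<in> invariant_probs B then coord (lift_measure \<nu>) else coord (lift_measure \<mu>))" for \<nu>
    have box: "coord (lift_measure \<nu>) \<in> unit_box" if "\<nu> \<in> invariant_probs B" for \<nu>
      by (rule S.emb_box[OF lift_measure_invariant[OF that]])
    have "((\<lambda>\<nu>. p \<nu> w) \<longlongrightarrow> coord (lift_measure \<mu>) w) (atin ?X \<mu>)" for w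
    proof (cases "w = [] \<or> 0 \<in> set w")
      case True
      have "p \<nu> w = coord (lift_measure \<mu>) w" for \<nu>
        using True coord_lift_measure[of \<nu> w] coord_lift_measure[OF \<mu>, of w] by (simp add: p_def)
      then show ?thesis by simp
    next
      case False
      let ?f = "indicator (cylinder B (map (\<lambda>a. a - 1) w)) :: _ \<Rightarrow> real"
      have "bounded (?f ` \<Sigma>)" by (auto simp: bounded_iff indicator_def intro!: exI[of _ 1])
      then have "((\<lambda>\<nu>. \<integral>x. ?f x \<partial>\<nu>) \<longlongrightarrow> (\<integral>x. ?f x \<partial>\<mu>)) (atin ?X \<mu>)"
        using continuous_map_integral[OF continuous_map_cylinder] \<mu>
        unfolding continuous_map_atin limitin_canonical_iff by (simp add: topspace_invariant_probs)
      then have "((\<lambda>\<nu>. \<integral>x. ?f x \<partial>\<nu>) \<longlongrightarrow> coord (lift_measure \<mu>) w) (atin ?X \<mu>)"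
        using coord_lift_measure[OF \<mu>, of w] False by simp
      then show ?thesis
      proof (rule Lim_transform_eventually)
        show "\<forall>\<^sub>F \<nu> in atin ?X \<mu>. (\<integral>x. ?f x \<partial>\<nu>) = p \<nu> w"
          using ev by eventually_elim (use coord_lift_measure False in \<open>simp add: p_def\<close>)
      qed
    qed
    then have "((\<lambda>\<nu>. weigh (p \<nu>)) \<longlongrightarrow> weigh (coord (lift_measure \<mu>))) (atin ?X \<mu>)"
      using box \<mu> by (intro tendsto_weigh) (auto simp: p_def)
    moreover have "\<forall>\<^sub>F \<nu> in atin ?X \<mu>. weigh (p \<nu>) = chart \<nu>"
      using ev by eventually_elim (simp add: p_def chart_def emb_def)
    ultimately show "(chart \<longlongrightarrow> chart \<mu>) (atin ?X \<mu>)"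
      unfolding chart_def[of \<mu>] emb_def[of "lift_measure \<mu>"] by (rule Lim_transform_eventually)
  qed
qed

lemma finite_part_meas:
  assumes "y \<in> finite_part"
  shows "S.meas y \<in> S.IM" "measure (S.meas y) (cyl [0]) = 0" "emb (S.meas y) = y"
  using assms by (auto simp: finite_part_def)

text \<open>Convergence in \<open>K\<close> says nothing about cylinders starting with
  \<open>0\<close>, but on \<open>finite_part\<close> these are null and the total mass is
  \<open>1\<close>. So all cylinder values converge and \<open>portmanteau_cyl\<close> applies, with
  \<open>A\<close> the set \<open>live\<close>, on which \<open>lower\<close> is continuous.\<close>

lemma integral_lower_continuous:
  assumes f: "continuous_map (markov_topology B) euclideanreal f" and bd: "bounded (f ` \<Sigma>)"
  shows "continuous_on finite_part (\<lambda>y. \<integral>x. f x \<partial>lower_measure (S.meas y))"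
  unfolding continuous_on_sequentially o_def
proof (intro ballI allI impI)
  fix ys y assume y: "y \<in> finite_part" and "(\<forall>n. ys n \<in> finite_part) \<and> ys \<longlonglongrightarrow> y"
  then have ys: "\<And>n. ys n \<in> finite_part" "ys \<longlonglongrightarrow> y" by auto
  obtain C where C: "\<And>x. x \<in> \<Sigma> \<Longrightarrow> \<bar>f x\<bar> \<le> C" using bd by (auto simp: bounded_iff)
  have fm: "f \<in> borel_measurable (markov_borel B)"
  proof (rule borel_measurableI)
    fix U :: "real set" assume "open U"
    then have "openin (markov_topology B) {x \<in> topspace (markov_topology B). f x \<in> U}"
      using f by (simp add: continuous_map_def)
    moreover have "{x \<in> topspace (markov_topology B). f x \<in> U} = f -` U \<inter> space (markov_borel B)"
      by (auto simp: topspace_markov_topology)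
    ultimately show "f -` U \<inter> space (markov_borel B) \<in> sets (markov_borel B)"
      using openin_sets_markov_borel by metis
  qed
  define F where "F x = f (lower x)" for x
  have F: "F \<in> borel_measurable borel"
    unfolding F_def[abs_def] by (rule measurable_compose[OF lower_measurable fm])
  have FC: "\<bar>F x\<bar> \<le> C" for x unfolding F_def by (rule C[OF lower_in])
  have int: "(\<integral>x. f x \<partial>lower_measure (S.meas z)) = (\<integral>x. F x \<partial>S.meas z)" if "z \<in> finite_part" for z
    unfolding lower_measure_def F_def by (rule integral_distr[OF lower_measurable'[OF finite_part_meas(1)[OF that]] fm])
  have lim: "(\<lambda>n. measure (S.meas (ys n)) (cyl u)) \<longlonglongrightarrow> measure (S.meas y) (cyl u)" for u
  proof -
    have c: "(\<lambda>n. coord (S.meas (ys n)) u) \<longlonglongrightarrow> coord (S.meas y) u"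
    proof (rule tendsto_weighD)
      show "(\<lambda>n. weigh (coord (S.meas (ys n)))) \<longlonglongrightarrow> weigh (coord (S.meas y))"
        using ys finite_part_meas(3)[OF y] finite_part_meas(3)[OF ys(1)] by (simp add: emb_def)
    qed (intro S.emb_box finite_part_meas y ys)+
    have m: "measure (S.meas z) (cyl u) = (if u = [] then 1 else if hd u = 0 then 0 else coord (S.meas z) u)"
      if z: "z \<in> finite_part" for z
    proof -
      interpret prob_space "S.meas z" by (rule invariant_measuresD(3)[OF finite_part_meas(1)[OF z]])
      have "prob (cyl u) \<le> prob (cyl [0])" if "u \<noteq> []" "hd u = 0"
        using that invariant_measuresD(1)[OF finite_part_meas(1)[OF z]]
        by (intro finite_measure_mono) (cases u; auto simp: cyl_Cons)+
      then show ?thesis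
        using finite_part_meas(2)[OF z] prob_space invariant_measuresD(2)[OF finite_part_meas(1)[OF z]]
          measure_nonneg[of "S.meas z" "cyl u"] by (auto simp: coord_def)
    qed
    show ?thesis using c by (simp add: m[OF y] m[OF ys(1)])
  qed
  have "(\<lambda>n. \<integral>x. F x \<partial>S.meas (ys n)) \<longlonglongrightarrow> (\<integral>x. F x \<partial>S.meas y)"
  proof (rule portmanteau_cyl[where A=live])
    show "prob_space (S.meas (ys n))" "sets (S.meas (ys n)) = sets borel" for n
      using invariant_measuresD[OF finite_part_meas(1)[OF ys(1)]] by auto
    show "prob_space (S.meas y)" "sets (S.meas y) = sets borel"
      using invariant_measuresD[OF finite_part_meas(1)[OF y]] by auto
    show "AE x in S.meas (ys n). x \<in> live" for n by (rule live_AE[OF finite_part_meas(1,2)[OF ys(1)]])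
    show "AE x in S.meas y. x \<in> live" by (rule live_AE[OF finite_part_meas(1,2)[OF y]])
    fix x :: "nat \<Rightarrow> nat" and e :: real assume x: "x \<in> live" and e: "e > 0"
    let ?U = "{z \<in> topspace (markov_topology B). f z \<in> ball (f (lower x)) e}"
    have "openin (markov_topology B) ?U" by (rule openin_continuous_map_preimage[OF f]) simp
    moreover have "lower x \<in> ?U" using lower_in e by (simp add: topspace_markov_topology)
    ultimately obtain m where m: "cylinder B (map (lower x) [0..<m]) \<subseteq> ?U" using openin_markov_cylinder by blast
    have "\<bar>F z - F x\<bar> \<le> e" if z: "z \<in> live \<inter> cyl (map x [0..<m])" for z
    proof -
      have "lower z \<in> cylinder B (map (lower x) [0..<m])"
        using z x lower_in[of z] by (auto simp: cylinder_def lower_def cyl_def)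
      then have "dist (f (lower x)) (f (lower z)) < e" using m by auto
      then show ?thesis by (simp add: F_def dist_real_def abs_minus_commute)
    qed
    then show "\<exists>m. \<forall>z\<in>live \<inter> cyl (map x [0..<m]). \<bar>F z - F x\<bar> \<le> e" by blast
  qed (rule F FC lim)+
  then show "(\<lambda>n. \<integral>x. f x \<partial>lower_measure (S.meas (ys n))) \<longlonglongrightarrow> (\<integral>x. f x \<partial>lower_measure (S.meas y))"
    using int[OF y] int[OF ys(1)] by simp
qed

lemma continuous_map_chart_inverse:
  "continuous_map (top_of_set finite_part) (invariant_probs_topology B) (\<lambda>y. lower_measure (S.meas y))"
  unfolding invariant_probs_topology_def continuous_map_in_subtopology
proof
  let ?g = "\<lambda>y. lower_measure (S.meas y)"
  let ?X = "markov_topology B"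
  have inv: "?g y \<in> invariant_probs B" if "y \<in> finite_part" for y
    by (rule lower_measure_invariant(1)[OF finite_part_meas(1,2)[OF that]])
  then show "?g \<in> topspace (top_of_set finite_part) \<rightarrow> invariant_probs B" by auto
  have bp: "?g y \<in> borel_probs ?X" if "y \<in> finite_part" for y
    using inv[OF that] by (simp add: invariant_probs_def)
  show "continuous_map (top_of_set finite_part) (weak_star_topology ?X) ?g"
    unfolding weak_star_topology_def
  proof (rule continuous_on_generated_topo)
    show "?g ` topspace (top_of_set finite_part) \<subseteq> \<Union> {{\<mu> \<in> borel_probs ?X. (\<integral>x. f x \<partial>\<mu>) \<in> U} | f U.
       continuous_map ?X euclideanreal f \<and> bounded (f ` topspace ?X) \<and> open U}"
    proof -
      have "borel_probs ?X \<in> {{\<mu> \<in> borel_probs ?X. (\<integral>x. f x \<partial>\<mu>) \<in> U} | f U.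
         continuous_map ?X euclideanreal f \<and> bounded (f ` topspace ?X) \<and> open U}"
        by (intro CollectI exI[of _ "\<lambda>_. 0"] exI[of _ UNIV]) (auto simp: bounded_iff)
      then show ?thesis using bp by auto
    qed
    fix V assume "V \<in> {{\<mu> \<in> borel_probs ?X. (\<integral>x. f x \<partial>\<mu>) \<in> U} | f U.
       continuous_map ?X euclideanreal f \<and> bounded (f ` topspace ?X) \<and> open U}"
    then obtain f U where V: "V = {\<mu> \<in> borel_probs ?X. (\<integral>x. f x \<partial>\<mu>) \<in> U}"
      and f: "continuous_map ?X euclideanreal f" "bounded (f ` \<Sigma>)" and U: "open U"
      by (auto simp: topspace_markov_topology)
    have "?g -` V \<inter> topspace (top_of_set finite_part) = finite_part \<inter> (\<lambda>y. \<integral>x. f x \<partial>?g y) -` U"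
      using bp by (auto simp: V)
    moreover have "openin (top_of_set finite_part) \<dots>"
      by (rule continuous_openin_preimage_gen[OF integral_lower_continuous[OF f] U])
    ultimately show "openin (top_of_set finite_part) (?g -` V \<inter> topspace (top_of_set finite_part))" by simp
  qed
qed

lemma homeomorphic_map_chart:
  "homeomorphic_map (invariant_probs_topology B) (top_of_set finite_part) chart"
  unfolding homeomorphic_map_maps homeomorphic_maps_def
proof (intro exI[of _ "\<lambda>y. lower_measure (S.meas y)"] conjI ballI)
  show "continuous_map (invariant_probs_topology B) (top_of_set finite_part) chart" by (rule continuous_map_chart)
  show "continuous_map (top_of_set finite_part) (invariant_probs_topology B) (\<lambda>y. lower_measure (S.meas y))"
    by (rule continuous_map_chart_inverse)
  show "lower_measure (S.meas (chart \<mu>)) = \<mu>" if "\<mu> \<in> topspace (invariant_probs_topology B)" for \<mu>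
    using that by (intro lower_meas_chart) (simp add: topspace_invariant_probs)
  show "chart (lower_measure (S.meas y)) = y" if "y \<in> topspace (top_of_set finite_part)" for y
    using that lower_measure_invariant(2)[OF finite_part_meas(1,2)[of y]] finite_part_meas(3)[of y]
    by (simp add: chart_def)
qed

lemma affine_chart: "affine_on_measures (invariant_probs B) chart"
  unfolding affine_on_measures_def
proof (intro ballI)
  fix \<mu> \<nu> and t :: real assume \<mu>: "\<mu> \<in> invariant_probs B" and \<nu>: "\<nu> \<in> invariant_probs B" and t: "t \<in> {0..1}"
  note m = invariant_probsD(1,2)[OF \<mu>] and n = invariant_probsD(1,2)[OF \<nu>]
  have sm: "sets (mix t \<mu> \<nu>) = sets (markov_borel B)"
    using m sets.space_closed[of \<mu>] sets.sigma_sets_eq[of \<mu>] by (simp add: mix_def)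
  have spm: "space (mix t \<mu> \<nu>) = \<Sigma>" using sets_eq_imp_space_eq[OF sm] by simp
  have meas: "lift_letters \<in> mix t \<mu> \<nu> \<rightarrow>\<^sub>M borel"
    using lift_letters_measurable measurable_cong_sets[OF sm refl] by blast
  have "lift_measure (mix t \<mu> \<nu>) = mix t (lift_measure \<mu>) (lift_measure \<nu>)"
  proof (rule measure_eqI)
    show "sets (lift_measure (mix t \<mu> \<nu>)) = sets (mix t (lift_measure \<mu>) (lift_measure \<nu>))"
      using S.mix_invariant(1)[OF lift_measure_invariant[OF \<mu>] lift_measure_invariant[OF \<nu>], of t] t
      by (simp add: lift_measure_def invariant_measuresD(1))
    fix A assume "A \<in> sets (lift_measure (mix t \<mu> \<nu>))"
    then have A: "A \<in> sets borel" by (simp add: lift_measure_def)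
    have l: "lift_letters -` A \<inter> \<Sigma> \<in> sets \<mu>"
      using measurable_sets[OF lift_letters_measurable A] m by simp
    have "emeasure (lift_measure (mix t \<mu> \<nu>)) A = emeasure (mix t \<mu> \<nu>) (lift_letters -` A \<inter> \<Sigma>)"
      unfolding lift_measure_def using emeasure_distr[OF meas A] spm by simp
    also have "\<dots> = ennreal t * emeasure \<mu> (lift_letters -` A \<inter> \<Sigma>) + ennreal (1 - t) * emeasure \<nu> (lift_letters -` A \<inter> \<Sigma>)"
      using m n l by (intro emeasure_mix) auto
    also have "\<dots> = ennreal t * emeasure (lift_measure \<mu>) A + ennreal (1 - t) * emeasure (lift_measure \<nu>) A"
      using emeasure_lift_measure[OF \<mu> A] emeasure_lift_measure[OF \<nu> A] by simp
    also have "\<dots> = emeasure (mix t (lift_measure \<mu>) (lift_measure \<nu>)) A"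
      using A by (intro emeasure_mix[symmetric]) (simp_all add: lift_measure_def)
    finally show "emeasure (lift_measure (mix t \<mu> \<nu>)) A = emeasure (mix t (lift_measure \<mu>) (lift_measure \<nu>)) A" .
  qed
  then show "chart (mix t \<mu> \<nu>) = t *\<^sub>R chart \<mu> + (1 - t) *\<^sub>R chart \<nu>"
    using S.emb_mix[OF lift_measure_invariant[OF \<mu>] lift_measure_invariant[OF \<nu>], of t] t by (simp add: chart_def)
qed

lemma markov_poulsen:
  "\<exists>(K :: bounded_seq set) v h.
    poulsen_simplex K \<and> v extreme_point_of K \<and>
    homeomorphic_map (invariant_probs_topology B)
      (top_of_set (K - {l *\<^sub>R x + (1 - l) *\<^sub>R v | x l. x \<in> K \<and> 0 \<le> l \<and> l < 1})) h \<and>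
    affine_on_measures (invariant_probs B) h"
  using S.poulsen zero_extreme homeomorphic_map_chart[unfolded finite_part_eq] affine_chart
  by (intro exI[of _ S.K] exI[of _ 0] exI[of _ chart] conjI)

end

theorem corollary1p3:
  fixes B :: "nat \<Rightarrow> nat \<Rightarrow> bool"
  assumes "no_zero_row_or_column B"
    and "transitive_shift B"
    and "F_property B"
  shows "\<exists>(K :: bounded_seq set) v h.
    poulsen_simplex K \<and> v extreme_point_of K \<and>
    homeomorphic_map (invariant_probs_topology B)
      (top_of_set (K - {l *\<^sub>R x + (1 - l) *\<^sub>R v | x l. x \<in> K \<and> 0 \<le> l \<and> l < 1})) h \<and>
    affine_on_measures (invariant_probs B) h"
  by (rule markov_poulsen[OF assms])

end
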